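(* Let $d \ge 5$, let $1 \le p < \frac{2d}{d+2}$, and let $f \in L^1(\mathbb{R}^d) \cap L^2(\mathbb{R}^d)$. Then the periodizations satisfy $g_\rho \in L^2([0,1]^d)$ for almost every $\rho \in SO(d)$, and $$\int_{SO(d)} \|g_\rho - \hat g_\rho(0)\|_{L^2([0,1]^d)}^2 \, d\rho \le C\,(\|f\|_2 + \|f\|_p)^2,$$ where $C$ depends only on $d$ and $p$.
   Context: For $f \in L^1(\mathbb{R}^d)$ and a rotation $\rho \in SO(d)$, the periodization of $f$ with respect to the rotated integer lattice is the $\mathbb{Z}^d$-periodic function $$g_\rho(x) = \sum_{\nu \in \mathbb{Z}^d} f(\rho(x-\nu)), \qquad x \in \mathbb{R}^d,$$ regarded as a function on $[0,1]^d$. The series converges absolutely for a.e. $x$, and $g_\rho \in L^1([0,1]^d)$. For $m \in \mathbb{Z}^d$, the Fourier coefficient is $\hat g_\rho(m) = \int_{[0,1]^d} g_\rho(x)e^{-2\pi i m\cdot x}dx$. In particular $\hat g_\rho(0)=\int_{\mathbb{R}^d} f$, and $g_\rho - \hat g_\rho(0)$ means $g_\rho$ minus this constant. Here $d\rho$ denotes the normalized Haar (probability) measure on $SO(d)$. *)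

theory Defs
  imports "HOL-Analysis.Analysis" "HOL-Probability.Probability"
begin

definition SO :: "(real^'n^'n) set" where
  "SO = {A. orthogonal_matrix A \<and> det A = 1}"

text \<open>Normalized Haar measure on SO(d): a Borel probability measure on matrix space,
  concentrated on SO(d) and invariant under left multiplication by rotations.
  (Such a measure exists and is unique.)\<close>
definition haar_SO :: "(real^'n^'n) measure \<Rightarrow> bool" where
  "haar_SO \<mu> \<longleftrightarrow> prob_space \<mu> \<and> sets \<mu> = sets borel \<and> emeasure \<mu> SO = 1 \<and>
     (\<forall>Q\<in>SO. distr \<mu> \<mu> (\<lambda>A. Q ** A) = \<mu>)"

definition int_lattice :: "(real^'n) set" where
  "int_lattice = {v. \<forall>i. v $ i \<in> \<int>}"

definition unit_cube :: "(real^'n) set" where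
  "unit_cube = cbox 0 One"

definition periodization :: "(real^'n \<Rightarrow> complex) \<Rightarrow> real^'n^'n \<Rightarrow> real^'n \<Rightarrow> complex" where
  "periodization f \<rho> x = infsum (\<lambda>\<nu>. f (\<rho> *v (x - \<nu>))) int_lattice"

definition fourier_coeff :: "(real^'n \<Rightarrow> complex) \<Rightarrow> real^'n \<Rightarrow> complex" where
  "fourier_coeff g m =
     (LINT x : unit_cube | lborel. g x * exp (- 2 * pi * \<i> * complex_of_real (m \<bullet> x)))"

definition Lp_norm :: "real \<Rightarrow> (real^'n \<Rightarrow> complex) \<Rightarrow> real" where
  "Lp_norm p f = (LINT x | lborel. norm (f x) powr p) powr (1 / p)"

end

theory Submission
  imports Defs
begin

text \<open>By Parseval's identity on the torus, the left-hand side is the average over \<open>\<rho>\<close> of the sum of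
  \<open>\<bar>f^(\<rho> m)\<bar>\<^sup>2\<close> over the nonzero lattice vectors \<open>m\<close>, and by invariance of Haar measure a term depends on
  \<open>\<bar>m\<bar>\<^sup>2 = n\<close> only. The circle method bounds the number of lattice vectors with \<open>\<bar>m\<bar>\<^sup>2 = n\<close> by a multiple of
  \<open>n\<close> to the power \<open>d/2 - 1\<close>; this is where \<open>d \<ge> 5\<close> is needed. It remains to sum that power of \<open>n\<close> times
  the mean of \<open>\<bar>f^\<bar>\<^sup>2\<close> over the sphere of radius \<open>\<surd>n\<close>. Poisson summation in \<open>n\<close> turns this into
  \<open>\<Sum>\<^sub>k \<integral> exp(2\<pi>ik\<bar>\<xi>\<bar>\<^sup>2) \<bar>f^(\<xi>)\<bar>\<^sup>2 d\<xi>\<close>, whose \<open>k\<close>-th term is at most the squared \<open>L\<^sup>2\<close> norm of \<open>f\<close> by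
  Plancherel, and at most the squared \<open>L\<^sup>1\<close> norm times \<open>\<bar>2k\<bar>\<close> to the power \<open>-d/2\<close> by the dispersive
  estimate for the Schroedinger equation. Interpolating with weight \<open>\<theta> > 2/d\<close> on the second bound makes
  the series converge; applied to the level sets of \<open>f\<close>, the resulting bounds sum to the \<open>L\<^sup>p\<close> norm when
  \<open>\<theta> < 2/p - 1\<close>. Such a \<open>\<theta>\<close> exists exactly for \<open>p < 2d/(d+2)\<close>.\<close>

subsection \<open>Rotations and Haar measure\<close>

text \<open>Only upper bounds are needed, and the proof is built around that. Poisson summation is
  never carried out: a nonnegative trigonometric polynomial with coefficients in [0, 1] that
  concentrates at the integers is tested against the radial profile of |f^|^2, which leaves finitely
  many frequencies k and bounds uniform in the degree. Its d-fold product gives the needed half of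
  Parseval for integrable f, by Fatou. A factor exp(-pi \<epsilon> |\<xi>|^2) keeps integrals
  absolutely convergent before f^ is known to be square integrable. The circle method uses no major
  or minor arcs: differencing bounds the squared Weyl sum by its length times the number of
  multiples of 2\<alpha> close to integers, and the fifth moment reduces to a sum of q^(-3/2); in
  general it is q^(1 - d/2), which converges because d > 4. The power n^(d/2 - 1) so obtained is
  also the density of |\<xi>|^2 under Lebesgue measure, so counting and radial integration match up
  to a constant. A single \<theta> cannot serve f itself because the L^1 norm is not controlled by
  the L^2 and L^p norms; on a level set it is, at the price of a power of the height.\<close>

declare transpose_matrix_vector [simp del]

lemma nn_integral_lborel_translate:
  fixes h :: "'a::euclidean_space \<Rightarrow> ennreal"
  assumes [measurable]: "h \<in> borel_measurable borel"
  shows "(\<integral>\<^sup>+x. h (x + a) \<partial>lborel) = (\<integral>\<^sup>+x. h x \<partial>lborel)"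
proof -
  have "(\<integral>\<^sup>+x. h x \<partial>lborel) = (\<integral>\<^sup>+x. h x \<partial>(distr lborel borel ((+) a)))"
    by (subst lborel_distr_plus) simp
  also have "\<dots> = (\<integral>\<^sup>+x. h (x + a) \<partial>lborel)"
    by (subst nn_integral_distr) (auto simp: add.commute)
  finally show ?thesis by simp
qed

lemma nn_integral_lborel_reflect:
  fixes h :: "'a::euclidean_space \<Rightarrow> ennreal"
  assumes [measurable]: "h \<in> borel_measurable borel"
  shows "(\<integral>\<^sup>+x. h (a - x) \<partial>lborel) = (\<integral>\<^sup>+x. h x \<partial>lborel)"
proof -
  have "lborel = density (distr lborel borel (\<lambda>x. a - x)) (\<lambda>_. 1)"
    using lborel_affine[of "-1::real" a] by simp
  then have "(\<integral>\<^sup>+x. h x \<partial>lborel) = (\<integral>\<^sup>+x. h x \<partial>(density (distr lborel borel (\<lambda>x. a - x)) (\<lambda>_. 1)))"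
    by simp
  also have "\<dots> = (\<integral>\<^sup>+x. h (a - x) \<partial>lborel)"
    by (simp add: nn_integral_density nn_integral_distr)
  finally show ?thesis by simp
qed

lemma measurable_matrix_vector_mult2 [measurable]:
  fixes f :: "'a \<Rightarrow> real^'n^'m" and g :: "'a \<Rightarrow> real^'n"
  assumes [measurable]: "f \<in> borel_measurable M" "g \<in> borel_measurable M"
  shows "(\<lambda>x. f x *v g x) \<in> borel_measurable M"
proof -
  have "continuous_on UNIV (\<lambda>p::(real^'n^'m) \<times> (real^'n). fst p *v snd p)"
    unfolding matrix_vector_mult_def by (intro continuous_intros)
  then have "(\<lambda>p::(real^'n^'m) \<times> (real^'n). fst p *v snd p) \<in> borel_measurable borel"
    by (rule borel_measurable_continuous_onI)
  from measurable_compose[OF _ this, of "\<lambda>x. (f x, g x)" M] show ?thesis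
    by (simp add: borel_prod[symmetric])
qed

lemma measurable_matrix_matrix_mult2 [measurable]:
  fixes f :: "'a \<Rightarrow> real^'n^'m" and g :: "'a \<Rightarrow> real^'k^'n"
  assumes [measurable]: "f \<in> borel_measurable M" "g \<in> borel_measurable M"
  shows "(\<lambda>x. f x ** g x) \<in> borel_measurable M"
proof -
  have "continuous_on UNIV (\<lambda>p::(real^'n^'m) \<times> (real^'k^'n). fst p ** snd p)"
    unfolding matrix_matrix_mult_def by (intro continuous_intros)
  then have "(\<lambda>p::(real^'n^'m) \<times> (real^'k^'n). fst p ** snd p) \<in> borel_measurable borel"
    by (rule borel_measurable_continuous_onI)
  from measurable_compose[OF _ this, of "\<lambda>x. (f x, g x)" M] show ?thesis
    by (simp add: borel_prod[symmetric])
qed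

lemma measurable_transpose [measurable]:
  fixes f :: "'a \<Rightarrow> real^'n^'m"
  assumes [measurable]: "f \<in> borel_measurable M"
  shows "(\<lambda>x. transpose (f x)) \<in> borel_measurable M"
proof -
  have "continuous_on UNIV (\<lambda>p::real^'n^'m. transpose p)"
    unfolding transpose_def by (intro continuous_intros)
  then show ?thesis
    by (rule borel_measurable_continuous_on[OF _ assms])
qed

section \<open>Orthogonal matrices and Lebesgue measure\<close>

lemma orthogonal_matrix_cancel:
  fixes Q :: "real^'n^'n"
  assumes "orthogonal_matrix Q"
  shows "Q *v (transpose Q *v x) = x" "transpose Q *v (Q *v x) = x"
  using assms by (auto simp: matrix_vector_mul_assoc orthogonal_matrix_def)

lemma orthogonal_matrix_transformation:
  fixes Q :: "real^'n^'n"
  assumes "orthogonal_matrix Q"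
  shows "orthogonal_transformation ((*v) Q)"
  using assms by (simp add: orthogonal_transformation_matrix)

lemma orthogonal_matrix_norm:
  fixes Q :: "real^'n^'n"
  assumes "orthogonal_matrix Q"
  shows "norm (Q *v x) = norm x"
  using orthogonal_transformation_norm[OF orthogonal_matrix_transformation[OF assms]] .

lemma orthogonal_matrix_inner:
  fixes Q :: "real^'n^'n"
  assumes "orthogonal_matrix Q"
  shows "(Q *v x) \<bullet> (Q *v y) = x \<bullet> y"
  using orthogonal_matrix_transformation[OF assms] by (simp add: orthogonal_transformation_def)

text \<open>The volume preservation in the library needs a well-ordered index type. The argument below
  averages over translates in a ball instead, which costs nothing because of translation invariance.\<close>
lemma nn_integral_orthogonal:
  fixes h :: "real^'n \<Rightarrow> ennreal" and Q :: "real^'n^'n"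
  assumes [measurable]: "h \<in> borel_measurable borel" and Q: "orthogonal_matrix Q"
  shows "(\<integral>\<^sup>+x. h (Q *v x) \<partial>lborel) = (\<integral>\<^sup>+x. h x \<partial>lborel)"
proof -
  define B where "B = ball (0::real^'n) 1"
  have [measurable]: "B \<in> sets borel" by (simp add: B_def)
  have inB: "y - Q *v x \<in> B \<longleftrightarrow> transpose Q *v y - x \<in> B" for x y
  proof -
    have "norm (y - Q *v x) = norm (Q *v (transpose Q *v y - x))"
      by (simp add: matrix_vector_mult_diff_distrib orthogonal_matrix_cancel[OF Q])
    also have "\<dots> = norm (transpose Q *v y - x)" by (rule orthogonal_matrix_norm[OF Q])
    finally show ?thesis by (simp add: B_def)
  qed
  have "emeasure lborel B * (\<integral>\<^sup>+x. h (Q *v x) \<partial>lborel) = (\<integral>\<^sup>+y. indicator B y * (\<integral>\<^sup>+x. h (Q *v x) \<partial>lborel) \<partial>lborel)"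
    by (subst nn_integral_multc) auto
  also have "\<dots> = (\<integral>\<^sup>+y. indicator B y * (\<integral>\<^sup>+x. h (Q *v x + y) \<partial>lborel) \<partial>lborel)"
  proof (rule nn_integral_cong)
    fix y
    have "(\<integral>\<^sup>+x. h (Q *v x) \<partial>lborel) = (\<integral>\<^sup>+x. h (Q *v (x + transpose Q *v y)) \<partial>lborel)"
      by (subst nn_integral_lborel_translate[of "\<lambda>x. h (Q *v x)"]) auto
    then show "indicator B y * (\<integral>\<^sup>+x. h (Q *v x) \<partial>lborel) = indicator B y * (\<integral>\<^sup>+x. h (Q *v x + y) \<partial>lborel)"
      by (simp add: matrix_vector_right_distrib orthogonal_matrix_cancel[OF Q])
  qed
  also have "\<dots> = (\<integral>\<^sup>+y. (\<integral>\<^sup>+x. indicator B y * h (Q *v x + y) \<partial>lborel) \<partial>lborel)"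
    by (subst nn_integral_cmult) auto
  also have "\<dots> = (\<integral>\<^sup>+x. (\<integral>\<^sup>+y. indicator B y * h (Q *v x + y) \<partial>lborel) \<partial>lborel)"
    by (rule lborel_pair.Fubini') measurable
  also have "\<dots> = (\<integral>\<^sup>+x. (\<integral>\<^sup>+y. indicator B (y - Q *v x) * h y \<partial>lborel) \<partial>lborel)"
  proof (rule nn_integral_cong)
    fix x
    show "(\<integral>\<^sup>+y. indicator B y * h (Q *v x + y) \<partial>lborel) = (\<integral>\<^sup>+y. indicator B (y - Q *v x) * h y \<partial>lborel)"
      using nn_integral_lborel_translate[of "\<lambda>y. indicator B (y - Q *v x) * h y" "Q *v x"]
      by (simp add: add.commute)
  qed
  also have "\<dots> = (\<integral>\<^sup>+y. (\<integral>\<^sup>+x. indicator B (y - Q *v x) * h y \<partial>lborel) \<partial>lborel)"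
    by (rule lborel_pair.Fubini') measurable
  also have "\<dots> = (\<integral>\<^sup>+y. (\<integral>\<^sup>+x. indicator B (transpose Q *v y - x) \<partial>lborel) * h y \<partial>lborel)"
    by (subst nn_integral_multc) (auto simp: indicator_def inB)
  also have "\<dots> = (\<integral>\<^sup>+y. emeasure lborel B * h y \<partial>lborel)"
    by (subst nn_integral_lborel_reflect) auto
  also have "\<dots> = emeasure lborel B * (\<integral>\<^sup>+y. h y \<partial>lborel)"
    by (subst nn_integral_cmult) auto
  finally have "emeasure lborel B * (\<integral>\<^sup>+x. h (Q *v x) \<partial>lborel) = emeasure lborel B * (\<integral>\<^sup>+y. h y \<partial>lborel)" .
  moreover have "emeasure lborel B \<noteq> 0" "emeasure lborel B \<noteq> \<infinity>"
    using emeasure_ball[of 1 "0::real^'n"] unit_ball_vol_pos[of "real (DIM(real^'n))"]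
    by (auto simp: B_def simp del: unit_ball_vol_pos)
  ultimately show ?thesis by (simp add: ennreal_mult_cancel_left)
qed

lemma lborel_orthogonal:
  fixes Q :: "real^'n^'n"
  assumes Q: "orthogonal_matrix Q"
  shows "distr lborel borel (\<lambda>x. Q *v x) = lborel"
proof (rule measure_eqI)
  fix A assume "A \<in> sets (distr lborel borel (\<lambda>x. Q *v x))"
  then have A[measurable]: "A \<in> sets borel" by simp
  have "emeasure (distr lborel borel (\<lambda>x. Q *v x)) A = (\<integral>\<^sup>+x. indicator A x \<partial>distr lborel borel (\<lambda>x. Q *v x))"
    by simp
  also have "\<dots> = (\<integral>\<^sup>+x. indicator A (Q *v x) \<partial>lborel)"
    by (subst nn_integral_distr) auto
  also have "\<dots> = emeasure lborel A"
    by (subst nn_integral_orthogonal[OF _ Q]) auto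
  finally show "emeasure (distr lborel borel (\<lambda>x. Q *v x)) A = emeasure lborel A" .
qed simp

section \<open>The rotation group and its Haar integral\<close>

lemma SO_mult: "A \<in> SO \<Longrightarrow> B \<in> SO \<Longrightarrow> A ** B \<in> SO"
  by (simp add: SO_def orthogonal_matrix_mul det_mul)

lemma SO_transpose: "A \<in> SO \<Longrightarrow> transpose A \<in> SO"
  by (simp add: SO_def orthogonal_matrix_transpose)

text \<open>The witness is \<open>B ** transpose A\<close>, where A and B rotate one fixed basis
  vector to v/|v| and w/|v|. In dimension 1 the identity is the only rotation, hence the lower bound
  2.\<close>

lemma SO_transitive:
  fixes v w :: "real^'n"
  assumes "2 \<le> CARD('n)" "norm v = norm w"
  obtains Q where "Q \<in> SO" "Q *v v = w"
proof (cases "v = 0")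
  case True
  have "mat 1 \<in> (SO :: (real^'n^'n) set)" by (simp add: SO_def orthogonal_matrix_id)
  then show ?thesis using True assms that[of "mat 1"] by simp
next
  case False
  define k :: 'n where "k = undefined"
  have nz: "norm v \<noteq> 0" "norm w \<noteq> 0" using False assms by auto
  have n1: "norm (v /\<^sub>R norm v) = 1" "norm (w /\<^sub>R norm v) = 1"
    using nz assms by auto
  obtain A where A: "rotation_matrix A" "A *v axis k 1 = v /\<^sub>R norm v"
    using rotation_matrix_exists_basis[OF assms(1) n1(1)] by metis
  obtain B where B: "rotation_matrix B" "B *v axis k 1 = w /\<^sub>R norm v"
    using rotation_matrix_exists_basis[OF assms(1) n1(2)] by metis
  have SO: "A \<in> SO" "B \<in> SO" using A B by (auto simp: rotation_matrix_def SO_def)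
  have "transpose A *v (v /\<^sub>R norm v) = axis k 1"
    using A(2) orthogonal_matrix_cancel(2)[of A "axis k 1"] SO by (simp add: SO_def)
  then have "(B ** transpose A) *v (v /\<^sub>R norm v) = w /\<^sub>R norm v"
    using B(2) by (simp only: matrix_vector_mul_assoc[symmetric])
  then have "(B ** transpose A) *v v = w"
    using nz by (simp add: matrix_vector_mult_scaleR)
  then show ?thesis using that[of "B ** transpose A"] SO SO_mult SO_transpose by blast
qed

lemma haar_SO_left:
  assumes "haar_SO \<mu>" "Q \<in> SO" and [measurable]: "h \<in> borel_measurable borel"
  shows "(\<integral>\<^sup>+A. h (Q ** A) \<partial>\<mu>) = (\<integral>\<^sup>+A. h A \<partial>\<mu>)"
proof -
  have s[measurable_cong]: "sets \<mu> = sets borel" and d: "distr \<mu> \<mu> (\<lambda>A. Q ** A) = \<mu>"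
    using assms by (auto simp: haar_SO_def)
  have "(\<integral>\<^sup>+A. h A \<partial>\<mu>) = (\<integral>\<^sup>+A. h A \<partial>distr \<mu> \<mu> (\<lambda>A. Q ** A))" using d by simp
  also have "\<dots> = (\<integral>\<^sup>+A. h (Q ** A) \<partial>\<mu>)" by (subst nn_integral_distr) auto
  finally show ?thesis by simp
qed

lemma haar_SO_AE:
  assumes "haar_SO \<mu>"
  shows "AE A in \<mu>. A \<in> SO"
proof -
  interpret prob_space \<mu> using assms by (simp add: haar_SO_def)
  have [measurable_cong]: "sets \<mu> = sets borel" using assms by (simp add: haar_SO_def)
  show ?thesis
    using assms by (intro AE_prob_1) (simp add: haar_SO_def measure_def)
qed

text \<open>Left and right Haar measure agree: compare \<open>\<integral>\<integral> h (A\<^sup>T B)\<close> computed in both orders.\<close>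
lemma haar_SO_transpose:
  assumes haar: "haar_SO \<mu>" and [measurable]: "h \<in> borel_measurable borel"
  shows "(\<integral>\<^sup>+A. h (transpose A) \<partial>\<mu>) = (\<integral>\<^sup>+A. h A \<partial>\<mu>)"
proof -
  interpret prob_space \<mu> using haar by (simp add: haar_SO_def)
  interpret pair_sigma_finite \<mu> \<mu> ..
  have s[measurable_cong]: "sets \<mu> = sets borel" using haar by (simp add: haar_SO_def)
  have "(\<integral>\<^sup>+A. h A \<partial>\<mu>) = (\<integral>\<^sup>+A. (\<integral>\<^sup>+B. h B \<partial>\<mu>) \<partial>\<mu>)"
    by (simp add: emeasure_space_1)
  also have "\<dots> = (\<integral>\<^sup>+A. (\<integral>\<^sup>+B. h (transpose A ** B) \<partial>\<mu>) \<partial>\<mu>)"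
    using haar_SO_AE[OF haar]
    by (intro nn_integral_cong_AE) (auto elim!: eventually_mono simp: haar_SO_left[OF haar SO_transpose])
  also have "\<dots> = (\<integral>\<^sup>+B. (\<integral>\<^sup>+A. h (transpose A ** B) \<partial>\<mu>) \<partial>\<mu>)"
    by (rule Fubini') measurable
  also have "\<dots> = (\<integral>\<^sup>+B. (\<integral>\<^sup>+A. h (transpose (transpose B ** A)) \<partial>\<mu>) \<partial>\<mu>)"
    by (simp add: matrix_transpose_mul)
  also have "\<dots> = (\<integral>\<^sup>+B. (\<integral>\<^sup>+A. h (transpose A) \<partial>\<mu>) \<partial>\<mu>)"
    using haar_SO_AE[OF haar]
    by (intro nn_integral_cong_AE)
       (auto elim!: eventually_mono simp: haar_SO_left[OF haar SO_transpose, of _ "\<lambda>A. h (transpose A)"])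
  also have "\<dots> = (\<integral>\<^sup>+A. h (transpose A) \<partial>\<mu>)"
    by (simp add: emeasure_space_1)
  finally show ?thesis by simp
qed

lemma haar_SO_right:
  assumes haar: "haar_SO \<mu>" and Q: "Q \<in> SO" and [measurable]: "h \<in> borel_measurable borel"
  shows "(\<integral>\<^sup>+A. h (A ** Q) \<partial>\<mu>) = (\<integral>\<^sup>+A. h A \<partial>\<mu>)"
proof -
  have "(\<integral>\<^sup>+A. h (A ** Q) \<partial>\<mu>) = (\<integral>\<^sup>+A. h (transpose A ** Q) \<partial>\<mu>)"
    using haar_SO_transpose[OF haar, of "\<lambda>A. h (A ** Q)"] by simp
  also have "\<dots> = (\<integral>\<^sup>+A. h (transpose (transpose Q ** A)) \<partial>\<mu>)"
    by (simp add: matrix_transpose_mul)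
  also have "\<dots> = (\<integral>\<^sup>+A. h (transpose A) \<partial>\<mu>)"
    by (rule haar_SO_left[OF haar SO_transpose[OF Q], of "\<lambda>A. h (transpose A)"]) measurable
  also have "\<dots> = (\<integral>\<^sup>+A. h A \<partial>\<mu>)" by (rule haar_SO_transpose[OF haar]) measurable
  finally show ?thesis .
qed

text \<open>Right invariance absorbs the rotation that carries v to w.\<close>

lemma haar_SO_radial:
  fixes \<Phi> :: "real^'n \<Rightarrow> ennreal"
  assumes "2 \<le> CARD('n)" and haar: "haar_SO \<mu>" and [measurable]: "\<Phi> \<in> borel_measurable borel"
    and "norm v = norm w"
  shows "(\<integral>\<^sup>+A. \<Phi> (A *v v) \<partial>\<mu>) = (\<integral>\<^sup>+A. \<Phi> (A *v w) \<partial>\<mu>)"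
proof -
  obtain Q where Q: "Q \<in> SO" "Q *v v = w" using SO_transitive assms by metis
  have "(\<integral>\<^sup>+A. \<Phi> (A *v w) \<partial>\<mu>) = (\<integral>\<^sup>+A. \<Phi> ((A ** Q) *v v) \<partial>\<mu>)"
    using Q by (simp add: matrix_vector_mul_assoc[symmetric])
  also have "\<dots> = (\<integral>\<^sup>+A. \<Phi> (A *v v) \<partial>\<mu>)"
    by (rule haar_SO_right[OF haar Q(1), of "\<lambda>A. \<Phi> (A *v v)"]) measurable
  finally show ?thesis by simp
qed

text \<open>Stands in for polar coordinates: after Fubini, each fixed rotation preserves both the
  radial weight and Lebesgue measure. No surface measure on spheres is ever introduced.\<close>

lemma haar_SO_average:
  fixes \<Phi> :: "real^'n \<Rightarrow> ennreal" and u :: "real \<Rightarrow> ennreal" and \<mu> :: "(real^'n^'n) measure"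
  assumes haar: "haar_SO \<mu>" and [measurable]: "\<Phi> \<in> borel_measurable borel" "u \<in> borel_measurable borel"
  shows "(\<integral>\<^sup>+\<xi>. u (norm \<xi>) * (\<integral>\<^sup>+A. \<Phi> (A *v \<xi>) \<partial>\<mu>) \<partial>lborel) = (\<integral>\<^sup>+\<xi>. u (norm \<xi>) * \<Phi> \<xi> \<partial>lborel)"
proof -
  interpret prob_space \<mu> using haar by (simp add: haar_SO_def)
  interpret pair_sigma_finite \<mu> "lborel :: (real^'n) measure" ..
  have s[measurable_cong]: "sets \<mu> = sets borel" using haar by (simp add: haar_SO_def)
  have "(\<integral>\<^sup>+\<xi>. u (norm \<xi>) * (\<integral>\<^sup>+A. \<Phi> (A *v \<xi>) \<partial>\<mu>) \<partial>lborel) = (\<integral>\<^sup>+\<xi>. (\<integral>\<^sup>+A. u (norm \<xi>) * \<Phi> (A *v \<xi>) \<partial>\<mu>) \<partial>lborel)"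
    by (subst nn_integral_cmult) auto
  also have "\<dots> = (\<integral>\<^sup>+A. (\<integral>\<^sup>+\<xi>. u (norm \<xi>) * \<Phi> (A *v \<xi>) \<partial>lborel) \<partial>\<mu>)"
    by (rule Fubini') measurable
  also have "\<dots> = (\<integral>\<^sup>+A. (\<integral>\<^sup>+\<xi>. u (norm \<xi>) * \<Phi> \<xi> \<partial>lborel) \<partial>\<mu>)"
  proof (intro nn_integral_cong_AE, use haar_SO_AE[OF haar] in eventually_elim)
    fix A :: "real^'n^'n" assume "A \<in> SO"
    then have A: "orthogonal_matrix A" by (simp add: SO_def)
    show "(\<integral>\<^sup>+\<xi>. u (norm \<xi>) * \<Phi> (A *v \<xi>) \<partial>lborel) = (\<integral>\<^sup>+\<xi>. u (norm \<xi>) * \<Phi> \<xi> \<partial>lborel)"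
      using nn_integral_orthogonal[OF _ A, of "\<lambda>\<xi>. u (norm \<xi>) * \<Phi> \<xi>"]
      by (simp add: orthogonal_matrix_norm[OF A])
  qed
  finally show ?thesis by (simp add: emeasure_space_1)
qed

subsection \<open>Exponentials and the distance to the nearest integer\<close>

definition ee :: "real \<Rightarrow> complex" where
  "ee t = cis (2 * pi * t)"

lemma ee_add: "ee (s + t) = ee s * ee t"
  by (simp add: ee_def cis_mult distrib_left)

lemma ee_0 [simp]: "ee 0 = 1"
  by (simp add: ee_def)

lemma norm_ee [simp]: "norm (ee t) = 1"
  by (simp add: ee_def)

lemma cnj_ee: "cnj (ee t) = ee (- t)"
  by (simp add: ee_def cis_cnj)

lemma ee_diff: "ee (s - t) = ee s * cnj (ee t)"
  using ee_add[of s "- t"] by (simp add: cnj_ee)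

lemma ee_sum: "ee (\<Sum>i\<in>A. f i) = (\<Prod>i\<in>A. ee (f i))"
  by (induction A rule: infinite_finite_induct) (auto simp: ee_add)

lemma ee_of_int [simp]: "ee (of_int k) = 1"
  using cis_multiple_2pi[of "of_int k"] by (simp add: ee_def)

lemma ee_Ints: "t \<in> \<int> \<Longrightarrow> ee t = 1"
  by (auto elim: Ints_cases)

lemma ee_power: "ee (of_nat n * t) = ee t ^ n"
  by (simp add: ee_def Complex.DeMoivre mult_ac)

lemma continuous_on_ee [continuous_intros]:
  "continuous_on A f \<Longrightarrow> continuous_on A (\<lambda>x. ee (f x))"
  unfolding ee_def cis_conv_exp by (intro continuous_intros)

lemma isCont_ee: "isCont ee t"
  using continuous_on_ee[OF continuous_on_id, of UNIV] by (simp add: continuous_on_eq_continuous_at)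

lemma measurable_ee [measurable]: "ee \<in> borel_measurable borel"
  by (rule borel_measurable_continuous_onI) (intro continuous_intros)

lemma ee_conv_exp: "ee t = exp (2 * pi * \<i> * complex_of_real t)"
  by (simp add: ee_def cis_conv_exp mult_ac)

lemma ee_has_vector_derivative:
  "((\<lambda>t. ee (k * t)) has_vector_derivative (2 * pi * \<i> * k) * ee (k * t)) (at t within A)"
  unfolding ee_conv_exp
  by (auto intro!: derivative_eq_intros has_vector_derivative_real_field simp: algebra_simps)

lemma integral_ee_period:
  "(\<integral>t. indicator {a..a+1} t *\<^sub>R ee (of_int k * t) \<partial>lborel) = (if k = 0 then 1 else 0)"
proof (cases "k = 0")
  case False
  let ?F = "\<lambda>t. ee (of_int k * t) / (2 * pi * \<i> * of_int k)"
  have "(\<integral>t. indicator {a..a+1} t *\<^sub>R ee (of_int k * t) \<partial>lborel) = ?F (a + 1) - ?F a"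
  proof (rule integral_FTC_Icc)
    fix t :: real
    have "((\<lambda>t. ee (of_int k * t) * inverse (2 * pi * \<i> * of_int k)) has_vector_derivative
        (2 * pi * \<i> * real_of_int k) * ee (of_int k * t) * inverse (2 * pi * \<i> * of_int k)) (at t within {a..a+1})"
      by (intro has_vector_derivative_mult_left ee_has_vector_derivative)
    then show "(?F has_vector_derivative ee (of_int k * t)) (at t within {a..a+1})"
      using False by (simp add: field_simps)
  qed (auto intro!: continuous_intros)
  also have "\<dots> = 0" by (simp add: distrib_left ee_add)
  finally show ?thesis using False by simp
qed simp

lemma integral_ee:
  "(\<integral>t. indicator {0..1} t *\<^sub>R ee (of_int k * t) \<partial>lborel) = (if k = 0 then 1 else 0)"
  using integral_ee_period[of 0 k] by simp

lemma norm_one_minus_ee: "norm (1 - ee t) = 2 * \<bar>sin (pi * t)\<bar>"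
proof -
  have "norm (1 - ee t) = norm (exp (\<i> * of_real (2 * pi * t)) - 1)"
    unfolding ee_def cis_conv_exp by (rule norm_minus_commute)
  then show ?thesis using dist_exp_i_1[of "2 * pi * t"] by simp
qed

definition distZ :: "real \<Rightarrow> real" where
  "distZ t = \<bar>t - of_int (round t)\<bar>"

lemma distZ_le: "distZ t \<le> \<bar>t - of_int k\<bar>"
  unfolding distZ_def by (rule round_diff_minimal)

lemma distZ_nonneg [simp]: "0 \<le> distZ t"
  by (simp add: distZ_def)

lemma distZ_le_half: "distZ t \<le> 1 / 2"
  using of_int_round_abs_le[of t] by (simp add: distZ_def abs_minus_commute)

lemma distZ_minus: "distZ (- t) = distZ t"
proof -
  have "distZ (- t) \<le> distZ t" for t
    using distZ_le[of "- t" "- round t"] by (simp add: distZ_def)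
  from this[of t] this[of "- t"] show ?thesis by simp
qed

lemma measurable_distZ [measurable]: "distZ \<in> borel_measurable borel"
  unfolding distZ_def[abs_def] round_def by measurable

text \<open>|1 - ee t| = 2 |sin (pi t)|, and reduction modulo 1 leaves |sin (pi s)| >= |s| for |s|
  <= 1/2. The sharp factor 4 is given up for a short proof.\<close>

lemma norm_one_minus_ee_ge: "2 * distZ t \<le> norm (1 - ee t)"
proof -
  define s where "s = t - of_int (round t)"
  have s: "\<bar>s\<bar> \<le> 1 / 2" using distZ_le_half[of t] by (simp add: s_def distZ_def)
  have "ee t = ee s" using ee_add[of s "of_int (round t)"] by (simp add: s_def)
  then have "norm (1 - ee t) = 2 * \<bar>sin (pi * s)\<bar>" by (simp add: norm_one_minus_ee)
  moreover have "\<bar>s\<bar> \<le> \<bar>sin (pi * s)\<bar>"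
  proof -
    let ?x = "pi * s"
    \<comment> \<open>Cubic Taylor error: |x| <= 1.6 makes it at most |x|/2, so |sin x| >= |x|/2 >=
      |s|.\<close>
    have b: "\<bar>sin ?x - ?x\<bar> \<le> \<bar>?x\<bar> ^ 3 / 6"
      using Maclaurin_sin_bound[of ?x 3] by (simp add: sin_coeff_def numeral_3_eq_3 fact_numeral)
    have p: "3 < pi" "pi < 3.2" using pi_approx by auto
    have x: "\<bar>?x\<bar> \<le> 1.6"
    proof -
      have "pi * \<bar>s\<bar> \<le> 3.2 * (1 / 2)" using p s by (intro mult_mono) auto
      then show ?thesis by (simp add: abs_mult)
    qed
    have "\<bar>?x\<bar> ^ 3 = \<bar>?x\<bar> ^ 2 * \<bar>?x\<bar>" by (simp add: power3_eq_cube power2_eq_square)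
    also have "\<dots> \<le> 1.6 ^ 2 * \<bar>?x\<bar>" using x by (intro mult_right_mono power_mono) auto
    finally have "\<bar>?x\<bar> ^ 3 / 6 \<le> \<bar>?x\<bar> / 2" by (simp add: power2_eq_square)
    then have "\<bar>?x\<bar> / 2 \<le> \<bar>sin ?x\<bar>" using b by linarith
    moreover have "\<bar>s\<bar> \<le> \<bar>?x\<bar> / 2" using p mult_right_mono[of 2 pi "\<bar>s\<bar>"] by (simp add: abs_mult)
    ultimately show ?thesis by simp
  qed
  ultimately show ?thesis by (simp add: distZ_def s_def)
qed

subsection \<open>Counting lattice points on spheres\<close>

text \<open>Summation by parts twice. Multiplication by
  \<open>ee \<beta> - 2 + ee (- \<beta>)\<close>, whose modulus is |1 - ee \<beta>|^2, transfers a
  second difference to the weight; since W vanishes from |k| = L on, no boundary terms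
  survive.\<close>

lemma second_difference_bound:
  fixes W :: "int \<Rightarrow> real" and L :: int and \<beta> :: real
  assumes W0: "\<And>k. \<bar>k\<bar> \<ge> L \<Longrightarrow> W k = 0" and L: "L > 0"
  shows "norm (\<Sum>k\<in>{-L..L}. W k * ee (k * \<beta>)) * (norm (1 - ee \<beta>))\<^sup>2
    \<le> (\<Sum>k\<in>{-L..L}. \<bar>W (k + 1) - 2 * W k + W (k - 1)\<bar>)"
proof -
  define T where "T = (\<Sum>k\<in>{-L..L}. W k * ee (k * \<beta>))"
  have s1: "(\<Sum>k\<in>{-L..L}. W k * ee ((k + 1) * \<beta>)) = (\<Sum>k\<in>{-L..L}. W (k - 1) * ee (k * \<beta>))"
  proof -
    have "(\<Sum>k\<in>{-L..L}. W k * ee ((k + 1) * \<beta>)) = (\<Sum>k\<in>{-L+1..L+1}. W (k - 1) * ee (k * \<beta>))"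
      by (rule sum.reindex_bij_witness[of _ "\<lambda>k. k - 1" "\<lambda>k. k + 1"]) auto
    also have "\<dots> = (\<Sum>k\<in>{-L..L+1}. W (k - 1) * ee (k * \<beta>))"
      using W0 L by (intro sum.mono_neutral_left) auto
    also have "\<dots> = (\<Sum>k\<in>{-L..L}. W (k - 1) * ee (k * \<beta>))"
      using W0 L by (intro sum.mono_neutral_right) auto
    finally show ?thesis .
  qed
  have s2: "(\<Sum>k\<in>{-L..L}. W k * ee ((k - 1) * \<beta>)) = (\<Sum>k\<in>{-L..L}. W (k + 1) * ee (k * \<beta>))"
  proof -
    have "(\<Sum>k\<in>{-L..L}. W k * ee ((k - 1) * \<beta>)) = (\<Sum>k\<in>{-L-1..L-1}. W (k + 1) * ee (k * \<beta>))"
      by (rule sum.reindex_bij_witness[of _ "\<lambda>k. k + 1" "\<lambda>k. k - 1"]) auto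
    also have "\<dots> = (\<Sum>k\<in>{-L-1..L}. W (k + 1) * ee (k * \<beta>))"
      using W0 L by (intro sum.mono_neutral_left) auto
    also have "\<dots> = (\<Sum>k\<in>{-L..L}. W (k + 1) * ee (k * \<beta>))"
      using W0 L by (intro sum.mono_neutral_right) auto
    finally show ?thesis .
  qed
  have "T * (ee \<beta> - 2 + ee (- \<beta>)) = (\<Sum>k\<in>{-L..L}. W k * ee ((k + 1) * \<beta>)) - 2 * T + (\<Sum>k\<in>{-L..L}. W k * ee ((k - 1) * \<beta>))"
    unfolding T_def sum_distrib_left sum_distrib_right sum_subtractf[symmetric] sum.distrib[symmetric]
  proof (intro sum.cong refl)
    fix k :: int
    have e: "ee ((k + 1) * \<beta>) = ee (k * \<beta>) * ee \<beta>" "ee ((k - 1) * \<beta>) = ee (k * \<beta>) * ee (- \<beta>)"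
      using ee_add[of "k * \<beta>" \<beta>] ee_add[of "k * \<beta>" "- \<beta>"] by (simp_all add: distrib_right left_diff_distrib)
    show "W k * ee (k * \<beta>) * (ee \<beta> - 2 + ee (- \<beta>)) = W k * ee ((k + 1) * \<beta>) - 2 * (W k * ee (k * \<beta>)) + W k * ee ((k - 1) * \<beta>)"
      unfolding e by (simp add: ring_distribs)
  qed
  also have "\<dots> = (\<Sum>k\<in>{-L..L}. (W (k + 1) - 2 * W k + W (k - 1)) * ee (k * \<beta>))"
    unfolding s1 s2 unfolding T_def sum_distrib_left sum_subtractf[symmetric] sum.distrib[symmetric]
    by (intro sum.cong) (auto simp: algebra_simps)
  finally have "norm (T * (ee \<beta> - 2 + ee (- \<beta>))) = norm (\<Sum>k\<in>{-L..L}. (W (k + 1) - 2 * W k + W (k - 1)) * ee (k * \<beta>))"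
    by simp
  also have "\<dots> \<le> (\<Sum>k\<in>{-L..L}. norm (complex_of_real (W (k + 1) - 2 * W k + W (k - 1)) * ee (k * \<beta>)))"
    using norm_sum by (simp only: of_real_add of_real_diff of_real_mult of_real_numeral)
  also have "\<dots> = (\<Sum>k\<in>{-L..L}. \<bar>W (k + 1) - 2 * W k + W (k - 1)\<bar>)"
    by (simp only: norm_mult norm_of_real norm_ee mult_1_right)
  finally have "norm T * norm (ee \<beta> - 2 + ee (- \<beta>)) \<le> \<dots>" by (simp add: norm_mult)
  moreover have "norm (ee \<beta> - 2 + ee (- \<beta>)) = (norm (1 - ee \<beta>))\<^sup>2"
  proof -
    have "(1 - ee \<beta>) * cnj (1 - ee \<beta>) = - (ee \<beta> - 2 + ee (- \<beta>))"
      using ee_add[of \<beta> "- \<beta>"] by (simp add: cnj_ee algebra_simps)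
    then have "norm ((1 - ee \<beta>) * cnj (1 - ee \<beta>)) = norm (ee \<beta> - 2 + ee (- \<beta>))"
      by (simp only: norm_minus_cancel)
    then show ?thesis by (simp only: norm_mult complex_mod_cnj power2_eq_square)
  qed
  ultimately show ?thesis by (simp add: T_def)
qed

text \<open>A Fejer-type weight instead of a sharp cutoff: being piecewise linear, it makes linear
  exponential sums decay like the inverse square of the distance to the integers. That is summable
  over arcs, whereas a sharp cutoff gives only the first power and costs a logarithm.\<close>

definition tri :: "int \<Rightarrow> int \<Rightarrow> real" where
  "tri L k = max 0 (1 - \<bar>of_int k\<bar> / of_int L)"

lemma tri_bounds: "L > 0 \<Longrightarrow> 0 \<le> tri L k" "L > 0 \<Longrightarrow> tri L k \<le> 1"
  by (auto simp: tri_def)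

lemma tri_eq_0: "L > 0 \<Longrightarrow> \<bar>k\<bar> \<ge> L \<Longrightarrow> tri L k = 0"
  by (simp add: tri_def max_def field_simps) linarith

lemma tri_lipschitz: "L > 0 \<Longrightarrow> \<bar>tri L (k + 1) - tri L k\<bar> \<le> 1 / of_int L"
proof -
  assume L: "L > 0"
  have m: "\<bar>max 0 a - max 0 b\<bar> \<le> \<bar>a - b\<bar>" for a b :: real by (simp add: max_def)
  have "\<bar>tri L (k + 1) - tri L k\<bar> \<le> \<bar>(\<bar>of_int k\<bar> - \<bar>of_int (k + 1)\<bar>) / (of_int L :: real)\<bar>"
    unfolding tri_def by (rule order_trans[OF m]) (simp add: diff_divide_distrib)
  also have "\<dots> \<le> 1 / of_int L" using L by (simp add: abs_divide divide_le_cancel)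
  finally show ?thesis .
qed

text \<open>The weight is piecewise linear, so only its kinks at -L, 0 and L contribute; each
  contributes at most two steps of slope 1/L.\<close>

lemma tri_second_difference:
  assumes L: "L > 0"
  shows "\<bar>tri L (k + 1) - 2 * tri L k + tri L (k - 1)\<bar> \<le> (if k \<in> {-L, 0, L} then 2 / of_int L else 0)"
proof -
  have e: "tri L j = (if \<bar>j\<bar> \<le> L then 1 - \<bar>of_int j\<bar> / of_int L else 0)" for j
    using L by (auto simp: tri_def max_def field_simps)
  consider "k \<in> {-L, 0, L}" | "k < -L" | "-L < k" "k < 0" | "0 < k" "k < L" | "L < k" by fastforce
  then show ?thesis
  proof cases
    case 1
    then show ?thesis
      using tri_lipschitz[OF L, of k] tri_lipschitz[OF L, of "k - 1"] by (auto simp: abs_if split: if_splits)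
  next
    case 2 then show ?thesis using L by (simp add: tri_eq_0)
  next
    case 3 then show ?thesis using L by (auto simp: e field_simps)
  next
    case 4 then show ?thesis using L by (auto simp: e field_simps)
  next
    case 5 then show ?thesis using L by (simp add: tri_eq_0)
  qed
qed

lemma tri_sum_second_difference:
  assumes L: "L > 0" and A: "finite A"
  shows "(\<Sum>k\<in>A. \<bar>tri L (k + v + 1) - 2 * tri L (k + v) + tri L (k + v - 1)\<bar>) \<le> 6 / of_int L"
proof -
  have "(\<Sum>k\<in>A. \<bar>tri L (k + v + 1) - 2 * tri L (k + v) + tri L (k + v - 1)\<bar>)
      \<le> (\<Sum>k\<in>A. if k \<in> {-L - v, - v, L - v} then 2 / of_int L else 0)"
    by (intro sum_mono order_trans[OF tri_second_difference[OF L]]) auto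
  also have "\<dots> = (\<Sum>k\<in>A \<inter> {-L - v, - v, L - v}. 2 / of_int L)"
    using A by (subst sum.inter_restrict) (auto intro!: sum.cong)
  also have "\<dots> \<le> (\<Sum>k\<in>{-L - v, - v, L - v}. 2 / of_int L)"
    using L by (intro sum_mono2) auto
  also have "\<dots> \<le> 6 / of_int L"
    using L by (simp add: sum.insert_if)
  finally show ?thesis .
qed

text \<open>Discrete Leibniz rule: two terms carry a second difference of one factor, 6/L each, and
  the products of first differences add at most (2L + 1) * 2/L^2 <= 6/L.\<close>

lemma tri_product_second_difference:
  assumes L: "L > 0"
  defines "W \<equiv> \<lambda>v k. tri L k * tri L (k + v)"
  shows "(\<Sum>k\<in>{-L..L}. \<bar>W v (k + 1) - 2 * W v k + W v (k - 1)\<bar>) \<le> 18 / of_int L"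
proof -
  let ?d = "\<lambda>k. tri L (k + 1) - 2 * tri L k + tri L (k - 1)"
  have L1: "1 \<le> real_of_int L" using L by simp
  have pw: "\<bar>W v (k + 1) - 2 * W v k + W v (k - 1)\<bar> \<le> \<bar>?d k\<bar> + \<bar>?d (k + v)\<bar> + 2 / (of_int L)\<^sup>2" for k
  proof -
    define p where "p = tri L (k + 1) - tri L k"
    define q where "q = tri L (k + v + 1) - tri L (k + v)"
    define p' where "p' = tri L k - tri L (k - 1)"
    define q' where "q' = tri L (k + v) - tri L (k + v - 1)"
    have a: "\<bar>p\<bar> \<le> 1 / of_int L" "\<bar>q\<bar> \<le> 1 / of_int L" "\<bar>p'\<bar> \<le> 1 / of_int L" "\<bar>q'\<bar> \<le> 1 / of_int L"
      using tri_lipschitz[OF L, of k] tri_lipschitz[OF L, of "k - 1"] tri_lipschitz[OF L, of "k + v"] tri_lipschitz[OF L, of "k + v - 1"]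
      by (auto simp: p_def q_def p'_def q'_def)
    have "W v (k + 1) - 2 * W v k + W v (k - 1) = ?d k * tri L (k + v) + tri L k * ?d (k + v) + p * q + p' * q'"
      by (simp add: W_def p_def q_def p'_def q'_def algebra_simps)
    also have "\<bar>\<dots>\<bar> \<le> \<bar>?d k\<bar> * 1 + 1 * \<bar>?d (k + v)\<bar> + (1 / of_int L) * (1 / of_int L) + (1 / of_int L) * (1 / of_int L)"
    proof -
      have "\<bar>?d k * tri L (k + v)\<bar> \<le> \<bar>?d k\<bar> * 1"
        unfolding abs_mult using tri_bounds[OF L, of "k + v"] by (intro mult_left_mono) auto
      moreover have "\<bar>tri L k * ?d (k + v)\<bar> \<le> 1 * \<bar>?d (k + v)\<bar>"
        unfolding abs_mult using tri_bounds[OF L, of k] by (intro mult_right_mono) auto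
      moreover have "\<bar>p * q\<bar> \<le> (1 / of_int L) * (1 / of_int L)" "\<bar>p' * q'\<bar> \<le> (1 / of_int L) * (1 / of_int L)"
        using mult_mono[OF a(1) a(2)] mult_mono[OF a(3) a(4)] L by (auto simp: abs_mult)
      ultimately show ?thesis by linarith
    qed
    finally show ?thesis by (simp add: power2_eq_square)
  qed
  have "(\<Sum>k\<in>{-L..L}. \<bar>W v (k + 1) - 2 * W v k + W v (k - 1)\<bar>)
      \<le> (\<Sum>k\<in>{-L..L}. \<bar>?d k\<bar>) + (\<Sum>k\<in>{-L..L}. \<bar>?d (k + v)\<bar>) + (\<Sum>k\<in>{-L..L}. 2 / (of_int L)\<^sup>2)"
    unfolding sum.distrib[symmetric] by (intro sum_mono pw)
  also have "(\<Sum>k\<in>{-L..L}. \<bar>?d k\<bar>) \<le> 6 / of_int L"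
    using tri_sum_second_difference[OF L, of "{-L..L}" 0] by simp
  also have "(\<Sum>k\<in>{-L..L}. \<bar>?d (k + v)\<bar>) \<le> 6 / of_int L"
    using tri_sum_second_difference[OF L, of "{-L..L}" v] by simp
  also have "(\<Sum>k\<in>{-L..L}. 2 / (real_of_int L)\<^sup>2) = (2 * of_int L + 1) * (2 / (of_int L)\<^sup>2)"
    using L by simp
  also have "\<dots> \<le> (3 * of_int L) * (2 / (of_int L)\<^sup>2)"
    using L1 by (intro mult_right_mono) auto
  also have "\<dots> = 6 / of_int L" using L1 by (simp add: power2_eq_square)
  finally show ?thesis by simp
qed

text \<open>The smaller of the trivial bound and the summation-by-parts bound, with the distance of
  \<beta> to the integers measured from below by b in units of 1/(16 L), the arc length used later.
  For b >= 1 the constants give 256 * 18 = 4608, rounded up to 5000.\<close>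

lemma tri_product_sum_bound:
  fixes L v :: int and b :: nat and \<beta> :: real
  assumes L: "L > 0" and db: "real b \<le> 16 * of_int L * distZ \<beta>"
  shows "norm (\<Sum>k\<in>{-L..L}. tri L k * tri L (k + v) * ee (k * \<beta>)) \<le> 5000 * of_int L / (1 + real b)\<^sup>2"
proof -
  let ?T = "norm (\<Sum>k\<in>{-L..L}. tri L k * tri L (k + v) * ee (k * \<beta>))"
  have L1: "1 \<le> real_of_int L" using L by simp
  show ?thesis
  proof (cases "b = 0")
    case True
    have "?T \<le> (\<Sum>k\<in>{-L..L}. 1)"
      by (intro order_trans[OF norm_sum] sum_mono)
         (auto simp: norm_mult tri_bounds L intro!: mult_le_one)
    also have "\<dots> = 2 * of_int L + 1" using L by simp
    also have "\<dots> \<le> 5000 * of_int L" using L1 by linarith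
    finally show ?thesis using True by simp
  next
    case False
    then have b1: "1 \<le> real b" by simp
    have d: "0 < distZ \<beta>"
    proof (rule ccontr)
      assume "\<not> 0 < distZ \<beta>"
      then have "distZ \<beta> = 0" using distZ_nonneg[of \<beta>] by linarith
      then show False using db b1 by simp
    qed
    have "?T * (2 * distZ \<beta>)\<^sup>2 \<le> ?T * (norm (1 - ee \<beta>))\<^sup>2"
      by (intro mult_left_mono power_mono norm_one_minus_ee_ge) auto
    also have "\<dots> \<le> 18 / of_int L"
    proof -
      define W where "W = (\<lambda>k::int. tri L k * tri L (k + v))"
      have W0: "\<bar>k\<bar> \<ge> L \<Longrightarrow> W k = 0" for k using L by (simp add: W_def tri_eq_0)
      have "?T * (norm (1 - ee \<beta>))\<^sup>2 \<le> (\<Sum>k\<in>{-L..L}. \<bar>W (k + 1) - 2 * W k + W (k - 1)\<bar>)"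
        using second_difference_bound[OF W0 L] by (simp add: W_def)
      also have "\<dots> \<le> 18 / of_int L"
        using tri_product_second_difference[OF L] by (simp add: W_def)
      finally show ?thesis .
    qed
    finally have 1: "?T * (4 * (distZ \<beta>)\<^sup>2) \<le> 18 / of_int L" by (simp add: power_mult_distrib)
    have "(1 + real b)\<^sup>2 \<le> (2 * real b)\<^sup>2" using b1 by (intro power_mono) auto
    also have "\<dots> \<le> (2 * (16 * of_int L * distZ \<beta>))\<^sup>2" by (intro power_mono mult_left_mono; (rule db | simp))
    finally have 2: "(1 + real b)\<^sup>2 \<le> 1024 * (of_int L)\<^sup>2 * (distZ \<beta>)\<^sup>2" by (simp add: power_mult_distrib)
    have "?T * (1 + real b)\<^sup>2 \<le> ?T * (1024 * (of_int L)\<^sup>2 * (distZ \<beta>)\<^sup>2)"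
      using 2 by (intro mult_left_mono) auto
    also have "\<dots> = 256 * (of_int L)\<^sup>2 * (?T * (4 * (distZ \<beta>)\<^sup>2))" by simp
    also have "\<dots> \<le> 256 * (of_int L)\<^sup>2 * (18 / of_int L)" using 1 by (intro mult_left_mono) auto
    also have "\<dots> = 4608 * of_int L" using L by (simp add: power2_eq_square)
    also have "\<dots> \<le> 5000 * of_int L" using L1 by simp
    finally show ?thesis using b1 by (simp add: pos_le_divide_eq)
  qed
qed

section \<open>Weyl differencing and multiples close to integers\<close>

definition weyl_sum :: "nat \<Rightarrow> real \<Rightarrow> complex" where
  "weyl_sum L \<alpha> = (\<Sum>j\<in>{-int L..int L}. tri (int L) j * ee (of_int (j\<^sup>2) * \<alpha>))"

text \<open>With j = k + v the phase difference (k + v)^2 - k^2 = v^2 + 2 k v is linear in k; the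
  factor depending on v^2 has modulus 1 and drops out. Since j and k lie in -L..L, v lies in
  -2L..2L.\<close>

lemma weyl_differencing:
  fixes \<alpha> :: real
  assumes L: "L > 0"
  shows "(norm (weyl_sum L \<alpha>))\<^sup>2 \<le> (\<Sum>v\<in>{-2*int L..2*int L}.
    norm (\<Sum>k\<in>{-int L..int L}. tri (int L) k * tri (int L) (k + v) * ee (k * (v * (2 * \<alpha>)))))"
proof -
  let ?t = "tri (int L)" let ?I = "{-int L..int L}" let ?J = "{-2*int L..2*int L}"
  have "complex_of_real ((norm (weyl_sum L \<alpha>))\<^sup>2) = weyl_sum L \<alpha> * cnj (weyl_sum L \<alpha>)"
    by (rule complex_norm_square)
  also have "\<dots> = (\<Sum>k\<in>?I. \<Sum>j\<in>?I. ?t k * ?t j * ee ((of_int (j\<^sup>2) - of_int (k\<^sup>2)) * \<alpha>))"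
    unfolding weyl_sum_def sum_product cnj_sum
    by (subst sum.swap) (auto intro!: sum.cong simp: ee_diff left_diff_distrib)
  also have "\<dots> = (\<Sum>k\<in>?I. \<Sum>v\<in>?J. ?t k * ?t (k + v) * ee ((of_int ((k + v)\<^sup>2) - of_int (k\<^sup>2)) * \<alpha>))"
  proof (rule sum.cong[OF refl])
    fix k assume k: "k \<in> ?I"
    let ?F = "\<lambda>j. ?t k * ?t j * ee ((of_int (j\<^sup>2) - of_int (k\<^sup>2)) * \<alpha>)"
    have "(\<Sum>j\<in>?I. ?F j) = (\<Sum>v\<in>{-int L - k..int L - k}. ?F (k + v))"
      by (rule sum.reindex_bij_witness[of _ "\<lambda>v. k + v" "\<lambda>j. j - k"]) auto
    also have "\<dots> = (\<Sum>v\<in>?J. ?F (k + v))"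
      using k L by (intro sum.mono_neutral_left) (auto simp: tri_eq_0)
    finally show "(\<Sum>j\<in>?I. ?F j) = (\<Sum>v\<in>?J. ?F (k + v))" .
  qed
  also have "\<dots> = (\<Sum>v\<in>?J. \<Sum>k\<in>?I. ?t k * ?t (k + v) * ee ((of_int ((k + v)\<^sup>2) - of_int (k\<^sup>2)) * \<alpha>))"
    by (rule sum.swap)
  also have "\<dots> = (\<Sum>v\<in>?J. ee (of_int (v\<^sup>2) * \<alpha>) * (\<Sum>k\<in>?I. ?t k * ?t (k + v) * ee (k * (v * (2 * \<alpha>)))))"
    unfolding sum_distrib_left
  proof (intro sum.cong refl)
    fix v k :: int
    have "(of_int ((k + v)\<^sup>2) - of_int (k\<^sup>2)) * \<alpha> = of_int (v\<^sup>2) * \<alpha> + k * (v * (2 * \<alpha>))"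
      by (simp add: power2_eq_square algebra_simps)
    then show "?t k * ?t (k + v) * ee ((of_int ((k + v)\<^sup>2) - of_int (k\<^sup>2)) * \<alpha>) =
        ee (of_int (v\<^sup>2) * \<alpha>) * (?t k * ?t (k + v) * ee (k * (v * (2 * \<alpha>))))"
      by (simp only: ee_add mult_ac)
  qed
  finally have eq: "complex_of_real ((norm (weyl_sum L \<alpha>))\<^sup>2) = (\<Sum>v\<in>?J. ee (of_int (v\<^sup>2) * \<alpha>) * (\<Sum>k\<in>?I. ?t k * ?t (k + v) * ee (k * (v * (2 * \<alpha>)))))" .
  have "(norm (weyl_sum L \<alpha>))\<^sup>2 = norm (\<Sum>v\<in>?J. ee (of_int (v\<^sup>2) * \<alpha>) * (\<Sum>k\<in>?I. ?t k * ?t (k + v) * ee (k * (v * (2 * \<alpha>)))))"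
    unfolding eq[symmetric] by (simp only: norm_of_real abs_of_nonneg zero_le_power2)
  also have "\<dots> \<le> (\<Sum>v\<in>?J. norm (ee (of_int (v\<^sup>2) * \<alpha>) * (\<Sum>k\<in>?I. ?t k * ?t (k + v) * ee (k * (v * (2 * \<alpha>))))))"
    by (rule norm_sum)
  finally show ?thesis by (simp add: norm_mult)
qed

text \<open>The range 4L holds the differences of two elements of -2L..2L. The width 1/(16 L) is
  small enough that two errors, each multiplied by at most 4L, add up to at most 1/2, which makes an
  integer determinant vanish in \<open>near_ints_structure\<close>.\<close>

definition near_ints :: "nat \<Rightarrow> real \<Rightarrow> int set" where
  "near_ints L x = {u \<in> {-4*int L..4*int L}. distZ (of_int u * x) < 1 / (16 * real L)}"

lemma finite_near_ints [simp]: "finite (near_ints L x)"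
  by (rule finite_subset[of _ "{-4*int L..4*int L}"]) (auto simp: near_ints_def)

lemma sum_inverse_squares: "(\<Sum>n<M. 1 / (1 + real n)\<^sup>2) \<le> 2"
proof -
  have "(\<Sum>n<M. 1 / (1 + real n)\<^sup>2) \<le> 2 - 1 / real M" if "M \<ge> 1" for M
    using that
  proof (induction M rule: dec_induct)
    case (step M)
    have "1 / (1 + real M)\<^sup>2 \<le> 1 / (real M * (1 + real M))"
      using step by (intro divide_left_mono) (auto simp: power2_eq_square)
    also have "\<dots> = 1 / real M - 1 / real (Suc M)" using step by (simp add: field_simps)
    finally show ?case using step by simp
  qed simp
  from this[of M] show ?thesis
    by (cases "M = 0") (auto intro: order_trans)
qed

text \<open>The points \<open>v x\<close> modulo 1 are distributed over arcs of length \<open>1 / (16 L)\<close>; by differencing,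
  an arc never contains more points than \<^term>\<open>near_ints L x\<close> has elements.\<close>
lemma weyl_sum_le_near_ints:
  fixes \<alpha> :: real
  assumes L: "L > 0"
  shows "(norm (weyl_sum L \<alpha>))\<^sup>2 \<le> 20000 * real L * card (near_ints L (2 * \<alpha>))"
proof -
  define x where "x = 2 * \<alpha>"
  let ?J = "{-2*int L..2*int L}"
  let ?E = "near_ints L x"
  define B where "B = (\<lambda>v::int. \<lfloor>16 * real L * (v * x - round (v * x))\<rfloor>)"
  \<comment> \<open>\<open>B v\<close> numbers the arc containing v x modulo 1; \<open>b\<close> is
    the distance of an arc from 0 in full arcs, so the arcs 0 and -1 on the two sides of 0 both get
    0.\<close>
  define b where "b = (\<lambda>\<beta>::int. if \<beta> \<ge> 0 then nat \<beta> else nat (-\<beta> - 1))"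
  define M where "M = 8 * L + 1"
  have finE: "finite ?E" by (rule finite_near_ints)
  have bB: "real (b (B v)) \<le> 16 * real_of_int (int L) * distZ (v * x)" for v
  proof -
    let ?y = "16 * real L * (v * x - round (v * x))"
    have y: "of_int (B v) \<le> ?y" "?y < of_int (B v) + 1" by (auto simp: B_def)
    have "\<bar>?y\<bar> = 16 * real L * distZ (v * x)" by (simp add: distZ_def abs_mult)
    then show ?thesis using y by (auto simp: b_def)
  qed
  have Brange: "B v \<in> {-int M..<int M}" for v
  proof -
    let ?y = "16 * real L * (v * x - round (v * x))"
    have "\<bar>?y\<bar> = 16 * real L * distZ (v * x)" by (simp add: distZ_def abs_mult)
    also have "\<dots> \<le> 16 * real L * (1 / 2)" using distZ_le_half by (intro mult_left_mono) auto
    finally have y: "?y \<le> 8 * real L" "- (8 * real L) \<le> ?y" by linarith+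
    have "B v \<le> 8 * int L" unfolding B_def using y by (simp add: floor_le_iff)
    moreover have "- (8 * int L) \<le> B v" unfolding B_def using y by (simp add: le_floor_iff)
    ultimately show ?thesis by (auto simp: M_def)
  qed
  have cardB: "card {v\<in>?J. B v = \<beta>} \<le> card ?E" for \<beta>
  proof (cases "{v\<in>?J. B v = \<beta>} = {}")
    case False
    then obtain v0 where v0: "v0 \<in> ?J" "B v0 = \<beta>" by auto
    have "(\<lambda>v. v - v0) ` {v\<in>?J. B v = \<beta>} \<subseteq> ?E"
    proof (rule image_subsetI)
      fix v assume "v \<in> {v\<in>?J. B v = \<beta>}"
      then have v: "v \<in> ?J" "\<beta> = B v" by auto
      let ?y = "16 * real L * (v * x - round (v * x))"
      let ?z = "16 * real L * (v0 * x - round (v0 * x))"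
      have "of_int (B v) \<le> ?y" "?y < of_int (B v) + 1" "of_int (B v0) \<le> ?z" "?z < of_int (B v0) + 1"
        unfolding B_def by linarith+
      moreover have "B v0 = B v" using v v0 by simp
      ultimately have lt: "\<bar>?y - ?z\<bar> < 1" by linarith
      have eq: "?y - ?z = 16 * real L * (of_int (v - v0) * x - of_int (round (v * x) - round (v0 * x)))"
        by (simp add: algebra_simps)
      have "16 * real L * \<bar>of_int (v - v0) * x - of_int (round (v * x) - round (v0 * x))\<bar> < 1"
        using lt unfolding eq abs_mult by (simp only: abs_numeral abs_of_nat)
      moreover have "16 * real L * distZ (of_int (v - v0) * x)
          \<le> 16 * real L * \<bar>of_int (v - v0) * x - of_int (round (v * x) - round (v0 * x))\<bar>"
        by (rule mult_left_mono[OF distZ_le]) simp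
      ultimately have "16 * real L * distZ (of_int (v - v0) * x) < 1"
        by (rule le_less_trans[rotated])
      then show "v - v0 \<in> ?E"
        using v v0 L by (auto simp: near_ints_def field_simps)
    qed
    then have "card ((\<lambda>v. v - v0) ` {v\<in>?J. B v = \<beta>}) \<le> card ?E"
      by (intro card_mono finE)
    then show ?thesis by (subst (asm) card_image) (auto simp: inj_on_def)
  next
    case True
    then show ?thesis by (simp only: card.empty)
  qed
  have "(norm (weyl_sum L \<alpha>))\<^sup>2 \<le> (\<Sum>v\<in>?J. norm (\<Sum>k\<in>{-int L..int L}. tri (int L) k * tri (int L) (k + v) * ee (k * (v * x))))"
    unfolding x_def by (rule weyl_differencing[OF L])
  also have "\<dots> \<le> (\<Sum>v\<in>?J. 5000 * real L / (1 + real (b (B v)))\<^sup>2)"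
    using tri_product_sum_bound[of "int L" "b (B v)" "v * x" v for v] bB L by (intro sum_mono) auto
  also have "\<dots> = (\<Sum>\<beta>\<in>{-int M..<int M}. \<Sum>v\<in>{v\<in>?J. B v = \<beta>}. 5000 * real L / (1 + real (b (B v)))\<^sup>2)"
    using Brange by (intro sum.group[symmetric]) auto
  also have "\<dots> = (\<Sum>\<beta>\<in>{-int M..<int M}. real (card {v\<in>?J. B v = \<beta>}) * (5000 * real L / (1 + real (b \<beta>))\<^sup>2))"
    by (intro sum.cong refl) simp
  also have "\<dots> \<le> (\<Sum>\<beta>\<in>{-int M..<int M}. real (card ?E) * (5000 * real L / (1 + real (b \<beta>))\<^sup>2))"
    using cardB by (intro sum_mono mult_right_mono) auto
  also have "\<dots> = real (card ?E) * (5000 * real L) * (\<Sum>\<beta>\<in>{-int M..<int M}. 1 / (1 + real (b \<beta>))\<^sup>2)"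
    by (simp add: sum_distrib_left)
  \<comment> \<open>Each side of 0 contributes at most 2, the bound for the sum of inverse squares;
    hence the constant 4 * 5000 = 20000.\<close>
  also have "(\<Sum>\<beta>\<in>{-int M..<int M}. 1 / (1 + real (b \<beta>))\<^sup>2) \<le> 4"
  proof -
    have "{-int M..<int M} = {-int M..<0} \<union> {0..<int M}" by auto
    then have "(\<Sum>\<beta>\<in>{-int M..<int M}. 1 / (1 + real (b \<beta>))\<^sup>2) =
      (\<Sum>\<beta>\<in>{-int M..<0}. 1 / (1 + real (b \<beta>))\<^sup>2) + (\<Sum>\<beta>\<in>{0..<int M}. 1 / (1 + real (b \<beta>))\<^sup>2)"
      by (simp only:) (subst sum.union_disjoint, auto)
    also have "(\<Sum>\<beta>\<in>{-int M..<0}. 1 / (1 + real (b \<beta>))\<^sup>2) = (\<Sum>n<M. 1 / (1 + real n)\<^sup>2)"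
      by (rule sum.reindex_bij_witness[of _ "\<lambda>n. -int n - 1" "\<lambda>\<beta>. nat (-\<beta> - 1)"]) (auto simp: b_def)
    also have "(\<Sum>\<beta>\<in>{0..<int M}. 1 / (1 + real (b \<beta>))\<^sup>2) = (\<Sum>n<M. 1 / (1 + real n)\<^sup>2)"
      by (rule sum.reindex_bij_witness[of _ int nat]) (auto simp: b_def)
    finally show ?thesis using sum_inverse_squares[of M] by simp
  qed
  finally have "(norm (weyl_sum L \<alpha>))\<^sup>2 \<le> real (card ?E) * (5000 * real L) * 4"
    by (simp add: mult_left_mono)
  then show ?thesis by (simp add: x_def mult_ac)
qed

text \<open>Two elements \<open>u, u'\<close> with nearest integers \<open>k, k'\<close> satisfy \<open>\<bar>u k' - u' k\<bar> < 1\<close>, so that all of them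
  are multiples of the smallest positive one.\<close>
lemma near_ints_structure:
  fixes x :: real
  assumes L: "L > 0"
  obtains "card (near_ints L x) \<le> 1"
  | q m :: nat where "q \<ge> 1" "m \<ge> 1" "m * q \<le> 4 * L" "real m * distZ (q * x) < 1 / (16 * real L)"
      "card (near_ints L x) \<le> 1 + 2 * m"
proof (cases "near_ints L x \<subseteq> {0}")
  case True
  then have "card (near_ints L x) \<le> card {0::int}" by (intro card_mono) auto
  then show ?thesis using that(1) by simp
next
  case False
  let ?E = "near_ints L x"
  have finE: "finite ?E" by (rule finite_near_ints)
  define P where "P = {n::nat. n \<ge> 1 \<and> int n \<in> ?E}"
  have neg: "- u \<in> ?E" if "u \<in> ?E" for u
    using that distZ_minus[of "u * x"] by (auto simp: near_ints_def)
  obtain u where u: "u \<in> ?E" "u \<noteq> 0" using False by auto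
  have "nat \<bar>u\<bar> \<in> P" using u neg[of u] by (auto simp: P_def abs_if)
  define q where "q = (LEAST n. n \<in> P)"
  have q: "q \<in> P" unfolding q_def using \<open>nat \<bar>u\<bar> \<in> P\<close> by (rule LeastI)
  have qmin: "q \<le> n" if "n \<in> P" for n unfolding q_def using that by (rule Least_le)
  have q1: "q \<ge> 1" and qE: "int q \<in> ?E" using q by (auto simp: P_def)
  define a where "a = round (real q * x)"
  have dq: "distZ (real q * x) = \<bar>real q * x - a\<bar>" by (simp add: distZ_def a_def)
  have dq': "\<bar>real q * x - a\<bar> < 1 / (16 * real L)"
    using qE dq by (simp add: near_ints_def)
  have qL: "q \<le> 4 * L" using qE by (auto simp: near_ints_def)
  have det: "u * a = q * round (u * x)" if "u \<in> ?E" for u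
  proof -
    define k where "k = round (u * x)"
    have du: "\<bar>u * x - k\<bar> < 1 / (16 * real L)" using that by (simp add: near_ints_def distZ_def k_def)
    have uL: "\<bar>real_of_int u\<bar> \<le> 4 * real L" using that by (auto simp: near_ints_def)
    have "\<bar>real_of_int (u * a - q * k)\<bar> = \<bar>real q * (u * x - k) - u * (real q * x - a)\<bar>"
      by (simp add: algebra_simps)
    also have "\<dots> \<le> real q * \<bar>u * x - k\<bar> + \<bar>real_of_int u\<bar> * \<bar>real q * x - a\<bar>"
      by (rule order_trans[OF abs_triangle_ineq4]) (simp add: abs_mult)
    also have "\<dots> \<le> (4 * real L) * (1 / (16 * real L)) + (4 * real L) * (1 / (16 * real L))"
      using qL uL du dq' by (intro add_mono mult_mono) auto
    also have "\<dots> < 1" using L by simp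
    finally have "\<bar>u * a - q * k\<bar> < 1" by linarith
    then show ?thesis by (simp add: k_def)
  qed
  \<comment> \<open>Division with remainder: r inherits the determinant identity, so its error is
    r/q times that of q and r lies in the set again. Minimality of q leaves r = 0.\<close>
  have mult: "int q dvd u" if u: "u \<in> ?E" for u
  proof -
    define l where "l = u div int q"
    define r where "r = u mod int q"
    have ur: "u = l * int q + r" by (simp add: l_def r_def)
    have r: "0 \<le> r" "r < int q" using q1 by (auto simp: r_def)
    have "r * a = int q * (round (u * x) - l * a)"
      using det[OF u] ur by (simp add: algebra_simps)
    then have "real_of_int (r * a) = real_of_int (int q * (round (u * x) - l * a))"
      by (rule arg_cong)
    then have "real_of_int r * a = real q * (round (u * x) - l * a)"
      by simp
    then have "real q * (r * x - (round (u * x) - l * a)) = r * (real q * x - a)"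
      by (simp add: algebra_simps)
    then have "\<bar>real q * (r * x - (round (u * x) - l * a))\<bar> = \<bar>r * (real q * x - a)\<bar>"
      by (rule arg_cong)
    then have "real q * \<bar>r * x - (round (u * x) - l * a)\<bar> = r * \<bar>real q * x - a\<bar>"
      using r unfolding abs_mult by simp
    also have "\<dots> \<le> real q * \<bar>real q * x - a\<bar>" using r by (intro mult_right_mono) auto
    finally have "\<bar>r * x - (round (u * x) - l * a)\<bar> \<le> \<bar>real q * x - a\<bar>" using q1 by simp
    then have "distZ (r * x) < 1 / (16 * real L)"
      using distZ_le[of "r * x" "round (u * x) - l * a"] dq' by simp
    then have "r \<in> ?E" using r qL by (auto simp: near_ints_def)
    have "r = 0"
    proof (rule ccontr)
      assume "r \<noteq> 0"
      then have "nat r \<in> P" using r \<open>r \<in> ?E\<close> by (auto simp: P_def)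
      from qmin[OF this] show False using r by auto
    qed
    then show ?thesis using ur by simp
  qed
  define m where "m = Max ((\<lambda>u. nat (\<bar>u\<bar> div int q)) ` ?E)"
  have mE: "u div int q \<in> {-int m..int m}" if u: "u \<in> ?E" for u
  proof -
    have "nat (\<bar>u\<bar> div int q) \<le> m" unfolding m_def using finE u by (intro Max_ge) auto
    moreover obtain l where l: "u = int q * l" using mult[OF u] by auto
    ultimately show ?thesis using q1 by (auto simp: abs_mult abs_le_iff nat_le_iff)
  qed
  have card: "card ?E \<le> 1 + 2 * m"
  proof -
    have "card ?E = card ((\<lambda>u. u div int q) ` ?E)"
    proof (intro card_image[symmetric] inj_onI)
      fix u w assume "u \<in> ?E" "w \<in> ?E" and e: "u div int q = w div int q"
      then have "u = u div int q * int q" by (intro dvd_div_mult_self[OF mult, symmetric])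
      also have "\<dots> = w div int q * int q" by (simp only: e)
      also have "\<dots> = w" by (rule dvd_div_mult_self[OF mult[OF \<open>w \<in> ?E\<close>]])
      finally show "u = w" .
    qed
    also have "\<dots> \<le> card {-int m..int m}" using mE by (intro card_mono) auto
    finally show ?thesis by simp
  qed
  have m1: "1 \<le> m"
    unfolding m_def using finE qE q1 by (intro Max_ge) (auto intro!: image_eqI[of _ _ "int q"])
  have "m \<in> (\<lambda>u. nat (\<bar>u\<bar> div int q)) ` ?E" unfolding m_def using finE qE by (intro Max_in) auto
  then obtain u where u: "u \<in> ?E" "m = nat (\<bar>u\<bar> div int q)" by auto
  have mq: "int m * int q = \<bar>u\<bar>" using mult[OF u(1)] u(2) q1 by (simp add: pos_imp_zdiv_nonneg_iff)
  obtain w where w: "w \<in> ?E" "w = int m * int q"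
    using u(1) neg[OF u(1)] mq by (cases "u \<ge> 0") auto
  have "int m * int q \<le> 4 * int L" using w by (auto simp: near_ints_def)
  then have "int (m * q) \<le> int (4 * L)" by simp
  then have "m * q \<le> 4 * L" by (simp only: of_nat_le_iff)
  \<comment> \<open>The largest element is m q with nearest integer m a, so its error is m times
    that of q and still below the width.\<close>
  moreover have "real m * distZ (q * x) < 1 / (16 * real L)"
  proof -
    have "int q * round (w * x) = int q * (int m * a)" using det[OF w(1)] by (simp only: w(2) mult_ac)
    then have rw: "round (w * x) = int m * a" by (rule mult_left_cancel[THEN iffD1, rotated]) (use q1 in simp)
    have "real m * distZ (q * x) = \<bar>real m * (real q * x - a)\<bar>" by (simp add: dq abs_mult)
    also have "\<dots> = \<bar>w * x - round (w * x)\<bar>" unfolding rw using w(2) by (simp add: algebra_simps)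
    also have "\<dots> < 1 / (16 * real L)" using w(1) by (simp add: near_ints_def distZ_def)
    finally show ?thesis .
  qed
  ultimately show ?thesis using that(2)[of q m] q1 m1 card by simp
qed

section \<open>The fifth moment of the Weyl sum\<close>

lemma sqrt_power5_diff:
  assumes "0 \<le> b" "b \<le> a"
  shows "sqrt a ^ 5 - sqrt b ^ 5 \<le> 5 * (a - b) * sqrt a ^ 3"
proof -
  define A where "A = sqrt a"
  define B where "B = sqrt b"
  have AB: "0 \<le> B" "B \<le> A" using assms by (auto simp: A_def B_def)
  have sq: "a = A\<^sup>2" "b = B\<^sup>2" using assms by (auto simp: A_def B_def)
  have r: "A * A ^ 3 = A ^ 4" "A ^ 2 * A ^ 2 = A ^ 4" "A ^ 3 * A = A ^ 4"
    by (simp_all add: eval_nat_numeral)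
  have "B ^ 2 * A ^ 2 \<le> A ^ 2 * A ^ 2" "B ^ 3 * A \<le> A ^ 3 * A" "B ^ 4 \<le> A ^ 4"
    using AB by (intro mult_mono power_mono; simp)+
  moreover have "0 \<le> B * A ^ 3" "0 \<le> A ^ 4" using AB by simp_all
  moreover have "5 * (A + B) * A ^ 3 = 5 * A ^ 4 + 5 * (B * A ^ 3)"
    by (simp add: ring_distribs r mult.assoc)
  ultimately have le: "A ^ 4 + B * A ^ 3 + B ^ 2 * A ^ 2 + B ^ 3 * A + B ^ 4 \<le> 5 * (A + B) * A ^ 3"
    unfolding r by linarith
  have "A ^ 5 - B ^ 5 = (A - B) * (A ^ 4 + B * A ^ 3 + B ^ 2 * A ^ 2 + B ^ 3 * A + B ^ 4)"
    by (simp add: algebra_simps eval_nat_numeral)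
  also have "\<dots> \<le> (A - B) * (5 * (A + B) * A ^ 3)"
    using AB le by (intro mult_left_mono) auto
  also have "\<dots> = 5 * (a - b) * A ^ 3" by (simp add: sq algebra_simps power2_eq_square)
  finally show ?thesis by (simp add: A_def B_def)
qed

text \<open>Telescoping writes the 5/2-th power as a sum over l <= m, so that a condition on m can
  be imposed on each l separately and integrated term by term. The constant 60 covers 10 *
  3^(3/2).\<close>

lemma sqrt_power5_le_sum: "sqrt (1 + 2 * real m) ^ 5 \<le> 1 + (\<Sum>l=1..m. 60 * sqrt (real l) ^ 3)"
proof (induction m)
  case (Suc m)
  have "sqrt (1 + 2 * real (Suc m)) ^ 5 - sqrt (1 + 2 * real m) ^ 5 \<le> 10 * sqrt (1 + 2 * real (Suc m)) ^ 3"
    using sqrt_power5_diff[of "1 + 2 * real m" "1 + 2 * real (Suc m)"] by simp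
  also have "\<dots> \<le> 10 * sqrt (3 * real (Suc m)) ^ 3" by (intro mult_left_mono power_mono) auto
  also have "\<dots> = 10 * (3 * sqrt 3) * sqrt (real (Suc m)) ^ 3"
    by (simp only: real_sqrt_mult power_mult_distrib) (simp add: power3_eq_cube)
  also have "\<dots> \<le> 60 * sqrt (real (Suc m)) ^ 3"
    using real_sqrt_le_mono[of 3 4] by (intro mult_right_mono) auto
  finally show ?case using Suc by simp
qed simp

text \<open>The pair (q, m) from \<open>near_ints_structure\<close> varies with x. Summing over all
  admissible q and l removes the choice and leaves a majorant built from sets of known
  measure.\<close>

lemma sqrt_card_near_ints:
  fixes x :: real
  assumes L: "L > 0"
  shows "sqrt (card (near_ints L x)) ^ 5 \<le> 1 + (\<Sum>q=1..4*L. \<Sum>l=1..4*L div q.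
    60 * sqrt (real l) ^ 3 * (if real l * distZ (q * x) < 1 / (16 * real L) then 1 else 0))"
    (is "_ \<le> 1 + (\<Sum>q=1..4*L. ?s q)")
proof -
  have s0: "0 \<le> ?s q" for q by (intro sum_nonneg) auto
  consider "card (near_ints L x) \<le> 1"
  | q m :: nat where "q \<ge> 1" "m \<ge> 1" "m * q \<le> 4 * L" "real m * distZ (q * x) < 1 / (16 * real L)"
      "card (near_ints L x) \<le> 1 + 2 * m"
    using near_ints_structure[OF L, of x] by blast
  then show ?thesis
  proof cases
    case 1
    have "sqrt (card (near_ints L x)) ^ 5 \<le> 1" using 1 by (intro power_le_one) auto
    moreover have "0 \<le> (\<Sum>q=1..4*L. ?s q)" by (intro sum_nonneg s0)
    ultimately show ?thesis by linarith
  next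
    case (2 q m)
    have "1 * q \<le> m * q" using 2(2) by (intro mult_right_mono) auto
    then have qL: "q \<le> 4 * L" using 2(3) by linarith
    have mq: "m \<le> 4 * L div q" using 2 by (simp add: less_eq_div_iff_mult_less_eq)
    have "real (card (near_ints L x)) \<le> 1 + 2 * real m" using 2(5) by linarith
    then have "sqrt (card (near_ints L x)) ^ 5 \<le> sqrt (1 + 2 * real m) ^ 5"
      by (intro power_mono real_sqrt_le_mono) auto
    also have "\<dots> \<le> 1 + (\<Sum>l=1..m. 60 * sqrt (real l) ^ 3)" by (rule sqrt_power5_le_sum)
    also have "(\<Sum>l=1..m. 60 * sqrt (real l) ^ 3) = (\<Sum>l=1..m. 60 * sqrt (real l) ^ 3 * (if real l * distZ (q * x) < 1 / (16 * real L) then 1 else 0))"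
    proof (intro sum.cong refl)
      fix l assume "l \<in> {1..m}"
      then have "real l * distZ (q * x) \<le> real m * distZ (q * x)" by (intro mult_right_mono) auto
      then show "60 * sqrt (real l) ^ 3 = 60 * sqrt (real l) ^ 3 * (if real l * distZ (q * x) < 1 / (16 * real L) then 1 else 0)"
        using 2(4) by auto
    qed
    also have "\<dots> \<le> ?s q" using mq by (intro sum_mono2) auto
    also have "\<dots> \<le> (\<Sum>q=1..4*L. ?s q)"
      using 2(1) qL s0 by (intro member_le_sum) auto
    finally show ?thesis by simp
  qed
qed

text \<open>The set is covered by 2q + 1 intervals of length h/q, centred at a/(2q) for a = 0, ...,
  2q. The resulting bound does not depend on q.\<close>

lemma measure_distZ_less:
  assumes q: "q \<ge> 1" and h: "h > 0"
  shows "measure lborel {\<alpha>\<in>{0..1}. distZ (real q * (2 * \<alpha>)) < h} \<le> 3 * h"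
proof -
  define I where "I = (\<lambda>a::nat. {(real a - h) / (2 * real q)<..<(real a + h) / (2 * real q)})"
  have sub: "{\<alpha>\<in>{0..1}. distZ (real q * (2 * \<alpha>)) < h} \<subseteq> (\<Union>a\<in>{..2*q}. I a)"
  proof (rule subsetI)
    fix \<alpha> assume a: "\<alpha> \<in> {\<alpha>\<in>{0..1}. distZ (real q * (2 * \<alpha>)) < h}"
    define k where "k = round (real q * (2 * \<alpha>))"
    have "0 \<le> real q * (2 * \<alpha>)" using a by auto
    moreover have "real q * (2 * \<alpha>) \<le> real q * (2 * 1)" using a by (intro mult_left_mono) auto
    ultimately have k: "0 \<le> k" "k \<le> round (real q * 2)"
      unfolding k_def using round_mono[of 0 "real q * (2 * \<alpha>)"] round_mono[of "real q * (2 * \<alpha>)" "real q * 2"] by auto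
    have "round (real q * 2) = 2 * int q" using round_of_int[of "2 * int q"] by (simp add: mult.commute)
    then have k2: "nat k \<le> 2 * q" using k by simp
    have "\<bar>real q * (2 * \<alpha>) - real (nat k)\<bar> < h" using a k by (simp add: distZ_def k_def)
    then have "\<alpha> \<in> I (nat k)"
      using q unfolding I_def abs_less_iff by (auto simp: field_simps)
    then show "\<alpha> \<in> (\<Union>a\<in>{..2*q}. I a)" using k2 by auto
  qed
  have fin: "emeasure lborel (I a) < \<infinity>" for a
    by (cases "(real a - h) / (2 * real q) \<le> (real a + h) / (2 * real q)") (auto simp: I_def)
  have "measure lborel {\<alpha>\<in>{0..1}. distZ (real q * (2 * \<alpha>)) < h} \<le> measure lborel (\<Union>a\<in>{..2*q}. I a)"
  proof (rule measure_mono_fmeasurable[OF sub])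
    show "{\<alpha>\<in>{0..1}. distZ (real q * (2 * \<alpha>)) < h} \<in> sets lborel" by measurable
    show "(\<Union>a\<in>{..2*q}. I a) \<in> fmeasurable lborel"
      by (intro fmeasurable.finite_UN fmeasurableI fin) (auto simp: I_def)
  qed
  also have "\<dots> \<le> (\<Sum>a\<in>{..2*q}. measure lborel (I a))"
    by (intro measure_UNION_le) (auto simp: I_def)
  also have "\<dots> = (\<Sum>a\<in>{..2*q}. h / real q)"
  proof (intro sum.cong refl)
    fix a
    have "(real a + h) / (2 * real q) - (real a - h) / (2 * real q) = h / real q"
      using q by (simp add: field_simps)
    moreover have "(real a - h) / (2 * real q) \<le> (real a + h) / (2 * real q)"
      using h q by (intro divide_right_mono) auto
    ultimately show "measure lborel (I a) = h / real q" by (simp add: I_def)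
  qed
  also have "\<dots> = (2 * real q + 1) * h / real q" by simp
  also have "\<dots> \<le> (3 * real q) * h / real q"
    using q h by (intro divide_right_mono mult_right_mono) auto
  also have "\<dots> = 3 * h" using q by simp
  finally show ?thesis .
qed

text \<open>Comparison with the telescoping differences of 2 / sqrt q. The exponent 3/2 is 5/2 - 1;
  the fourth moment would lead to the harmonic series instead.\<close>

lemma sum_power_neg_three_halves: "(\<Sum>q=1..M. 1 / (real q * sqrt (real q))) \<le> 3"
proof -
  have "(\<Sum>q=1..M. 1 / (real q * sqrt (real q))) \<le> 3 - 2 / sqrt (real M)" if "M \<ge> 1" for M
    using that
  proof (induction M rule: dec_induct)
    case (step M)
    define a where "a = sqrt (real M)"
    define b where "b = sqrt (real (Suc M))"
    have a: "0 < a" "a < b" and b: "b\<^sup>2 = a\<^sup>2 + 1" using step by (auto simp: a_def b_def)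
    have "2 / a - 2 / b = 2 * (b - a) / (a * b)" using a by (simp add: field_simps)
    moreover have "(b - a) * (b + a) = 1" using b by (simp add: algebra_simps power2_eq_square)
    then have "b - a = 1 / (b + a)" using a by (simp add: field_simps)
    moreover have "1 / (b\<^sup>2 * b) \<le> 2 * (1 / (b + a)) / (a * b)"
    proof -
      have "(b + a) * (a * b) \<le> (2 * b) * (b * b)" using a by (intro mult_mono) auto
      then have "1 / ((2 * b) * (b * b)) \<le> 1 / ((b + a) * (a * b))"
        using a by (intro divide_left_mono) auto
      then show ?thesis using a by (simp add: power2_eq_square field_simps)
    qed
    ultimately have "1 / (b\<^sup>2 * b) \<le> 2 / a - 2 / b" by simp
    moreover have "real (Suc M) * sqrt (real (Suc M)) = b\<^sup>2 * b" by (simp add: b_def)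
    ultimately show ?case using step by (simp add: a_def b_def)
  qed simp
  from this[of M] show ?thesis
    by (cases "M = 0") (auto intro: order_trans)
qed

lemma norm_weyl_sum_le:
  assumes "L > 0"
  shows "norm (weyl_sum L \<alpha>) \<le> 3 * real L"
proof -
  have "norm (weyl_sum L \<alpha>) \<le> (\<Sum>j\<in>{-int L..int L}. 1)"
    unfolding weyl_sum_def using assms tri_bounds[of "int L"]
    by (intro order_trans[OF norm_sum] sum_mono) (auto simp: norm_mult)
  also have "\<dots> \<le> 3 * real L" using assms by simp
  finally show ?thesis .
qed

text \<open>The set for (q, l) has measure at most 3/(16 L l); with the weight 60 l^(3/2) and at
  most 4L/q values of l, the sum over l is at most 96 sqrt L * q^(-3/2). The sum over q is at most
  3, and 96 * 3 + 1 = 289.\<close>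

lemma set_integral_sqrt_card_near_ints:
  assumes L: "L > 0"
  defines "g \<equiv> \<lambda>\<alpha>::real. 1 + (\<Sum>q=1..4*L. \<Sum>l=1..4*L div q.
    60 * sqrt (real l) ^ 3 * (if real l * distZ (real q * (2 * \<alpha>)) < 1 / (16 * real L) then 1 else 0))"
  shows "integrable lborel (\<lambda>\<alpha>. indicator {0..1} \<alpha> * g \<alpha>)"
    and "(\<integral>\<alpha>. indicator {0..1} \<alpha> * g \<alpha> \<partial>lborel) \<le> 289 * sqrt (real L)"
proof -
  define A where "A = (\<lambda>q l. {\<alpha>::real\<in>{0..1}. distZ (real q * (2 * \<alpha>)) < 1 / (16 * real L * real l)})"
  have [measurable]: "A q l \<in> sets borel" for q l unfolding A_def by measurable
  have Afin: "emeasure lborel (A q l) < \<infinity>" for q l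
  proof -
    have "emeasure lborel (A q l) \<le> emeasure lborel {0..1::real}" by (intro emeasure_mono) (auto simp: A_def)
    then show ?thesis by (simp add: le_less_trans)
  qed
  have geq: "indicator {0..1} \<alpha> * g \<alpha> = indicator {0..1} \<alpha> + (\<Sum>q=1..4*L. \<Sum>l=1..4*L div q. 60 * sqrt (real l) ^ 3 * indicator (A q l) \<alpha>)" for \<alpha>
  proof -
    have k: "indicator {0..1} \<alpha> * (60 * sqrt (real l) ^ 3 * (if real l * distZ (real q * (2 * \<alpha>)) < 1 / (16 * real L) then 1 else 0))
       = 60 * sqrt (real l) ^ 3 * indicator (A q l) \<alpha>" if "l \<ge> 1" for q l
    proof -
      have "real l * distZ (real q * (2 * \<alpha>)) < 1 / (16 * real L) \<longleftrightarrow> distZ (real q * (2 * \<alpha>)) < 1 / (16 * real L * real l)"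
        using that L by (simp add: field_simps)
      then show ?thesis by (auto simp: A_def indicator_def)
    qed
    show ?thesis
      unfolding g_def distrib_left sum_distrib_left
      by (intro arg_cong2[where f = "(+)"] sum.cong refl k) auto
  qed
  have int: "integrable lborel (\<lambda>\<alpha>. \<Sum>q=1..4*L. \<Sum>l=1..4*L div q. 60 * sqrt (real l) ^ 3 * indicator (A q l) \<alpha>)"
    using Afin by (intro Bochner_Integration.integrable_sum integrable_mult_right integrable_real_indicator) auto
  show "integrable lborel (\<lambda>\<alpha>. indicator {0..1} \<alpha> * g \<alpha>)"
    unfolding geq by (intro Bochner_Integration.integrable_add int integrable_real_indicator) auto
  have "(\<integral>\<alpha>. indicator {0..1} \<alpha> * g \<alpha> \<partial>lborel) = 1 + (\<integral>\<alpha>. (\<Sum>q=1..4*L. \<Sum>l=1..4*L div q. 60 * sqrt (real l) ^ 3 * indicator (A q l) \<alpha>) \<partial>lborel)"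
    unfolding geq by (subst Bochner_Integration.integral_add[OF _ int]) auto
  also have "(\<integral>\<alpha>. (\<Sum>q=1..4*L. \<Sum>l=1..4*L div q. 60 * sqrt (real l) ^ 3 * indicator (A q l) \<alpha>) \<partial>lborel)
     = (\<Sum>q=1..4*L. \<Sum>l=1..4*L div q. 60 * sqrt (real l) ^ 3 * measure lborel (A q l))"
  proof -
    have I: "integrable lborel (\<lambda>\<alpha>. 60 * sqrt (real l) ^ 3 * indicator (A q l) \<alpha> :: real)" for q l
      using Afin by (intro integrable_mult_right integrable_real_indicator) auto
    have "(\<integral>\<alpha>. (\<Sum>q=1..4*L. \<Sum>l=1..4*L div q. 60 * sqrt (real l) ^ 3 * indicator (A q l) \<alpha>) \<partial>lborel)
      = (\<Sum>q=1..4*L. \<Sum>l=1..4*L div q. \<integral>\<alpha>. 60 * sqrt (real l) ^ 3 * indicator (A q l) \<alpha> \<partial>lborel)"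
      by (simp only: Bochner_Integration.integral_sum Bochner_Integration.integrable_sum I)
    then show ?thesis by simp
  qed
  also have "\<dots> \<le> (\<Sum>q=1..4*L. 96 * sqrt (real L) * (1 / (real q * sqrt (real q))))"
  proof (intro sum_mono)
    fix q assume q: "q \<in> {1..4*L}"
    let ?M = "4 * real L / real q"
    have M0: "0 < ?M" using q L by simp
    have "(\<Sum>l=1..4*L div q. 60 * sqrt (real l) ^ 3 * measure lborel (A q l)) \<le> (\<Sum>l=1..4*L div q. 12 / real L * sqrt ?M)"
    proof (intro sum_mono)
      fix l assume l: "l \<in> {1..4*L div q}"
      have "real l \<le> real (4 * L div q)" using l by simp
      also have "\<dots> \<le> ?M" using of_nat_div_le_of_nat[of "4 * L" q, where 'a = real] by simp
      finally have lM: "real l \<le> ?M" .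
      have "measure lborel (A q l) \<le> 3 * (1 / (16 * real L * real l))"
        unfolding A_def using q l L by (intro measure_distZ_less) auto
      then have "60 * sqrt (real l) ^ 3 * measure lborel (A q l) \<le> 60 * sqrt (real l) ^ 3 * (3 * (1 / (16 * real L * real l)))"
        by (intro mult_left_mono) auto
      also have "\<dots> = 180 / (16 * real L) * (sqrt (real l) ^ 3 / real l)" by simp
      also have "sqrt (real l) ^ 3 / real l = sqrt (real l)"
        using l by (simp add: power3_eq_cube real_div_sqrt)
      also have "180 / (16 * real L) * sqrt (real l) \<le> 12 / real L * sqrt ?M"
        using L lM by (intro mult_mono real_sqrt_le_mono) (auto simp: field_simps)
      finally show "60 * sqrt (real l) ^ 3 * measure lborel (A q l) \<le> 12 / real L * sqrt ?M" .
    qed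
    also have "\<dots> = real (4 * L div q) * (12 / real L * sqrt ?M)" by simp
    also have "\<dots> \<le> ?M * (12 / real L * sqrt ?M)"
      using of_nat_div_le_of_nat[of "4 * L" q, where 'a = real] by (intro mult_right_mono) auto
    also have "\<dots> = 96 * sqrt (real L) * (1 / (real q * sqrt (real q)))"
      using L by (simp add: real_sqrt_divide real_sqrt_mult)
    finally show "(\<Sum>l=1..4*L div q. 60 * sqrt (real l) ^ 3 * measure lborel (A q l)) \<le> 96 * sqrt (real L) * (1 / (real q * sqrt (real q)))" .
  qed
  also have "\<dots> = 96 * sqrt (real L) * (\<Sum>q=1..4*L. 1 / (real q * sqrt (real q)))"
    by (simp only: sum_distrib_left)
  also have "\<dots> \<le> 96 * sqrt (real L) * 3"
    by (intro mult_left_mono sum_power_neg_three_halves) auto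
  also have "1 + 96 * sqrt (real L) * 3 \<le> 289 * sqrt (real L)"
    using L by simp
  finally show "(\<integral>\<alpha>. indicator {0..1} \<alpha> * g \<alpha> \<partial>lborel) \<le> 289 * sqrt (real L)" by simp
qed

text \<open>The integral contributes 289 sqrt L and the pointwise bound sqrt (20000 L)^5; together
  they scale like L^3.\<close>

definition moment_const :: real where
  "moment_const = 289 * sqrt 20000 ^ 5"

text \<open>Five factors are averaged, the other d - 5 are bounded trivially by 3 L. The size L^(d -
  2) is the heuristic one: about L^d vectors share about L^2 values of the sum of squares.\<close>

lemma weyl_sum_moment:
  assumes L: "L > 0" and d: "d \<ge> 5"
  shows "(\<integral>\<alpha>. indicator {0..1} \<alpha> * norm (weyl_sum L \<alpha>) ^ d \<partial>lborel) \<le> moment_const * 3 ^ (d - 5) * real L ^ (d - 2)"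
proof -
  define g where "g = (\<lambda>\<alpha>::real. 1 + (\<Sum>q=1..4*L. \<Sum>l=1..4*L div q.
    60 * sqrt (real l) ^ 3 * (if real l * distZ (real q * (2 * \<alpha>)) < 1 / (16 * real L) then 1 else 0)))"
  let ?K = "(3 * real L) ^ (d - 5) * sqrt (20000 * real L) ^ 5"
  have pw: "norm (weyl_sum L \<alpha>) ^ d \<le> ?K * g \<alpha>" for \<alpha>
  proof -
    have "norm (weyl_sum L \<alpha>) = sqrt ((norm (weyl_sum L \<alpha>))\<^sup>2)" by simp
    also have "\<dots> \<le> sqrt (20000 * real L * card (near_ints L (2 * \<alpha>)))"
      using weyl_sum_le_near_ints[OF L] by (intro real_sqrt_le_mono)
    finally have "norm (weyl_sum L \<alpha>) \<le> sqrt (20000 * real L) * sqrt (card (near_ints L (2 * \<alpha>)))"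
      by (simp add: real_sqrt_mult)
    then have "norm (weyl_sum L \<alpha>) ^ 5 \<le> (sqrt (20000 * real L) * sqrt (card (near_ints L (2 * \<alpha>)))) ^ 5"
      by (intro power_mono) auto
    also have "\<dots> = sqrt (20000 * real L) ^ 5 * sqrt (card (near_ints L (2 * \<alpha>))) ^ 5"
      by (rule power_mult_distrib)
    also have "\<dots> \<le> sqrt (20000 * real L) ^ 5 * g \<alpha>"
      using sqrt_card_near_ints[OF L, of "2 * \<alpha>"] by (intro mult_left_mono) (auto simp: g_def)
    finally have 5: "norm (weyl_sum L \<alpha>) ^ 5 \<le> sqrt (20000 * real L) ^ 5 * g \<alpha>" .
    have "norm (weyl_sum L \<alpha>) ^ d = norm (weyl_sum L \<alpha>) ^ (d - 5) * norm (weyl_sum L \<alpha>) ^ 5"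
      using d by (simp flip: power_add)
    also have "\<dots> \<le> (3 * real L) ^ (d - 5) * (sqrt (20000 * real L) ^ 5 * g \<alpha>)"
      by (intro mult_mono power_mono norm_weyl_sum_le L 5) auto
    finally show ?thesis by simp
  qed
  have "(\<integral>\<alpha>. indicator {0..1} \<alpha> * norm (weyl_sum L \<alpha>) ^ d \<partial>lborel) \<le> (\<integral>\<alpha>. ?K * (indicator {0..1} \<alpha> * g \<alpha>) \<partial>lborel)"
  proof (rule integral_mono_AE')
    show "integrable lborel (\<lambda>\<alpha>. ?K * (indicator {0..1} \<alpha> * g \<alpha>))"
      unfolding g_def by (intro integrable_mult_right set_integral_sqrt_card_near_ints(1)[OF L])
    show "AE \<alpha> in lborel. indicator {0..1} \<alpha> * norm (weyl_sum L \<alpha>) ^ d \<le> ?K * (indicator {0..1} \<alpha> * g \<alpha>)"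
      using pw by (intro AE_I2) (simp add: indicator_def)
    have "0 \<le> ?K * g \<alpha>" for \<alpha>
      by (rule order_trans[OF zero_le_power[OF norm_ge_zero] pw])
    then show "AE \<alpha> in lborel. 0 \<le> ?K * (indicator {0..1} \<alpha> * g \<alpha>)"
      by (intro AE_I2) (simp add: indicator_def)
  qed
  also have "\<dots> = ?K * (\<integral>\<alpha>. indicator {0..1} \<alpha> * g \<alpha> \<partial>lborel)" by simp
  also have "\<dots> \<le> ?K * (289 * sqrt (real L))"
    unfolding g_def by (intro mult_left_mono set_integral_sqrt_card_near_ints(2)[OF L]) auto
  also have "\<dots> = moment_const * 3 ^ (d - 5) * (real L ^ (d - 5) * sqrt (real L) ^ 6)"
    by (simp add: moment_const_def real_sqrt_mult power_mult_distrib eval_nat_numeral)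
  also have "sqrt (real L) ^ 6 = real L ^ 3"
    using power_mult[of "sqrt (real L)" 2 3] by simp
  also have "real L ^ (d - 5) * real L ^ 3 = real L ^ (d - 2)"
  proof -
    have "d - 5 + 3 = d - 2" using d by simp
    then show ?thesis by (simp only: power_add[symmetric])
  qed
  finally show ?thesis .
qed

section \<open>Lattice point counts from the moment, by orthogonality\<close>

lemma weyl_sum_power:
  fixes n :: nat
  shows "weyl_sum L \<alpha> ^ CARD('n::finite) * ee (- real n * \<alpha>) =
    (\<Sum>m\<in>PiE (UNIV :: 'n set) (\<lambda>_. {-int L..int L}). (\<Prod>i\<in>UNIV. tri (int L) (m i)) * ee (of_int ((\<Sum>i\<in>UNIV. (m i)\<^sup>2) - int n) * \<alpha>))"
proof -
  have "weyl_sum L \<alpha> ^ CARD('n) = (\<Prod>i\<in>(UNIV :: 'n set). \<Sum>j\<in>{-int L..int L}. tri (int L) j * ee (of_int (j\<^sup>2) * \<alpha>))"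
    by (simp add: weyl_sum_def)
  also have "\<dots> = (\<Sum>m\<in>PiE (UNIV :: 'n set) (\<lambda>_. {-int L..int L}). \<Prod>i\<in>UNIV. tri (int L) (m i) * ee (of_int ((m i)\<^sup>2) * \<alpha>))"
    by (rule prod_sum_PiE) auto
  also have "\<dots> * ee (- real n * \<alpha>) = (\<Sum>m\<in>PiE (UNIV :: 'n set) (\<lambda>_. {-int L..int L}). (\<Prod>i\<in>UNIV. tri (int L) (m i)) * ee (of_int ((\<Sum>i\<in>UNIV. (m i)\<^sup>2) - int n) * \<alpha>))"
    unfolding sum_distrib_right
  proof (intro sum.cong refl)
    fix m :: "'n \<Rightarrow> int"
    have "of_int ((\<Sum>i\<in>UNIV. (m i)\<^sup>2) - int n) * \<alpha> = (\<Sum>i\<in>UNIV. of_int ((m i)\<^sup>2) * \<alpha>) + - real n * \<alpha>"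
      by (simp add: sum_distrib_right left_diff_distrib)
    then show "(\<Prod>i\<in>UNIV. tri (int L) (m i) * ee (of_int ((m i)\<^sup>2) * \<alpha>)) * ee (- real n * \<alpha>) =
        (\<Prod>i\<in>UNIV. tri (int L) (m i)) * ee (of_int ((\<Sum>i\<in>UNIV. (m i)\<^sup>2) - int n) * \<alpha>)"
      by (simp only: ee_add ee_sum prod.distrib of_real_prod mult.assoc)
  qed
  finally show ?thesis .
qed

text \<open>Integrating the d-th power of the Weyl sum against \<open>ee (- n \<alpha>)\<close>
  keeps exactly the vectors with sum of squares n, with their weights; the modulus of that integral
  is at most the d-th moment.\<close>

lemma card_sum_of_squares_le:
  fixes n :: nat
  assumes d: "CARD('n::finite) \<ge> 5" and n: "n \<ge> 1"
  shows "finite {m :: 'n \<Rightarrow> int. (\<Sum>i\<in>UNIV. (m i)\<^sup>2) = int n}"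
    and "real (card {m :: 'n \<Rightarrow> int. (\<Sum>i\<in>UNIV. (m i)\<^sup>2) = int n}) \<le> 12 ^ CARD('n) * moment_const * sqrt n ^ (CARD('n) - 2)"
proof -
  let ?d = "CARD('n)"
  define N where "N = nat \<lfloor>sqrt (real n)\<rfloor>"
  \<comment> \<open>Twice the largest possible coordinate, so that every coordinate of a solution
    has weight at least 1/2.\<close>
  define L where "L = 2 * N"
  define R where "R = {m :: 'n \<Rightarrow> int. (\<Sum>i\<in>UNIV. (m i)\<^sup>2) = int n}"
  let ?P = "PiE (UNIV :: 'n set) (\<lambda>_. {-int L..int L})"
  have s1: "1 \<le> sqrt (real n)" using n by simp
  then have N1: "N \<ge> 1" and "real N \<le> sqrt (real n)"
    by (auto simp: N_def le_nat_iff le_floor_iff)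
  then have L: "L > 0" and Lle: "real L \<le> 2 * sqrt (real n)" by (auto simp: L_def)
  have mi: "\<bar>m i\<bar> \<le> int N" if "m \<in> R" for m and i :: 'n
  proof -
    have "(m i)\<^sup>2 \<le> (\<Sum>i\<in>UNIV. (m i)\<^sup>2)" by (rule member_le_sum) auto
    then have "(m i)\<^sup>2 \<le> int n" using that by (simp add: R_def)
    then have "real_of_int ((m i)\<^sup>2) \<le> real_of_int (int n)" by (simp only: of_int_le_iff)
    then have "sqrt ((real_of_int (m i))\<^sup>2) \<le> sqrt (real n)" by (intro real_sqrt_le_mono) simp
    then have "of_int \<bar>m i\<bar> \<le> sqrt (real n)" by simp
    then have "\<bar>m i\<bar> \<le> \<lfloor>sqrt (real n)\<rfloor>" by (simp only: le_floor_iff)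
    then show ?thesis by (simp add: N_def)
  qed
  have RP: "R \<subseteq> ?P"
  proof
    fix m assume "m \<in> R"
    from mi[OF this] have "m i \<in> {-int L..int L}" for i
      unfolding L_def using abs_le_iff[of "m i" "int N"] by (auto intro: order_trans)
    then show "m \<in> ?P" by (simp add: PiE_def)
  qed
  have finP: "finite ?P" by (intro finite_PiE) auto
  show fin: "finite {m :: 'n \<Rightarrow> int. (\<Sum>i\<in>UNIV. (m i)\<^sup>2) = int n}"
    using finite_subset[OF RP finP] by (simp add: R_def)
  have "(\<integral>\<alpha>. indicator {0..1} \<alpha> *\<^sub>R (weyl_sum L \<alpha> ^ ?d * ee (- real n * \<alpha>)) \<partial>lborel) =
     (\<integral>\<alpha>. (\<Sum>m\<in>?P. of_real (\<Prod>i\<in>UNIV. tri (int L) (m i)) * (indicator {0..1} \<alpha> *\<^sub>R ee (of_int ((\<Sum>i\<in>UNIV. (m i)\<^sup>2) - int n) * \<alpha>))) \<partial>lborel)"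
    unfolding weyl_sum_power by (simp add: sum_distrib_left scaleR_sum_right)
  also have "\<dots> = (\<Sum>m\<in>?P. \<integral>\<alpha>. of_real (\<Prod>i\<in>UNIV. tri (int L) (m i)) * (indicator {0..1} \<alpha> *\<^sub>R ee (of_int ((\<Sum>i\<in>UNIV. (m i)\<^sup>2) - int n) * \<alpha>)) \<partial>lborel)"
    by (intro Bochner_Integration.integral_sum integrable_mult_right borel_integrable_compact[of "{0..1}"])
       (auto intro!: continuous_intros)
  also have "\<dots> = (\<Sum>m\<in>?P. of_real (\<Prod>i\<in>UNIV. tri (int L) (m i)) * (if (\<Sum>i\<in>UNIV. (m i)\<^sup>2) - int n = 0 then 1 else 0))"
    by (intro sum.cong refl) (simp only: integral_mult_right_zero integral_ee)
  also have "\<dots> = (\<Sum>m\<in>?P. if m \<in> R then of_real (\<Prod>i\<in>UNIV. tri (int L) (m i)) else 0)"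
    by (intro sum.cong refl) (auto simp: R_def)
  also have "\<dots> = (\<Sum>m\<in>R. of_real (\<Prod>i\<in>UNIV. tri (int L) (m i)))"
    using RP finP by (simp add: sum.inter_restrict[symmetric] Int_absorb1)
  finally have eq: "(\<integral>\<alpha>. indicator {0..1} \<alpha> *\<^sub>R (weyl_sum L \<alpha> ^ ?d * ee (- real n * \<alpha>)) \<partial>lborel) = complex_of_real (\<Sum>m\<in>R. \<Prod>i\<in>UNIV. tri (int L) (m i))"
    by simp
  have "(1 / 2) ^ ?d * real (card R) = (\<Sum>m\<in>R. \<Prod>i\<in>(UNIV :: 'n set). 1 / 2)" by simp
  also have "\<dots> \<le> (\<Sum>m\<in>R. \<Prod>i\<in>UNIV. tri (int L) (m i))"
  proof (intro sum_mono prod_mono conjI)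
    fix m and i :: 'n assume "m \<in> R"
    from mi[OF this, of i] have "\<bar>real_of_int (m i)\<bar> \<le> real N" by linarith
    then have "\<bar>real_of_int (m i)\<bar> / real L \<le> 1 / 2" using N1 by (simp add: L_def field_simps)
    then show "1 / 2 \<le> tri (int L) (m i)"
      unfolding tri_def by (intro max.coboundedI2) simp
  qed auto
  also have "\<dots> \<le> norm (\<integral>\<alpha>. indicator {0..1} \<alpha> *\<^sub>R (weyl_sum L \<alpha> ^ ?d * ee (- real n * \<alpha>)) \<partial>lborel)"
    unfolding eq by (simp only: norm_of_real abs_ge_self)
  also have "\<dots> \<le> (\<integral>\<alpha>. norm (indicator {0..1} \<alpha> *\<^sub>R (weyl_sum L \<alpha> ^ ?d * ee (- real n * \<alpha>))) \<partial>lborel)"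
    by (rule integral_norm_bound)
  also have "\<dots> = (\<integral>\<alpha>. indicator {0..1} \<alpha> * norm (weyl_sum L \<alpha>) ^ ?d \<partial>lborel)"
    by (simp add: norm_mult norm_power)
  also have "\<dots> \<le> moment_const * 3 ^ (?d - 5) * real L ^ (?d - 2)"
    by (rule weyl_sum_moment[OF L d])
  also have "\<dots> \<le> moment_const * 3 ^ ?d * (2 * sqrt (real n)) ^ (?d - 2)"
    using Lle by (intro mult_mono power_mono power_increasing) (auto simp: moment_const_def)
  also have "\<dots> \<le> moment_const * 3 ^ ?d * (2 ^ ?d * sqrt (real n) ^ (?d - 2))"
    unfolding power_mult_distrib
    by (intro mult_left_mono mult_right_mono power_increasing) (auto simp: moment_const_def)
  finally have le: "(1 / 2) ^ ?d * real (card R) \<le> \<dots>" .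
  have "real (card R) = 2 ^ ?d * ((1 / 2) ^ ?d * real (card R))"
    by (simp add: power_divide)
  also have "\<dots> \<le> 2 ^ ?d * (moment_const * 3 ^ ?d * (2 ^ ?d * sqrt (real n) ^ (?d - 2)))"
    by (intro mult_left_mono le) auto
  \<comment> \<open>The 12 collects 2 from the weights, 3 from the trivial bound of the Weyl sum and
    2 from L <= 2 sqrt n.\<close>
  also have "\<dots> = (2 * 3 * 2) ^ ?d * moment_const * sqrt (real n) ^ (?d - 2)"
    unfolding power_mult_distrib by (simp only: mult_ac)
  finally show "real (card {m :: 'n \<Rightarrow> int. (\<Sum>i\<in>UNIV. (m i)\<^sup>2) = int n}) \<le> 12 ^ CARD('n) * moment_const * sqrt n ^ (CARD('n) - 2)"
    by (simp add: R_def)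
qed

definition shell :: "nat \<Rightarrow> (real^'n) set" where
  "shell n = {v \<in> int_lattice. (norm v)\<^sup>2 = real n}"

lemma card_shell_le:
  assumes d: "CARD('n::finite) \<ge> 5" and n: "n \<ge> 1"
  shows "finite (shell n :: (real^'n) set)"
    and "real (card (shell n :: (real^'n) set)) \<le> 12 ^ CARD('n) * moment_const * sqrt n ^ (CARD('n) - 2)"
proof -
  define R where "R = {m :: 'n \<Rightarrow> int. (\<Sum>i\<in>UNIV. (m i)\<^sup>2) = int n}"
  have eq: "(shell n :: (real^'n) set) = (\<lambda>m. \<chi> i. of_int (m i)) ` R"
  proof (intro set_eqI iffI)
    fix v :: "real^'n" assume v: "v \<in> shell n"
    define m where "m = (\<lambda>i. \<lfloor>v $ i\<rfloor>)"
    have m: "v $ i = of_int (m i)" for i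
      using v by (auto simp: shell_def int_lattice_def m_def elim: Ints_cases dest!: spec[of _ i])
    have "(\<Sum>i\<in>UNIV. (v $ i)\<^sup>2) = real n"
      using v by (simp add: shell_def norm_vec_def L2_set_def sum_nonneg)
    then have "real_of_int (\<Sum>i\<in>UNIV. (m i)\<^sup>2) = real_of_int (int n)" by (simp add: m)
    then have "m \<in> R" unfolding R_def by (simp only: of_int_eq_iff mem_Collect_eq)
    moreover have "v = (\<chi> i. of_int (m i))" by (simp add: vec_eq_iff m)
    ultimately show "v \<in> (\<lambda>m. \<chi> i. of_int (m i)) ` R" by blast
  next
    fix v :: "real^'n" assume "v \<in> (\<lambda>m. \<chi> i. of_int (m i)) ` R"
    then obtain m where m: "m \<in> R" "v = (\<chi> i. of_int (m i))" by auto
    have "(norm v)\<^sup>2 = real_of_int (\<Sum>i\<in>UNIV. (m i)\<^sup>2)"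
      by (simp add: m norm_vec_def L2_set_def sum_nonneg)
    also have "\<dots> = real n" using m(1) by (simp add: R_def)
    finally show "v \<in> shell n" using m by (simp add: shell_def int_lattice_def)
  qed
  show "finite (shell n :: (real^'n) set)"
    unfolding eq R_def by (intro finite_imageI card_sum_of_squares_le(1) d n)
  have "card (shell n :: (real^'n) set) \<le> card R"
    unfolding eq R_def by (intro card_image_le card_sum_of_squares_le(1) d n)
  then show "real (card (shell n :: (real^'n) set)) \<le> 12 ^ CARD('n) * moment_const * sqrt n ^ (CARD('n) - 2)"
    using card_sum_of_squares_le(2)[OF d n] by (simp add: R_def)
qed

subsection \<open>The de la Vallee Poussin kernel\<close>

text \<open>Normalised to mean 1 over a period. What matters below: it is nonnegative, its Fourier
  coefficients \<open>vp_coeff\<close> lie in [0, 1], and away from the integers it is exponentially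
  small in N.\<close>

definition vp :: "nat \<Rightarrow> real \<Rightarrow> real" where
  "vp N t = 4 ^ N / real ((2 * N) choose N) * cos (pi * t) ^ (2 * N)"

definition vp_coeff :: "nat \<Rightarrow> int \<Rightarrow> real" where
  "vp_coeff N k = real ((2 * N) choose nat (int N + k)) / real ((2 * N) choose N)"

lemma vp_nonneg: "0 \<le> vp N t"
  by (simp add: vp_def power_mult)

lemma vp_coeff_bounds: "0 \<le> vp_coeff N k" "vp_coeff N k \<le> 1"
  using binomial_maximum'[of N "nat (int N + k)"] by (auto simp: vp_coeff_def divide_le_eq)

lemma vp_coeff_0 [simp]: "vp_coeff N 0 = 1"
  by (simp add: vp_coeff_def)

lemma continuous_on_vp [continuous_intros]:
  fixes f :: "'a::metric_space \<Rightarrow> real"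
  shows "continuous_on A f \<Longrightarrow> continuous_on A (\<lambda>x. vp N (f x))"
  unfolding vp_def by (intro continuous_intros)

lemma measurable_vp [measurable]: "vp N \<in> borel_measurable borel"
  by (intro borel_measurable_continuous_onI continuous_intros)

lemma one_plus_ee: "1 + ee t = 2 * cos (pi * t) * ee (t / 2)"
proof -
  have "2 * cos (pi * t) * ee (t / 2) = (ee (t / 2) + cnj (ee (t / 2))) * ee (t / 2)"
    by (simp add: ee_def complex_eq_iff)
  also have "\<dots> = 1 + ee t"
    using ee_add[of "t / 2" "t / 2"] ee_add[of "t / 2" "- t / 2"] by (simp add: cnj_ee algebra_simps)
  finally show ?thesis by simp
qed

text \<open>The binomial theorem for (1 + ee t)^(2N) = (2 cos (pi t))^(2N) * ee (N t), recentred by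
  ee (- N t).\<close>

lemma vp_expand:
  fixes t :: real
  shows "complex_of_real (vp N t) = (\<Sum>k\<in>{-int N..int N}. vp_coeff N k * ee (k * t))"
proof -
  let ?b = "complex_of_real (real ((2 * N) choose N))"
  have "(1 + ee t) ^ (2 * N) * ee (- (N * t)) = (2 * cos (pi * t)) ^ (2 * N) * (ee (t / 2) ^ (2 * N) * ee (- (N * t)))"
    unfolding one_plus_ee by (simp add: power_mult_distrib)
  also have "ee (t / 2) ^ (2 * N) * ee (- (N * t)) = 1"
    unfolding ee_power[symmetric] ee_add[symmetric] by simp
  also have "complex_of_real ((2 * cos (pi * t)) ^ (2 * N)) = of_real (4 ^ N * cos (pi * t) ^ (2 * N))"
    by (simp add: power_mult_distrib power_mult)
  finally have 1: "of_real (4 ^ N * cos (pi * t) ^ (2 * N)) = (1 + ee t) ^ (2 * N) * ee (- (N * t))"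
    by simp
  have "(1 + ee t) ^ (2 * N) = (\<Sum>j\<le>2 * N. of_nat ((2 * N) choose j) * ee (real j * t))"
    using binomial_ring[of "ee t" 1 "2 * N"] by (simp add: add.commute ee_power)
  then have "(1 + ee t) ^ (2 * N) * ee (- (N * t)) = (\<Sum>j\<le>2 * N. of_nat ((2 * N) choose j) * ee ((real j - real N) * t))"
    by (simp add: sum_distrib_right mult.assoc ee_add[symmetric] left_diff_distrib)
  also have "\<dots> = (\<Sum>k\<in>{-int N..int N}. of_nat ((2 * N) choose nat (int N + k)) * ee (k * t))"
    by (rule sum.reindex_bij_witness[of _ "\<lambda>k. nat (int N + k)" "\<lambda>j. int j - int N"]) auto
  finally have "of_real (4 ^ N * cos (pi * t) ^ (2 * N)) = (\<Sum>k\<in>{-int N..int N}. of_nat ((2 * N) choose nat (int N + k)) * ee (k * t))"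
    unfolding 1 .
  then have "of_real (4 ^ N * cos (pi * t) ^ (2 * N)) / ?b = (\<Sum>k\<in>{-int N..int N}. of_nat ((2 * N) choose nat (int N + k)) * ee (k * t)) / ?b"
    by simp
  then show ?thesis
    by (simp add: vp_def vp_coeff_def sum_divide_distrib)
qed

text \<open>4^N is a sum of 2N + 1 binomial coefficients, none above the central one; and cos^2 = 1
  - sin^2 with |sin (pi t)| >= \<open>distZ t\<close>.\<close>

lemma vp_le:
  "vp N t \<le> (2 * real N + 1) * (1 - (distZ t)\<^sup>2) ^ N"
proof -
  have "(4::real) ^ N = (\<Sum>j\<le>2 * N. real ((2 * N) choose j))"
    using choose_row_sum[of "2 * N"] by (simp add: power_mult flip: of_nat_sum)
  also have "\<dots> \<le> (\<Sum>j\<le>2 * N. real ((2 * N) choose N))"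
    by (intro sum_mono) (use binomial_maximum'[of N] in simp)
  finally have 4: "4 ^ N / real ((2 * N) choose N) \<le> 2 * real N + 1"
    by (simp add: divide_le_eq add.commute)
  have s: "distZ t \<le> \<bar>sin (pi * t)\<bar>"
    using norm_one_minus_ee_ge[of t] by (simp add: norm_one_minus_ee)
  have "(cos (pi * t))\<^sup>2 = 1 - (sin (pi * t))\<^sup>2" using sin_cos_squared_add[of "pi * t"] by linarith
  also have "\<dots> \<le> 1 - (distZ t)\<^sup>2"
    using power_mono[OF s, of 2] by simp
  finally have c: "(cos (pi * t))\<^sup>2 \<le> 1 - (distZ t)\<^sup>2" .
  have "cos (pi * t) ^ (2 * N) \<le> (1 - (distZ t)\<^sup>2) ^ N"
    unfolding power_mult by (intro power_mono c) auto
  then show ?thesis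
    unfolding vp_def by (intro mult_mono 4) (auto simp: power_mult)
qed

lemma distZ_sq_le_1: "(distZ t)\<^sup>2 \<le> 1"
  using distZ_le_half[of t] distZ_nonneg[of t] by (simp add: power_le_one)

lemma vp_le_const: "vp N t \<le> 2 * real N + 1"
proof -
  have "(2 * real N + 1) * (1 - (distZ t)\<^sup>2) ^ N \<le> (2 * real N + 1) * 1"
    using distZ_sq_le_1[of t] by (intro mult_left_mono power_le_one) auto
  from order_trans[OF vp_le this] show ?thesis by simp
qed

lemma vp_le_away:
  assumes "0 \<le> \<delta>" "\<delta> \<le> distZ t"
  shows "vp N t \<le> (2 * real N + 1) * (1 - \<delta>\<^sup>2) ^ N"
proof -
  have "\<delta>\<^sup>2 \<le> (distZ t)\<^sup>2" using assms by (intro power_mono)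
  then have "(2 * real N + 1) * (1 - (distZ t)\<^sup>2) ^ N \<le> (2 * real N + 1) * (1 - \<delta>\<^sup>2) ^ N"
    using distZ_sq_le_1[of t] by (intro mult_left_mono power_mono) auto
  from order_trans[OF vp_le this] show ?thesis .
qed

text \<open>The exponent d serves the d-fold product of the kernel. Taking a d-th root s of r
  reduces the claim to N s^N -> 0.\<close>

lemma vp_tail_tendsto_0:
  fixes r :: real
  assumes "0 < r" "r < 1" "d > 0"
  shows "(\<lambda>N. (2 * real N + 1) ^ d * r ^ N) \<longlonglongrightarrow> 0"
proof -
  define s where "s = root d r"
  have s: "0 < s" "s < 1" "s ^ d = r" using assms by (auto simp: s_def)
  have "(\<lambda>N. 2 * (real N * s ^ N) + s ^ N) \<longlonglongrightarrow> 2 * 0 + 0"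
    using s by (intro tendsto_intros powser_times_n_limit_0 LIMSEQ_realpow_zero) auto
  then have "(\<lambda>N. (2 * (real N * s ^ N) + s ^ N) ^ d) \<longlonglongrightarrow> (2 * 0 + 0) ^ d"
    by (rule tendsto_power)
  moreover have "(2 * (real N * s ^ N) + s ^ N) ^ d = (2 * real N + 1) ^ d * r ^ N" for N
  proof -
    have "2 * (real N * s ^ N) + s ^ N = (2 * real N + 1) * s ^ N" by (simp add: algebra_simps)
    moreover have "(s ^ N) ^ d = r ^ N" unfolding s(3)[symmetric] by (simp flip: power_mult add: mult.commute)
    ultimately show ?thesis by (simp add: power_mult_distrib)
  qed
  ultimately show ?thesis using assms by (simp add: power_0_left)
qed

lemma integral_vp: "(\<integral>t. indicator {a..a+1} t * vp N t \<partial>lborel) = 1"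
proof -
  have int: "integrable lborel (\<lambda>t. indicator {a..a+1} t *\<^sub>R ee (of_int k * t))" for k
    by (intro borel_integrable_compact) (auto intro!: continuous_intros)
  have "complex_of_real (\<integral>t. indicator {a..a+1} t * vp N t \<partial>lborel) = (\<integral>t. complex_of_real (indicator {a..a+1} t * vp N t) \<partial>lborel)"
    by (rule integral_complex_of_real[symmetric])
  also have "\<dots> = (\<integral>t. (\<Sum>k\<in>{-int N..int N}. vp_coeff N k * (indicator {a..a+1} t *\<^sub>R ee (k * t))) \<partial>lborel)"
    by (intro Bochner_Integration.integral_cong refl)
       (simp add: vp_expand sum_distrib_left scaleR_conv_of_real mult_ac)
  also have "\<dots> = (\<Sum>k\<in>{-int N..int N}. complex_of_real (vp_coeff N k) * (if k = 0 then 1 else 0))"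
    using int by (simp only: Bochner_Integration.integral_sum integrable_mult_right integral_mult_right_zero integral_ee_period)
  also have "\<dots> = 1" by (simp add: if_distrib cong: if_cong)
  finally show ?thesis by (simp only: of_real_eq_1_iff)
qed

lemma integrable_vp: "integrable lborel (\<lambda>t. indicator {a..b} t * vp N t)"
  using borel_integrable_compact[OF compact_Icc continuous_on_vp[OF continuous_on_id], of a b N] by simp

lemma distZ_eq:
  assumes "\<bar>t - of_int n\<bar> \<le> 1 / 2"
  shows "distZ t = \<bar>t - of_int n\<bar>"
proof (rule antisym)
  show "distZ t \<le> \<bar>t - of_int n\<bar>" by (rule distZ_le)
  show "\<bar>t - of_int n\<bar> \<le> distZ t"
  proof (cases "round t = n")
    case False
    then have "1 \<le> \<bar>round t - n\<bar>" by linarith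
    then have "real_of_int 1 \<le> of_int \<bar>round t - n\<bar>" by (simp only: of_int_le_iff)
    then have "1 \<le> \<bar>real_of_int (round t) - of_int n\<bar>" by simp
    then show ?thesis using assms unfolding distZ_def by linarith
  qed (simp add: distZ_def)
qed

text \<open>One period centred at n has mass 1, and the part of it at distance at least \<delta>
  from n carries an exponentially small mass.\<close>

lemma integral_vp_near:
  assumes "0 < \<delta>" "\<delta> \<le> 1 / 2"
  shows "1 - (2 * real N + 1) * (1 - \<delta>\<^sup>2) ^ N \<le> (\<integral>t. indicator {real_of_int n - \<delta>..n + \<delta>} t * vp N t \<partial>lborel)"
proof -
  let ?e = "(2 * real N + 1) * (1 - \<delta>\<^sup>2) ^ N"
  let ?a = "real_of_int n - 1 / 2"
  have e0: "0 \<le> ?e" using assms by (intro mult_nonneg_nonneg zero_le_power) (auto simp: power_le_one)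
  have i: "integrable lborel (\<lambda>t. indicator {?a..?a + 1} t * ?e)" by simp
  have "1 = (\<integral>t. indicator {?a..?a + 1} t * vp N t \<partial>lborel)" by (rule integral_vp[symmetric])
  also have "\<dots> \<le> (\<integral>t. indicator {real_of_int n - \<delta>..n + \<delta>} t * vp N t + indicator {?a..?a + 1} t * ?e \<partial>lborel)"
  proof (intro integral_mono integrable_vp Bochner_Integration.integrable_add i)
    fix t
    show "indicator {?a..?a + 1} t * vp N t \<le> indicator {real_of_int n - \<delta>..n + \<delta>} t * vp N t + indicator {?a..?a + 1} t * ?e"
    proof (cases "t \<in> {?a..?a + 1} \<and> t \<notin> {real_of_int n - \<delta>..n + \<delta>}")
      case True
      then have "?a \<le> t" "t \<le> ?a + 1" and or: "t < real_of_int n - \<delta> \<or> real_of_int n + \<delta> < t" by auto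
      then have 1: "\<bar>t - of_int n\<bar> \<le> 1 / 2" "\<delta> \<le> \<bar>t - of_int n\<bar>" by (linarith, use or in \<open>elim disjE; linarith\<close>)
      from distZ_eq[OF 1(1)] have "vp N t \<le> ?e" using 1 assms by (intro vp_le_away) auto
      then show ?thesis using True by simp
    qed (use e0 vp_nonneg[of N t] in \<open>auto simp: indicator_def\<close>)
  qed
  also have "\<dots> = (\<integral>t. indicator {real_of_int n - \<delta>..n + \<delta>} t * vp N t \<partial>lborel) + ?e"
    by (subst Bochner_Integration.integral_add[OF integrable_vp i]) simp
  finally show ?thesis by simp
qed

text \<open>The one-sided substitute for Poisson summation. As N grows, the kernel puts mass tending
  to 1 near each integer, where continuity keeps G close to its value at that integer; nonnegativity
  of G lets the rest of the integral be dropped. The bound B is uniform in N, which permits the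
  limit.\<close>

lemma sum_le_of_vp_bound:
  fixes G :: "real \<Rightarrow> real" and B :: real
  assumes G0: "\<And>t. 0 \<le> G t" and [measurable]: "G \<in> borel_measurable borel"
    and cont: "\<And>n. n \<in> {1..M} \<Longrightarrow> isCont G (real n)"
    and bound: "\<And>N. (\<integral>\<^sup>+t. indicator {0<..} t * ennreal (G t * vp N t) \<partial>lborel) \<le> ennreal B"
    and B0: "0 \<le> B"
  shows "(\<Sum>n=1..M. G (real n)) \<le> B"
proof -
  \<comment> \<open>Truncation at 0 keeps each summand nonnegative after the loss of \<eta>; that
    loss is removed at the end by letting \<eta> tend to 0.\<close>
  have main: "(\<Sum>n=1..M. max 0 (G (real n) - \<eta>)) \<le> B" if \<eta>: "\<eta> > 0" for \<eta>
  proof -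
    have "\<exists>\<delta>>0. \<forall>n\<in>{1..M}. \<forall>t. \<bar>t - real n\<bar> < \<delta> \<longrightarrow> G (real n) - \<eta> \<le> G t"
    proof -
      have "\<forall>n\<in>{1..M}. \<exists>\<delta>>0. \<forall>t. \<bar>t - real n\<bar> < \<delta> \<longrightarrow> G (real n) - \<eta> \<le> G t"
      proof
        fix n assume "n \<in> {1..M}"
        from cont[OF this] \<eta> obtain \<delta> where \<delta>: "\<delta> > 0" "\<And>t. dist t (real n) < \<delta> \<Longrightarrow> dist (G t) (G (real n)) < \<eta>"
          unfolding continuous_at_eps_delta by blast
        have "G (real n) - \<eta> \<le> G t" if "\<bar>t - real n\<bar> < \<delta>" for t
          using \<delta>(2)[of t] that by (simp add: dist_real_def abs_less_iff)
        then show "\<exists>\<delta>>0. \<forall>t. \<bar>t - real n\<bar> < \<delta> \<longrightarrow> G (real n) - \<eta> \<le> G t" using \<delta>(1) by blast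
      qed
      then obtain D where D: "\<And>n. n \<in> {1..M} \<Longrightarrow> D n > 0"
          "\<And>n t. n \<in> {1..M} \<Longrightarrow> \<bar>t - real n\<bar> < D n \<Longrightarrow> G (real n) - \<eta> \<le> G t"
        by metis
      show ?thesis
        by (rule exI[of _ "Min (insert 1 (D ` {1..M}))"]) (use D in auto)
    qed
    then obtain \<delta>0 where \<delta>0: "\<delta>0 > 0" "\<And>n t. n \<in> {1..M} \<Longrightarrow> \<bar>t - real n\<bar> < \<delta>0 \<Longrightarrow> G (real n) - \<eta> \<le> G t"
      by blast
    \<comment> \<open>At most 1/4, so that the intervals around distinct integers are disjoint and
      those around 1, ..., M lie in the positive half-line.\<close>
    define \<delta> where "\<delta> = min (\<delta>0 / 2) (1 / 4)"
    have \<delta>: "0 < \<delta>" "\<delta> \<le> 1 / 4" "\<delta> < \<delta>0" using \<delta>0(1) by (auto simp: \<delta>_def)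
    define I where "I = (\<lambda>n::nat. {real n - \<delta>..real n + \<delta>})"
    let ?c = "\<lambda>N. 1 - (2 * real N + 1) * (1 - \<delta>\<^sup>2) ^ N"
    let ?S = "\<Sum>n=1..M. max 0 (G (real n) - \<eta>)"
    have "?S * ?c N \<le> B" for N
    proof -
      have "ennreal (?S * ?c N) \<le> ennreal (\<Sum>n=1..M. max 0 (G (real n) - \<eta>) * (\<integral>t. indicator (I n) t * vp N t \<partial>lborel))"
        unfolding sum_distrib_right I_def
        using integral_vp_near[of \<delta> N "int n" for n] \<delta>
        by (intro ennreal_leI sum_mono mult_left_mono) auto
      also have "\<dots> = ennreal (\<integral>t. (\<Sum>n=1..M. max 0 (G (real n) - \<eta>) * (indicator (I n) t * vp N t)) \<partial>lborel)"
        unfolding I_def by (simp only: Bochner_Integration.integral_sum integrable_mult_right integrable_vp integral_mult_right_zero)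
      also have "\<dots> = (\<integral>\<^sup>+t. ennreal (\<Sum>n=1..M. max 0 (G (real n) - \<eta>) * (indicator (I n) t * vp N t)) \<partial>lborel)"
        unfolding I_def
        by (intro nn_integral_eq_integral[symmetric] Bochner_Integration.integrable_sum integrable_mult_right integrable_vp)
           (auto intro!: AE_I2 sum_nonneg mult_nonneg_nonneg vp_nonneg)
      also have "\<dots> \<le> (\<integral>\<^sup>+t. indicator {0<..} t * ennreal (G t * vp N t) \<partial>lborel)"
      proof (intro nn_integral_mono)
        fix t
        show "ennreal (\<Sum>n=1..M. max 0 (G (real n) - \<eta>) * (indicator (I n) t * vp N t)) \<le> indicator {0<..} t * ennreal (G t * vp N t)"
        proof (cases "\<exists>n\<in>{1..M}. t \<in> I n")
          case True
          then obtain n where n: "n \<in> {1..M}" "t \<in> I n" by auto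
          have uniq: "t \<notin> I k" if "k \<noteq> n" for k
          proof
            assume "t \<in> I k"
            then have "\<bar>real k - real n\<bar> \<le> 2 * \<delta>" using n(2) unfolding I_def by (auto simp: abs_le_iff)
            then have "\<bar>real k - real n\<bar> < 1" using \<delta> by linarith
            then show False using that by linarith
          qed
          have "(\<Sum>n=1..M. max 0 (G (real n) - \<eta>) * (indicator (I n) t * vp N t)) = (\<Sum>k\<in>{n}. max 0 (G (real k) - \<eta>) * (indicator (I k) t * vp N t))"
            using n uniq by (intro sum.mono_neutral_right) auto
          also have "\<dots> = max 0 (G (real n) - \<eta>) * vp N t" using n by simp
          also have "\<dots> \<le> G t * vp N t"
          proof (intro mult_right_mono vp_nonneg)
            have "\<bar>t - real n\<bar> < \<delta>0" using n(2) \<delta> unfolding I_def by (auto simp: abs_less_iff)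
            then show "max 0 (G (real n) - \<eta>) \<le> G t" using \<delta>0(2)[OF n(1)] G0[of t] by simp
          qed
          finally have "(\<Sum>n=1..M. max 0 (G (real n) - \<eta>) * (indicator (I n) t * vp N t)) \<le> G t * vp N t" .
          moreover have "0 < t" using n \<delta> unfolding I_def by auto
          ultimately show ?thesis by (simp add: ennreal_leI)
        next
          case False
          then have "(\<Sum>n=1..M. max 0 (G (real n) - \<eta>) * (indicator (I n) t * vp N t)) = 0"
            by (intro sum.neutral) auto
          then show ?thesis by simp
        qed
      qed
      also have "\<dots> \<le> ennreal B" by (rule bound)
      finally show ?thesis using B0 by simp
    qed
    moreover have "(\<lambda>N. ?S * ?c N) \<longlonglongrightarrow> ?S * (1 - 0)"
    proof (intro tendsto_intros)
      have "0 < \<delta>\<^sup>2" "\<delta>\<^sup>2 < 1" using \<delta> by (auto simp: power_less_one_iff abs_square_less_1)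
      then show "(\<lambda>N. (2 * real N + 1) * (1 - \<delta>\<^sup>2) ^ N) \<longlonglongrightarrow> 0"
        using vp_tail_tendsto_0[of "1 - \<delta>\<^sup>2" 1] by simp
    qed
    ultimately show "?S \<le> B" using LIMSEQ_le_const2[of _ "?S * (1 - 0)" B] by auto
  qed
  have "(\<Sum>n=1..M. G (real n)) \<le> B + \<epsilon>" if "\<epsilon> > 0" for \<epsilon>
  proof -
    define \<eta> where "\<eta> = \<epsilon> / (real M + 1)"
    have \<eta>: "\<eta> > 0" using that by (simp add: \<eta>_def)
    have "(\<Sum>n=1..M. G (real n)) \<le> (\<Sum>n=1..M. max 0 (G (real n) - \<eta>) + \<eta>)"
      by (intro sum_mono) simp
    also have "\<dots> = (\<Sum>n=1..M. max 0 (G (real n) - \<eta>)) + real M * \<eta>" by (simp add: sum.distrib)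
    also have "\<dots> \<le> B + real M * \<eta>" using main[OF \<eta>] by simp
    also have "real M * \<eta> \<le> \<epsilon>" using that by (simp add: \<eta>_def field_simps)
    finally show ?thesis by simp
  qed
  then show ?thesis by (rule field_le_epsilon)
qed

subsection \<open>Periodization over the integer lattice\<close>

lemma Basis_vec_axis: "(Basis :: (real^'n) set) = (\<lambda>i. axis i 1) ` UNIV"
  by (auto simp: Basis_vec_def)

lemma inj_axis_1: "inj (\<lambda>i::'n::finite. axis i (1::real))"
  by (auto simp: inj_on_def axis_eq_axis)

lemma prod_Basis_vec:
  fixes g :: "real^'n \<Rightarrow> 'b::comm_monoid_mult"
  shows "(\<Prod>b\<in>Basis. g b) = (\<Prod>i\<in>UNIV. g (axis i 1))"
proof -
  have "(\<Prod>b\<in>(Basis :: (real^'n) set). g b) = prod g ((\<lambda>i. axis i 1) ` UNIV)"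
    by (rule arg_cong[OF Basis_vec_axis])
  also have "\<dots> = prod (g \<circ> (\<lambda>i. axis i 1)) UNIV"
    by (rule prod.reindex[OF inj_axis_1])
  finally show ?thesis by (simp only: o_def)
qed

lemma nn_integral_lborel_prod_vec:
  fixes f :: "'n::finite \<Rightarrow> real \<Rightarrow> ennreal"
  assumes [measurable]: "\<And>i. f i \<in> borel_measurable borel"
  shows "(\<integral>\<^sup>+x. (\<Prod>i\<in>UNIV. f i (x $ i)) \<partial>(lborel :: (real^'n) measure)) = (\<Prod>i\<in>UNIV. \<integral>\<^sup>+t. f i t \<partial>lborel)"
proof -
  define ix where "ix = the_inv (\<lambda>i::'n. axis i (1::real))"
  have ix: "ix (axis i 1) = i" for i unfolding ix_def by (rule the_inv_f_f[OF inj_axis_1])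
  have "(\<integral>\<^sup>+x. (\<Prod>b\<in>Basis. f (ix b) (x \<bullet> b)) \<partial>(lborel :: (real^'n) measure)) = (\<Prod>b\<in>(Basis :: (real^'n) set). \<integral>\<^sup>+t. f (ix b) t \<partial>lborel)"
    by (rule nn_integral_lborel_prod) auto
  then show ?thesis
    by (simp add: prod_Basis_vec ix inner_axis)
qed

lemma
  fixes f :: "'n::finite \<Rightarrow> real \<Rightarrow> complex"
  assumes int: "\<And>i. integrable lborel (f i)"
  shows integrable_lborel_prod_vec: "integrable (lborel :: (real^'n) measure) (\<lambda>x. \<Prod>i\<in>UNIV. f i (x $ i))"
    and integral_lborel_prod_vec: "(\<integral>x. (\<Prod>i\<in>UNIV. f i (x $ i)) \<partial>(lborel :: (real^'n) measure)) = (\<Prod>i\<in>UNIV. \<integral>t. f i t \<partial>lborel)"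
proof -
  interpret product_sigma_finite "\<lambda>_::real^'n. lborel :: real measure" ..
  define ix where "ix = the_inv (\<lambda>i::'n. axis i (1::real))"
  have ix: "ix (axis i 1) = i" for i unfolding ix_def by (rule the_inv_f_f[OF inj_axis_1])
  let ?D = "\<lambda>y::real^'n \<Rightarrow> real. \<Sum>b\<in>Basis. y b *\<^sub>R b"
  have [measurable]: "f i \<in> borel_measurable borel" for i using int[of i] by (simp add: borel_measurable_integrable)
  have m: "?D \<in> (\<Pi>\<^sub>M b\<in>Basis. lborel) \<rightarrow>\<^sub>M borel" by measurable
  have comp: "?D y $ i = y (axis i 1)" for y i
  proof -
    have "?D y $ i = ?D y \<bullet> axis i 1" by (simp add: inner_axis)
    also have "\<dots> = y (axis i 1)" by (subst inner_sum_left_Basis) (auto simp: axis_in_Basis_iff)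
    finally show ?thesis .
  qed
  have eq: "(\<lambda>y. \<Prod>i\<in>UNIV. f i (?D y $ i)) = (\<lambda>y. \<Prod>b\<in>Basis. f (ix b) (y b))"
    unfolding comp by (simp add: prod_Basis_vec ix)
  have "integrable (\<Pi>\<^sub>M b\<in>Basis. lborel) (\<lambda>y. \<Prod>b\<in>(Basis :: (real^'n) set). f (ix b) (y b))"
    by (rule product_integrable_prod) (auto simp: int)
  then show "integrable (lborel :: (real^'n) measure) (\<lambda>x. \<Prod>i\<in>UNIV. f i (x $ i))"
    unfolding eq[symmetric] by (subst lborel_eq) (simp add: integrable_distr_eq[OF m])
  have "(\<integral>x. (\<Prod>i\<in>UNIV. f i (x $ i)) \<partial>(lborel :: (real^'n) measure)) = (\<integral>y. (\<Prod>i\<in>UNIV. f i (?D y $ i)) \<partial>(\<Pi>\<^sub>M b\<in>Basis. lborel))"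
    by (subst lborel_eq) (simp add: integral_distr[OF m])
  also have "\<dots> = (\<Prod>b\<in>(Basis :: (real^'n) set). \<integral>t. f (ix b) t \<partial>lborel)"
    unfolding eq by (rule product_integral_prod) (auto simp: int)
  finally show "(\<integral>x. (\<Prod>i\<in>UNIV. f i (x $ i)) \<partial>(lborel :: (real^'n) measure)) = (\<Prod>i\<in>UNIV. \<integral>t. f i t \<partial>lborel)"
    by (simp add: prod_Basis_vec ix)
qed

section \<open>Tiling space by lattice translates of a unit cube\<close>

definition cube :: "real \<Rightarrow> (real^'n) set" where
  "cube a = {x. \<forall>i. a \<le> x $ i \<and> x $ i \<le> a + 1}"

lemma cube_borel [measurable]: "(cube a :: (real^'n) set) \<in> sets borel"
  unfolding cube_def by measurable

lemma indicator_cube: "indicator (cube a) x = (\<Prod>i\<in>UNIV. indicator {a..a+1} (x $ i) :: 'b::comm_semiring_1)"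
proof (cases "x \<in> cube a")
  case True
  then show ?thesis by (simp add: cube_def)
next
  case False
  then obtain i where "x $ i \<notin> {a..a+1}" by (auto simp: cube_def)
  then have "(\<Prod>i\<in>UNIV. indicator {a..a+1} (x $ i) :: 'b) = 0"
  proof (intro prod_zero)
    show "\<exists>i\<in>UNIV. indicator {a..a+1} (x $ i) = (0 :: 'b)"
      by (rule bexI[of _ i]) (use \<open>x $ i \<notin> {a..a+1}\<close> in simp_all)
  qed simp
  then show ?thesis using False by simp
qed

lemma unit_cube_eq: "unit_cube = (cube 0 :: (real^'n) set)"
proof -
  have "(One :: real^'n) $ i = 1" for i
  proof -
    have "(One :: real^'n) $ i = One \<bullet> axis i (1::real)" by (simp add: inner_axis)
    also have "\<dots> = 1" by (rule inner_sum_Basis) (simp add: axis_in_Basis_iff)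
    finally show ?thesis .
  qed
  then show ?thesis by (auto simp: unit_cube_def cube_def mem_box_cart)
qed

lemma emeasure_cube: "emeasure lborel (cube a :: (real^'n) set) = 1"
proof -
  have "emeasure lborel (cube a :: (real^'n) set) = (\<integral>\<^sup>+x. indicator (cube a :: (real^'n) set) x \<partial>lborel)"
    by simp
  also have "\<dots> = (\<integral>\<^sup>+x. (\<Prod>i\<in>UNIV. indicator {a..a+1} (x $ i)) \<partial>(lborel :: (real^'n) measure))"
    by (simp only: indicator_cube)
  also have "\<dots> = 1" by (subst nn_integral_lborel_prod_vec) auto
  finally show ?thesis .
qed

lemma int_lattice_uminus: "\<nu> \<in> int_lattice \<Longrightarrow> - \<nu> \<in> int_lattice"
  by (simp add: int_lattice_def)

text \<open>A numbering turns lattice sums into \<open>suminf\<close>, where the theorems exchanging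
  sum and integral apply.\<close>

lemma int_lattice_enum:
  obtains e :: "nat \<Rightarrow> real^'n" where "bij_betw e UNIV int_lattice"
proof -
  have eq: "(int_lattice :: (real^'n) set) = (\<lambda>m. \<chi> i. of_int (m i)) ` UNIV"
  proof (intro set_eqI iffI)
    fix v :: "real^'n" assume v: "v \<in> int_lattice"
    have "v $ i = of_int \<lfloor>v $ i\<rfloor>" for i
    proof -
      have "v $ i \<in> \<int>" using v by (simp add: int_lattice_def)
      then show ?thesis by (elim Ints_cases) simp
    qed
    then have "v = (\<chi> i. of_int \<lfloor>v $ i\<rfloor>)" by (simp add: vec_eq_iff)
    then show "v \<in> (\<lambda>m. \<chi> i. of_int (m i)) ` UNIV"
      by (rule image_eqI[where x = "\<lambda>i. \<lfloor>v $ i\<rfloor>"]) simp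
  qed (auto simp: int_lattice_def)
  have "countable (UNIV :: ('n \<Rightarrow> int) set)" by (rule countableI_type)
  then have c: "countable (int_lattice :: (real^'n) set)" unfolding eq by simp
  have "inj (\<lambda>k::nat. \<chi> i::'n. real k)" by (auto simp: inj_on_def vec_eq_iff)
  moreover have "range (\<lambda>k::nat. \<chi> i::'n. real k) \<subseteq> int_lattice" by (auto simp: int_lattice_def)
  ultimately have "infinite (int_lattice :: (real^'n) set)"
    using range_inj_infinite finite_subset by blast
  from bij_betw_from_nat_into[OF c this] show ?thesis by (rule that)
qed

lemma AE_not_hyperplane:
  "AE x in (lborel :: (real^'n) measure). x $ i \<noteq> c"
proof -
  have "negligible {x::real^'n. x $ i = c}" using negligible_standard_hyperplane[of "axis i (1::real)" c] by (simp add: axis_in_Basis_iff inner_axis)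
  then have "{x::real^'n. x $ i = c} \<in> null_sets lebesgue" by (simp add: negligible_iff_null_sets)
  moreover have m: "{x::real^'n. x $ i = c} \<in> sets borel" by measurable
  ultimately have "{x::real^'n. x $ i = c} \<in> null_sets lborel"
    by (simp add: null_sets_def)
  then show ?thesis by (rule AE_I') auto
qed

text \<open>Closed cubes overlap only on the hyperplanes where some coordinate is congruent to a
  modulo 1, a null set. Off it the translate is determined by the floors of the coordinates shifted
  by a.\<close>

lemma AE_unique_translate:
  fixes e :: "nat \<Rightarrow> real^'n"
  assumes e: "bij_betw e UNIV int_lattice"
  shows "AE x in lborel. \<exists>!k. x - e k \<in> cube a"
proof -
  have "AE x in (lborel :: (real^'n) measure). \<forall>i. \<forall>j::int. x $ i \<noteq> a + of_int j"
    by (intro AE_all_countable[THEN iffD2] AE_finite_all[THEN iffD2] allI AE_not_hyperplane)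
  then show ?thesis
  proof eventually_elim
    fix x :: "real^'n" assume x: "\<forall>i. \<forall>j::int. x $ i \<noteq> a + of_int j"
    define v where "v = (\<chi> i. real_of_int \<lfloor>x $ i - a\<rfloor>)"
    have "v \<in> int_lattice" by (simp add: v_def int_lattice_def)
    then obtain k where k: "e k = v" using e by (metis bij_betw_imp_surj_on imageE)
    show "\<exists>!k. x - e k \<in> cube a"
    proof (rule ex1I[of _ k])
      have "a \<le> x $ i - of_int \<lfloor>x $ i - a\<rfloor>" "x $ i - of_int \<lfloor>x $ i - a\<rfloor> \<le> a + 1" for i
        by linarith+
      then show "x - e k \<in> cube a" by (simp add: k v_def cube_def)
    next
      fix l assume l: "x - e l \<in> cube a"
      have "e l \<in> int_lattice" using e by (metis bij_betwE UNIV_I)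
      have "e l $ i = v $ i" for i
      proof -
        obtain j where j: "e l $ i = of_int j"
          using \<open>e l \<in> int_lattice\<close> unfolding int_lattice_def by (auto elim: Ints_cases)
        have "a \<le> (x - e l) $ i \<and> (x - e l) $ i \<le> a + 1" using l by (simp add: cube_def)
        then have b: "a \<le> x $ i - of_int j" "x $ i - of_int j \<le> a + 1" by (simp_all add: j)
        have "x $ i \<noteq> a + of_int (j + 1)" using x by blast
        then have "x $ i - a < of_int j + 1" using b by simp
        moreover have "of_int j \<le> x $ i - a" using b by simp
        ultimately have "\<lfloor>x $ i - a\<rfloor> = j" by (simp add: floor_unique)
        then show ?thesis by (simp add: v_def j)
      qed
      then have "e l = e k" by (simp add: k vec_eq_iff)
      then show "l = k" using e by (metis bij_betw_imp_inj_on injD)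
    qed
  qed
qed

text \<open>Unfolding: translating the k-th summand moves the cube to its k-th translate, and almost
  every point lies in exactly one of them.\<close>

lemma nn_integral_tile:
  fixes h :: "real^'n \<Rightarrow> ennreal"
  assumes e: "bij_betw e UNIV int_lattice" and [measurable]: "h \<in> borel_measurable borel"
  shows "(\<integral>\<^sup>+x. indicator (cube a) x * (\<Sum>k. h (x + e k)) \<partial>lborel) = (\<integral>\<^sup>+x. h x \<partial>lborel)"
proof -
  have "(\<integral>\<^sup>+x. indicator (cube a) x * (\<Sum>k. h (x + e k)) \<partial>lborel) = (\<integral>\<^sup>+x. (\<Sum>k. indicator (cube a) x * h (x + e k)) \<partial>lborel)"
    by simp
  also have "\<dots> = (\<Sum>k. \<integral>\<^sup>+x. indicator (cube a) x * h (x + e k) \<partial>lborel)"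
    by (rule nn_integral_suminf) measurable
  also have "\<dots> = (\<Sum>k. \<integral>\<^sup>+x. indicator (cube a) (x - e k) * h x \<partial>lborel)"
  proof (intro suminf_cong)
    fix k
    show "(\<integral>\<^sup>+x. indicator (cube a) x * h (x + e k) \<partial>lborel) = (\<integral>\<^sup>+x. indicator (cube a) (x - e k) * h x \<partial>lborel)"
      using nn_integral_lborel_translate[of "\<lambda>x. indicator (cube a) (x - e k) * h x" "e k"] by simp
  qed
  also have "\<dots> = (\<integral>\<^sup>+x. (\<Sum>k. indicator (cube a) (x - e k) * h x) \<partial>lborel)"
    by (rule nn_integral_suminf[symmetric]) measurable
  also have "\<dots> = (\<integral>\<^sup>+x. h x \<partial>lborel)"
  proof (intro nn_integral_cong_AE, use AE_unique_translate[OF e, of a] in eventually_elim)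
    fix x assume "\<exists>!k. x - e k \<in> cube a"
    then obtain k where k: "x - e k \<in> cube a" "\<And>l. x - e l \<in> cube a \<Longrightarrow> l = k" by auto
    have "(\<Sum>l. indicator (cube a) (x - e l) * h x) = (\<Sum>l\<in>{k}. indicator (cube a) (x - e l) * h x)"
      using k(2) by (intro suminf_finite) (auto simp: indicator_def)
    then show "(\<Sum>l. indicator (cube a) (x - e l) * h x) = h x" using k(1) by simp
  qed
  finally show ?thesis .
qed

lemma integral_lborel_translate:
  fixes h :: "'a::euclidean_space \<Rightarrow> 'b::{banach, second_countable_topology}"
  assumes [measurable]: "h \<in> borel_measurable borel"
  shows "(\<integral>x. h (x + a) \<partial>lborel) = (\<integral>x. h x \<partial>lborel)"
proof -
  have "(\<integral>x. h x \<partial>lborel) = (\<integral>x. h x \<partial>(distr lborel borel ((+) a)))"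
    by (subst lborel_distr_plus) simp
  also have "\<dots> = (\<integral>x. h (x + a) \<partial>lborel)"
    by (subst integral_distr) (auto simp: add.commute)
  finally show ?thesis by simp
qed

lemma integrable_lborel_translate:
  fixes h :: "'a::euclidean_space \<Rightarrow> 'b::{banach, second_countable_topology}"
  assumes "integrable lborel h"
  shows "integrable lborel (\<lambda>x. h (x + a))"
proof -
  have "integrable (distr lborel borel ((+) a)) h" using assms by (subst lborel_distr_plus)
  then have "integrable lborel (\<lambda>x. h (a + x))" by (subst (asm) integrable_distr_eq) (use assms in auto)
  then show ?thesis by (simp add: add.commute)
qed

text \<open>The unfolding identity applied to |h| gives absolute convergence almost everywhere in
  the cube together with summable L^1 norms of the pieces; sum and integral may then be exchanged
  for vector-valued h.\<close>

lemma
  fixes h :: "real^'n \<Rightarrow> 'b::{banach, second_countable_topology}"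
  assumes e: "bij_betw e UNIV int_lattice" and int: "integrable lborel h"
  shows AE_summable_tile: "AE x in lborel. x \<in> cube a \<longrightarrow> summable (\<lambda>k. norm (h (x + e k)))"
    and sums_integral_tile: "(\<lambda>k. \<integral>x. indicator (cube a) x *\<^sub>R h (x + e k) \<partial>lborel) sums (\<integral>x. h x \<partial>lborel)"
    and integrable_tile: "integrable lborel (\<lambda>x. indicator (cube a) x *\<^sub>R (\<Sum>k. h (x + e k)))"
    and integral_tile: "(\<integral>x. indicator (cube a) x *\<^sub>R (\<Sum>k. h (x + e k)) \<partial>lborel) = (\<integral>x. h x \<partial>lborel)"
proof -
  have [measurable]: "h \<in> borel_measurable borel" using int by (simp add: borel_measurable_integrable)
  have "(\<integral>\<^sup>+x. indicator (cube a) x * (\<Sum>k. ennreal (norm (h (x + e k)))) \<partial>lborel) = (\<integral>\<^sup>+x. ennreal (norm (h x)) \<partial>lborel)"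
    by (rule nn_integral_tile[OF e]) measurable
  also have "\<dots> < \<infinity>" using int by (simp add: integrable_iff_bounded)
  finally have fin: "(\<integral>\<^sup>+x. indicator (cube a) x * (\<Sum>k. ennreal (norm (h (x + e k)))) \<partial>lborel) \<noteq> \<infinity>" by simp
  have "AE x in lborel. indicator (cube a) x * (\<Sum>k. ennreal (norm (h (x + e k)))) \<noteq> \<infinity>"
    by (rule nn_integral_PInf_AE[OF _ fin]) measurable
  then have AEs: "AE x in lborel. x \<in> cube a \<longrightarrow> summable (\<lambda>k. norm (h (x + e k)))"
  proof eventually_elim
    fix x assume *: "indicator (cube a) x * (\<Sum>k. ennreal (norm (h (x + e k)))) \<noteq> \<infinity>"
    show "x \<in> cube a \<longrightarrow> summable (\<lambda>k. norm (h (x + e k)))"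
    proof
      assume "x \<in> cube a"
      then have "(\<Sum>k. ennreal (norm (h (x + e k)))) \<noteq> \<top>" using * by simp
      then show "summable (\<lambda>k. norm (h (x + e k)))" by (intro summable_suminf_not_top) auto
    qed
  qed
  then show "AE x in lborel. x \<in> cube a \<longrightarrow> summable (\<lambda>k. norm (h (x + e k)))" .
  let ?f = "\<lambda>k x. indicator (cube a) x *\<^sub>R h (x + e k)"
  have i: "integrable lborel (?f k)" for k
    by (intro integrable_mult_indicator integrable_lborel_translate int) auto
  have s1: "AE x in lborel. summable (\<lambda>k. norm (?f k x))"
    using AEs by eventually_elim (simp add: indicator_def)
  have s2: "summable (\<lambda>k. \<integral>x. norm (?f k x) \<partial>lborel)"
  proof (rule summable_suminf_not_top)
    have "(\<Sum>k. ennreal (\<integral>x. norm (?f k x) \<partial>lborel)) = (\<Sum>k. \<integral>\<^sup>+x. ennreal (norm (?f k x)) \<partial>lborel)"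
      by (intro suminf_cong nn_integral_eq_integral[symmetric] integrable_norm i) auto
    also have "\<dots> = (\<integral>\<^sup>+x. (\<Sum>k. ennreal (norm (?f k x))) \<partial>lborel)"
      by (rule nn_integral_suminf[symmetric]) measurable
    also have "\<dots> = (\<integral>\<^sup>+x. indicator (cube a) x * (\<Sum>k. ennreal (norm (h (x + e k)))) \<partial>lborel)"
    proof (rule nn_integral_cong)
      fix x
      show "(\<Sum>k. ennreal (norm (?f k x))) = indicator (cube a) x * (\<Sum>k. ennreal (norm (h (x + e k))))"
        by (cases "x \<in> cube a") simp_all
    qed
    finally show "(\<Sum>k. ennreal (\<integral>x. norm (?f k x) \<partial>lborel)) \<noteq> \<top>"
      using fin unfolding infinity_ennreal_def by (rule ssubst)
  qed auto
  have eq: "(\<Sum>k. ?f k x) = indicator (cube a) x *\<^sub>R (\<Sum>k. h (x + e k))" for x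
    by (cases "x \<in> cube a") simp_all
  show "integrable lborel (\<lambda>x. indicator (cube a) x *\<^sub>R (\<Sum>k. h (x + e k)))"
    using integrable_suminf[OF i s1 s2] unfolding eq .
  have it: "(\<integral>x. indicator (cube a) x *\<^sub>R (\<Sum>k. h (x + e k)) \<partial>lborel) = (\<Sum>k. \<integral>x. ?f k x \<partial>lborel)"
    using integral_suminf[OF i s1 s2] unfolding eq .
  have sm: "summable (\<lambda>k. \<integral>x. ?f k x \<partial>lborel)"
  proof (rule summable_norm_cancel, rule summable_comparison_test[OF _ s2])
    show "\<exists>N. \<forall>n\<ge>N. norm (norm (\<integral>x. ?f n x \<partial>lborel)) \<le> (\<integral>x. norm (?f n x) \<partial>lborel)"
      by (intro exI[of _ 0] allI impI) (simp only: real_norm_def abs_norm_cancel integral_norm_bound)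
  qed
  let ?g = "\<lambda>k x. indicator (cube a) (x - e k) *\<^sub>R h x"
  have shift: "(\<integral>x. ?f k x \<partial>lborel) = (\<integral>x. ?g k x \<partial>lborel)" for k
    using integral_lborel_translate[of "?g k" "e k"] by simp
  have shiftn: "(\<integral>x. norm (?f k x) \<partial>lborel) = (\<integral>x. norm (?g k x) \<partial>lborel)" for k
    using integral_lborel_translate[of "\<lambda>x. norm (?g k x)" "e k"] by simp
  have gi: "integrable lborel (?g k)" for k
    using int by (rule Bochner_Integration.integrable_bound) (auto simp: indicator_def)
  have uniq: "AE x in lborel. (\<lambda>k. ?g k x) sums h x \<and> summable (\<lambda>k. norm (?g k x))"
    using AE_unique_translate[OF e, of a]
  proof eventually_elim
    fix x assume "\<exists>!k. x - e k \<in> cube a"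
    then obtain k where k: "x - e k \<in> cube a" "\<And>l. x - e l \<in> cube a \<Longrightarrow> l = k" by auto
    have z: "?g l x = 0" if "l \<notin> {k}" for l
    proof -
      have "x - e l \<notin> cube a" using k(2)[of l] that by blast
      then show ?thesis by simp
    qed
    have "(\<lambda>l. ?g l x) sums (\<Sum>l\<in>{k}. ?g l x)" by (rule sums_finite) (use z in auto)
    then have "(\<lambda>l. ?g l x) sums h x" using k(1) by simp
    moreover have "summable (\<lambda>l. norm (?g l x))"
    proof (rule summable_finite[of "{k}"])
      fix l assume "l \<notin> {k}"
      then show "norm (?g l x) = 0" using z[of l] by simp
    qed simp
    ultimately show "(\<lambda>k. ?g k x) sums h x \<and> summable (\<lambda>k. norm (?g k x))" by (rule conjI)
  qed
  have u1: "AE x in lborel. h x = (\<Sum>k. ?g k x)"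
    using uniq by eventually_elim (simp only: sums_iff)
  have u2: "AE x in lborel. summable (\<lambda>k. norm (?g k x))"
    using uniq by eventually_elim (rule conjunct2)
  have s3: "summable (\<lambda>k. \<integral>x. norm (?g k x) \<partial>lborel)"
    using s2 unfolding shiftn .
  have "(\<integral>x. h x \<partial>lborel) = (\<integral>x. (\<Sum>k. ?g k x) \<partial>lborel)"
    by (rule integral_cong_AE[OF _ _ u1]) measurable
  also have "\<dots> = (\<Sum>k. \<integral>x. ?g k x \<partial>lborel)"
    by (rule integral_suminf[OF gi u2 s3])
  finally have hs: "(\<Sum>k. \<integral>x. ?f k x \<partial>lborel) = (\<integral>x. h x \<partial>lborel)" by (simp add: shift)
  show "(\<integral>x. indicator (cube a) x *\<^sub>R (\<Sum>k. h (x + e k)) \<partial>lborel) = (\<integral>x. h x \<partial>lborel)"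
    using it hs by simp
  show "(\<lambda>k. \<integral>x. ?f k x \<partial>lborel) sums (\<integral>x. h x \<partial>lborel)"
    using sm hs by (simp add: sums_iff)
qed

subsection \<open>Continuity of translation in mean\<close>

definition L1_modulus :: "('a::euclidean_space \<Rightarrow> 'b::{banach, second_countable_topology}) \<Rightarrow> 'a \<Rightarrow> ennreal" where
  "L1_modulus F u = (\<integral>\<^sup>+x. ennreal (norm (F (x - u) - F x)) \<partial>lborel)"

lemma L1_modulus_triangle:
  assumes [measurable]: "F \<in> borel_measurable borel" "G \<in> borel_measurable borel"
  shows "L1_modulus F u \<le> L1_modulus G u + 2 * (\<integral>\<^sup>+x. ennreal (norm (F x - G x)) \<partial>lborel)"
proof -
  let ?d = "\<lambda>x. ennreal (norm (F x - G x))"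
  have "L1_modulus F u \<le> (\<integral>\<^sup>+x. ennreal (norm (G (x - u) - G x)) + (?d (x + (- u)) + ?d x) \<partial>lborel)"
    unfolding L1_modulus_def
  proof (rule nn_integral_mono)
    fix x
    have "norm (F (x - u) - F x) \<le> norm (G (x - u) - G x) + (norm (F (x - u) - G (x - u)) + norm (F x - G x))"
    proof -
      have "F (x - u) - F x = (G (x - u) - G x) + ((F (x - u) - G (x - u)) - (F x - G x))" by simp
      then show ?thesis using norm_triangle_ineq[of "G (x - u) - G x" "(F (x - u) - G (x - u)) - (F x - G x)"]
          norm_triangle_ineq4[of "F (x - u) - G (x - u)" "F x - G x"] by simp
    qed
    then show "ennreal (norm (F (x - u) - F x)) \<le> ennreal (norm (G (x - u) - G x)) + (?d (x + (- u)) + ?d x)"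
      by (simp flip: ennreal_plus)
  qed
  also have "\<dots> = L1_modulus G u + ((\<integral>\<^sup>+x. ?d (x + (- u)) \<partial>lborel) + (\<integral>\<^sup>+x. ?d x \<partial>lborel))"
    unfolding L1_modulus_def by (simp add: nn_integral_add)
  also have "(\<integral>\<^sup>+x. ?d (x + (- u)) \<partial>lborel) = (\<integral>\<^sup>+x. ?d x \<partial>lborel)"
    by (rule nn_integral_lborel_translate) measurable
  finally show ?thesis by (simp add: mult_2)
qed

text \<open>For open U, a point x of U has x + u in U once u is small, so the indicator of the
  points pushed out of U tends to 0 pointwise and is dominated by the indicator of U. The difference
  of the two indicators splits into points leaving and points entering U, which \<open>D\<close>
  counts with - u and with u.\<close>

lemma L1_modulus_open:
  fixes U :: "'a::euclidean_space set" and c :: "'b::{banach, second_countable_topology}"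
  assumes U: "open U" "emeasure lborel U < \<infinity>" and "\<epsilon> > 0"
  shows "\<exists>\<delta>>0. \<forall>u. norm u < \<delta> \<longrightarrow> L1_modulus (\<lambda>x. indicator U x *\<^sub>R c) u \<le> ennreal \<epsilon>"
proof (rule ccontr)
  have [measurable]: "U \<in> sets borel" using U by simp
  let ?F = "\<lambda>x. indicator U x *\<^sub>R c"
  define D where "D = (\<lambda>u. \<integral>\<^sup>+x. ennreal (norm c) * (indicator U x * indicator (- U) (x + u)) \<partial>lborel)"
  have le: "L1_modulus ?F u \<le> D (- u) + D u" for u
  proof -
    have "L1_modulus ?F u \<le> (\<integral>\<^sup>+x. ennreal (norm c) * (indicator U x * indicator (- U) (x + (- u)))
        + ennreal (norm c) * (indicator U (x + (- u)) * indicator (- U) ((x + (- u)) + u)) \<partial>lborel)"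
      unfolding L1_modulus_def by (intro nn_integral_mono) (auto simp: indicator_def)
    also have "\<dots> = D (- u) + (\<integral>\<^sup>+x. ennreal (norm c) * (indicator U (x + (- u)) * indicator (- U) ((x + (- u)) + u)) \<partial>lborel)"
      unfolding D_def by (rule nn_integral_add) measurable
    also have "(\<integral>\<^sup>+x. ennreal (norm c) * (indicator U (x + (- u)) * indicator (- U) ((x + (- u)) + u)) \<partial>lborel) = D u"
      unfolding D_def by (rule nn_integral_lborel_translate[of "\<lambda>x. ennreal (norm c) * (indicator U x * indicator (- U) (x + u))"]) measurable
    finally show ?thesis .
  qed
  assume "\<not> ?thesis"
  then have "\<forall>n::nat. \<exists>u. norm u < 1 / real (Suc n) \<and> ennreal \<epsilon> < L1_modulus ?F u"
    by (auto simp: not_le dest!: spec[of _ "1 / real (Suc _)"])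
  then obtain u where u: "\<And>n. norm (u n) < 1 / real (Suc n)" "\<And>n. ennreal \<epsilon> < L1_modulus ?F (u n)"
    by metis
  have lim: "(\<lambda>n. 1 / real (Suc n)) \<longlonglongrightarrow> 0"
    using LIMSEQ_inverse_real_of_nat by (simp only: inverse_eq_divide)
  have u0: "u \<longlonglongrightarrow> 0"
    by (rule tendsto_norm_zero_cancel, rule real_tendsto_sandwich[of "\<lambda>_. 0" _ _ "\<lambda>n. 1 / real (Suc n)"])
       (use u(1) lim in \<open>auto intro!: always_eventually less_imp_le\<close>)
  have D0: "(\<lambda>n. D (v n)) \<longlonglongrightarrow> 0" if v: "v \<longlonglongrightarrow> 0" for v :: "nat \<Rightarrow> 'a"
  proof -
    have "(\<lambda>n. D (v n)) \<longlonglongrightarrow> (\<integral>\<^sup>+x. 0 \<partial>(lborel :: 'a measure))"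
      unfolding D_def
    proof (rule nn_integral_dominated_convergence[where w = "\<lambda>x. ennreal (norm c) * indicator U x"])
      show "(\<integral>\<^sup>+x. ennreal (norm c) * indicator U x \<partial>lborel) < \<infinity>"
        using U by (simp add: nn_integral_cmult ennreal_mult_less_top)
      show "AE x in lborel. (\<lambda>n. ennreal (norm c) * (indicator U x * indicator (- U) (x + v n))) \<longlonglongrightarrow> 0"
      proof (rule AE_I2)
        fix x
        show "(\<lambda>n. ennreal (norm c) * (indicator U x * indicator (- U) (x + v n))) \<longlonglongrightarrow> 0"
        proof (cases "x \<in> U")
          case True
          have "(\<lambda>n. x + v n) \<longlonglongrightarrow> x + 0" by (intro tendsto_intros v)
          then have "\<forall>\<^sub>F n in sequentially. x + v n \<in> U" using U(1) True by (simp add: topological_tendstoD)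
          then have "\<forall>\<^sub>F n in sequentially. ennreal (norm c) * (indicator U x * indicator (- U) (x + v n)) = 0"
            by eventually_elim simp
          then show ?thesis by (rule tendsto_eventually)
        qed simp
      qed
    qed (auto simp: indicator_def)
    then show ?thesis by simp
  qed
  have "(\<lambda>n. D (- u n) + D (u n)) \<longlonglongrightarrow> 0 + 0"
    using D0[OF u0] D0[of "\<lambda>n. - u n"] tendsto_minus[OF u0] by (intro tendsto_add) simp_all
  then have "\<forall>\<^sub>F n in sequentially. D (- u n) + D (u n) < ennreal \<epsilon>"
    using \<open>\<epsilon> > 0\<close> by (intro order_tendstoD) auto
  then obtain n where "D (- u n) + D (u n) < ennreal \<epsilon>" by (auto simp: eventually_sequentially)
  then show False using le[of "u n"] u(2)[of n] by auto
qed

text \<open>Induction over integrable functions. A measurable set of finite measure is replaced by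
  an open superset of almost the same measure; sums and limits follow from triangle
  inequalities.\<close>

lemma L1_modulus_tendsto_0:
  fixes F :: "'a::euclidean_space \<Rightarrow> 'b::{banach, second_countable_topology}"
  assumes "integrable lborel F" and "\<epsilon> > 0"
  shows "\<exists>\<delta>>0. \<forall>u. norm u < \<delta> \<longrightarrow> L1_modulus F u \<le> ennreal \<epsilon>"
  using assms
proof (induction arbitrary: \<epsilon> rule: integrable_induct)
  case (base A c)
  have [measurable]: "A \<in> sets borel" using base by simp
  \<comment> \<open>The added 1 keeps the denominator of \<open>e\<close> positive when c =
    0.\<close>
  define X where "X = norm c + 1"
  define e where "e = \<epsilon> / (4 * X)"
  have X: "X > 0" by (simp add: X_def add_nonneg_pos)
  then have e: "e > 0" using base by (simp add: e_def)
  obtain U where U: "open U" "A \<subseteq> U" "emeasure lborel (U - A) < e"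
    using outer_regular_lborel[of A e] e by auto
  have [measurable]: "U \<in> sets borel" using U by simp
  have "emeasure lborel U \<le> emeasure lborel A + emeasure lborel (U - A)"
    using U(2) emeasure_subadditive[of A lborel "U - A"] by (simp add: Un_absorb1)
  also have "\<dots> < \<infinity>" using base U(3) by (auto simp: less_top[symmetric] top_unique)
  finally have Ufin: "emeasure lborel U < \<infinity>" .
  from L1_modulus_open[OF U(1) Ufin, of "\<epsilon> / 2" c] base
  obtain \<delta> where \<delta>: "\<delta> > 0" "\<And>u. norm u < \<delta> \<Longrightarrow> L1_modulus (\<lambda>x. indicator U x *\<^sub>R c) u \<le> ennreal (\<epsilon> / 2)"
    by auto
  have diff: "(\<integral>\<^sup>+x. ennreal (norm (indicator A x *\<^sub>R c - indicator U x *\<^sub>R c)) \<partial>lborel) \<le> ennreal (\<epsilon> / 4)"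
  proof -
    have "(\<integral>\<^sup>+x. ennreal (norm (indicator A x *\<^sub>R c - indicator U x *\<^sub>R c)) \<partial>lborel) = (\<integral>\<^sup>+x. ennreal (norm c) * indicator (U - A) x \<partial>lborel)"
      using U(2) by (intro nn_integral_cong) (auto simp: indicator_def)
    also have "\<dots> = ennreal (norm c) * emeasure lborel (U - A)" by (simp add: nn_integral_cmult)
    also have "\<dots> \<le> ennreal (norm c) * ennreal e" using U(3) by (intro mult_left_mono) auto
    also have "\<dots> = ennreal (norm c * e)" using e by (simp add: ennreal_mult')
    also have "\<dots> \<le> ennreal (\<epsilon> / 4)"
    proof (rule ennreal_leI)
      have "norm c * e \<le> X * e" using e by (intro mult_right_mono) (auto simp: X_def)
      also have "\<dots> = \<epsilon> / 4" using X by (simp add: e_def)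
      finally show "norm c * e \<le> \<epsilon> / 4" .
    qed
    finally show ?thesis .
  qed
  show ?case
  proof (intro exI[of _ \<delta>] conjI allI impI \<delta>(1))
    fix u :: 'a assume u: "norm u < \<delta>"
    have "L1_modulus (\<lambda>x. indicator A x *\<^sub>R c) u \<le> L1_modulus (\<lambda>x. indicator U x *\<^sub>R c) u + 2 * (\<integral>\<^sup>+x. ennreal (norm (indicator A x *\<^sub>R c - indicator U x *\<^sub>R c)) \<partial>lborel)"
      by (rule L1_modulus_triangle) measurable
    also have "\<dots> \<le> ennreal (\<epsilon> / 2) + 2 * ennreal (\<epsilon> / 4)"
      by (intro add_mono mult_left_mono \<delta>(2) u diff) auto
    also have "\<dots> = ennreal (\<epsilon> / 2) + ennreal (2 * (\<epsilon> / 4))"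
      by (subst ennreal_mult'') (use base in auto)
    also have "\<dots> = ennreal \<epsilon>" using base by (subst ennreal_plus[symmetric]) auto
    finally show "L1_modulus (\<lambda>x. indicator A x *\<^sub>R c) u \<le> ennreal \<epsilon>" .
  qed
next
  case (add F G)
  have [measurable]: "F \<in> borel_measurable borel" "G \<in> borel_measurable borel"
    using add by (auto simp: borel_measurable_integrable)
  from add obtain \<delta>1 where \<delta>1: "\<delta>1 > 0" "\<And>u. norm u < \<delta>1 \<Longrightarrow> L1_modulus F u \<le> ennreal (\<epsilon> / 2)"
    by (metis half_gt_zero)
  from add obtain \<delta>2 where \<delta>2: "\<delta>2 > 0" "\<And>u. norm u < \<delta>2 \<Longrightarrow> L1_modulus G u \<le> ennreal (\<epsilon> / 2)"
    by (metis half_gt_zero)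
  show ?case
  proof (intro exI[of _ "min \<delta>1 \<delta>2"] conjI allI impI)
    fix u :: 'a assume u: "norm u < min \<delta>1 \<delta>2"
    have "L1_modulus (\<lambda>x. F x + G x) u \<le> (\<integral>\<^sup>+x. ennreal (norm (F (x - u) - F x)) + ennreal (norm (G (x - u) - G x)) \<partial>lborel)"
      unfolding L1_modulus_def
    proof (rule nn_integral_mono)
      fix x
      have "norm (F (x - u) + G (x - u) - (F x + G x)) \<le> norm (F (x - u) - F x) + norm (G (x - u) - G x)"
        by (rule norm_diff_triangle_ineq)
      then show "ennreal (norm (F (x - u) + G (x - u) - (F x + G x))) \<le> ennreal (norm (F (x - u) - F x)) + ennreal (norm (G (x - u) - G x))"
        by (simp flip: ennreal_plus)
    qed
    also have "\<dots> = L1_modulus F u + L1_modulus G u"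
      unfolding L1_modulus_def by (rule nn_integral_add) measurable
    also have "\<dots> \<le> ennreal (\<epsilon> / 2) + ennreal (\<epsilon> / 2)" using u by (intro add_mono \<delta>1 \<delta>2) auto
    also have "\<dots> = ennreal \<epsilon>" using add by (subst ennreal_plus[symmetric]) auto
    finally show "L1_modulus (\<lambda>x. F x + G x) u \<le> ennreal \<epsilon>" .
  qed (use \<delta>1 \<delta>2 in auto)
next
  case (lim F s)
  have [measurable]: "F \<in> borel_measurable borel" "\<And>i. s i \<in> borel_measurable borel"
    using lim by (auto simp: borel_measurable_integrable)
  have "(\<lambda>i. \<integral>\<^sup>+x. ennreal (norm (F x - s i x)) \<partial>lborel) \<longlonglongrightarrow> 0"
  proof (rule nn_integral_dominated_convergence_norm[where w = "\<lambda>x. 2 * norm (F x)"])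
    show "(\<integral>\<^sup>+x. ennreal (2 * norm (F x)) \<partial>lborel) < \<infinity>"
      using lim by (simp add: integrable_iff_bounded ennreal_mult' nn_integral_cmult ennreal_mult_less_top)
  qed (use lim in auto)
  then have "\<forall>\<^sub>F i in sequentially. (\<integral>\<^sup>+x. ennreal (norm (F x - s i x)) \<partial>lborel) < ennreal (\<epsilon> / 4)"
    using lim by (intro order_tendstoD) auto
  then obtain i where i: "(\<integral>\<^sup>+x. ennreal (norm (F x - s i x)) \<partial>lborel) < ennreal (\<epsilon> / 4)"
    by (auto simp: eventually_sequentially)
  obtain \<delta> where \<delta>: "\<delta> > 0" "\<And>u. norm u < \<delta> \<Longrightarrow> L1_modulus (s i) u \<le> ennreal (\<epsilon> / 2)"
    using lim(5)[of "\<epsilon> / 2" i] lim(6) by auto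
  show ?case
  proof (intro exI[of _ \<delta>] conjI allI impI \<delta>(1))
    fix u :: 'a assume u: "norm u < \<delta>"
    have "L1_modulus F u \<le> L1_modulus (s i) u + 2 * (\<integral>\<^sup>+x. ennreal (norm (F x - s i x)) \<partial>lborel)"
      by (rule L1_modulus_triangle) measurable
    also have "\<dots> \<le> ennreal (\<epsilon> / 2) + 2 * ennreal (\<epsilon> / 4)"
      using i by (intro add_mono mult_left_mono \<delta>(2) u) (auto simp: norm_minus_commute)
    also have "\<dots> = ennreal (\<epsilon> / 2) + ennreal (2 * (\<epsilon> / 4))"
      by (subst ennreal_mult'') (use lim in auto)
    also have "\<dots> = ennreal \<epsilon>" using lim by (subst ennreal_plus[symmetric]) auto
    finally show "L1_modulus F u \<le> ennreal \<epsilon>" .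
  qed
qed

subsection \<open>Parseval's inequality for periodizations\<close>

definition fhat :: "(real^'n \<Rightarrow> complex) \<Rightarrow> real^'n \<Rightarrow> complex" where
  "fhat f \<xi> = (\<integral>x. f x * ee (- (\<xi> \<bullet> x)) \<partial>lborel)"

lemma integrable_mult_ee:
  fixes f :: "'a::euclidean_space \<Rightarrow> complex"
  assumes "integrable lborel f" and [measurable]: "g \<in> borel_measurable borel"
  shows "integrable lborel (\<lambda>x. f x * ee (g x))"
  using assms(1) by (rule Bochner_Integration.integrable_bound) (use assms in \<open>auto simp: norm_mult\<close>)

lemma lborel_reflect: "lborel = distr lborel borel (\<lambda>x. a - x :: 'a::euclidean_space)"
proof -
  have "lborel = density (distr lborel borel (\<lambda>x. a - x)) (\<lambda>_. 1)"
    using lborel_affine[of "-1::real" a] by simp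
  then show ?thesis by (simp add: density_1)
qed

lemma integral_lborel_reflect:
  fixes h :: "'a::euclidean_space \<Rightarrow> 'b::{banach, second_countable_topology}"
  assumes [measurable]: "h \<in> borel_measurable borel"
  shows "(\<integral>x. h (a - x) \<partial>lborel) = (\<integral>x. h x \<partial>lborel)"
  by (subst (2) lborel_reflect[of a]) (simp add: integral_distr)

lemma integrable_lborel_reflect:
  fixes h :: "'a::euclidean_space \<Rightarrow> 'b::{banach, second_countable_topology}"
  assumes "integrable lborel h"
  shows "integrable lborel (\<lambda>x. h (a - x))"
proof -
  have "integrable (distr lborel borel (\<lambda>x. a - x)) h" using assms lborel_reflect[of a] by simp
  then show ?thesis by (subst (asm) integrable_distr_eq) (use assms in auto)
qed

definition vec_of :: "('n \<Rightarrow> int) \<Rightarrow> real^'n" where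
  "vec_of m = (\<chi> i. of_int (m i))"

lemma vec_of_nth [simp]: "vec_of m $ i = of_int (m i)"
  by (simp add: vec_of_def)

lemma inj_vec_of: "inj_on vec_of A"
  by (auto simp: inj_on_def vec_eq_iff fun_eq_iff)

lemma vec_of_0 [simp]: "vec_of (\<lambda>_. 0) = 0"
  by (simp add: vec_eq_iff)

lemma vec_of_lattice: "vec_of m \<in> int_lattice"
  by (simp add: int_lattice_def)

lemma norm_vec_of: "(norm (vec_of m))\<^sup>2 = of_int (\<Sum>i\<in>UNIV. (m i)\<^sup>2)"
  by (simp add: norm_vec_def L2_set_def sum_nonneg)

lemma inner_vec_of: "vec_of m \<bullet> x = (\<Sum>i\<in>UNIV. of_int (m i) * x $ i)"
  by (simp add: inner_vec_def)

lemma integral_cube_ee: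
  fixes m :: "'n::finite \<Rightarrow> int"
  shows "(\<integral>x. indicator (cube 0) x *\<^sub>R ee (vec_of m \<bullet> x) \<partial>(lborel :: (real^'n) measure)) = (if m = (\<lambda>_. 0) then 1 else 0)"
proof -
  have "(\<integral>x. indicator (cube 0) x *\<^sub>R ee (vec_of m \<bullet> x) \<partial>(lborel :: (real^'n) measure)) =
      (\<integral>x. (\<Prod>i\<in>UNIV. indicator {0..1} (x $ i) *\<^sub>R ee (of_int (m i) * x $ i)) \<partial>(lborel :: (real^'n) measure))"
    by (intro Bochner_Integration.integral_cong refl)
       (simp add: indicator_cube inner_vec_of ee_sum prod.distrib scaleR_conv_of_real of_real_prod)
  also have "\<dots> = (\<Prod>i\<in>UNIV. \<integral>t. indicator {0..1} t *\<^sub>R ee (of_int (m i) * t) \<partial>lborel)"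
    by (rule integral_lborel_prod_vec) (intro borel_integrable_compact, auto intro!: continuous_intros)
  also have "\<dots> = (\<Prod>i\<in>UNIV. if m i = 0 then 1 else 0)"
    by (simp only: integral_ee)
  also have "\<dots> = (if m = (\<lambda>_. 0) then 1 else 0)"
    by (auto simp: fun_eq_iff intro!: prod_zero)
  finally show ?thesis .
qed

lemma integrable_cube_mult:
  fixes f :: "real^'n \<Rightarrow> 'b::{banach, second_countable_topology}"
  assumes [measurable]: "f \<in> borel_measurable borel" and "\<And>x. norm (f x) \<le> B"
  shows "integrable lborel (\<lambda>x. indicator (cube a) x *\<^sub>R f x)"
  by (rule integrableI_bounded_set_indicator[where B = B]) (use assms in \<open>auto simp: emeasure_cube\<close>)

lemma trig_poly_norm_sq:
  fixes A :: "('n::finite \<Rightarrow> int) set"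
  assumes A: "finite A"
  shows "(\<integral>\<^sup>+x. indicator (cube 0) x * ennreal ((norm (\<Sum>m\<in>A. c m * ee (vec_of m \<bullet> x)))\<^sup>2) \<partial>(lborel :: (real^'n) measure)) = ennreal (\<Sum>m\<in>A. (norm (c m))\<^sup>2)"
proof -
  let ?T = "\<lambda>x::real^'n. \<Sum>m\<in>A. c m * ee (vec_of m \<bullet> x)"
  have m[measurable]: "?T \<in> borel_measurable borel" by measurable
  have bd: "norm (?T x) \<le> (\<Sum>m\<in>A. norm (c m))" for x
    by (rule order_trans[OF norm_sum]) (simp add: norm_mult)
  have bd2: "norm ((norm (?T x))\<^sup>2) \<le> (\<Sum>m\<in>A. norm (c m))\<^sup>2" for x
    using power_mono[OF bd[of x], of 2] by simp
  have int: "integrable lborel (\<lambda>x::real^'n. indicator (cube 0) x *\<^sub>R (norm (?T x))\<^sup>2)"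
    by (rule integrable_cube_mult[OF _ bd2]) measurable
  have sq: "complex_of_real ((norm (?T x))\<^sup>2) = (\<Sum>k\<in>A. \<Sum>l\<in>A. (c k * cnj (c l)) * ee (vec_of (\<lambda>i. k i - l i) \<bullet> x))" for x
  proof -
    have "vec_of (\<lambda>i. k i - l i) \<bullet> x = vec_of k \<bullet> x - vec_of l \<bullet> x" for k l :: "'n \<Rightarrow> int"
      unfolding inner_diff_left[symmetric] by (simp add: vec_of_def minus_vec_def)
    then show ?thesis
      unfolding complex_norm_square by (simp add: sum_product cnj_sum ee_diff mult_ac)
  qed
  have int2: "integrable lborel (\<lambda>x::real^'n. indicator (cube 0) x *\<^sub>R ee (vec_of m \<bullet> x))" for m
    by (rule integrable_cube_mult[of _ 1]) auto
  have "complex_of_real (\<integral>x. indicator (cube 0) x *\<^sub>R (norm (?T x))\<^sup>2 \<partial>lborel) = (\<integral>x. complex_of_real (indicator (cube 0) x *\<^sub>R (norm (?T x))\<^sup>2) \<partial>lborel)"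
    by (rule integral_complex_of_real[symmetric])
  also have "\<dots> = (\<integral>x. (\<Sum>k\<in>A. \<Sum>l\<in>A. (c k * cnj (c l)) * (indicator (cube 0) x *\<^sub>R ee (vec_of (\<lambda>i. k i - l i) \<bullet> x))) \<partial>(lborel :: (real^'n) measure))"
    unfolding real_scaleR_def of_real_mult sq
    by (intro Bochner_Integration.integral_cong refl) (simp add: scaleR_conv_of_real sum_distrib_left mult_ac)
  also have "\<dots> = (\<Sum>k\<in>A. \<Sum>l\<in>A. (c k * cnj (c l)) * (if (\<lambda>i. k i - l i) = (\<lambda>_. 0) then 1 else 0))"
    by (simp only: Bochner_Integration.integral_sum Bochner_Integration.integrable_sum int2 integrable_mult_right integral_mult_right_zero integral_cube_ee)
  also have "\<dots> = (\<Sum>k\<in>A. \<Sum>l\<in>A. if k = l then c k * cnj (c l) else 0)"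
    by (intro sum.cong refl) (auto simp: fun_eq_iff)
  also have "\<dots> = (\<Sum>k\<in>A. c k * cnj (c k))"
    using A by simp
  also have "\<dots> = complex_of_real (\<Sum>m\<in>A. (norm (c m))\<^sup>2)"
    by (simp only: of_real_sum complex_norm_square)
  finally have eq: "(\<integral>x. indicator (cube 0) x *\<^sub>R (norm (?T x))\<^sup>2 \<partial>lborel) = (\<Sum>m\<in>A. (norm (c m))\<^sup>2)"
    by (simp only: of_real_eq_iff)
  have "(\<integral>\<^sup>+x. indicator (cube 0) x * ennreal ((norm (?T x))\<^sup>2) \<partial>lborel) = (\<integral>\<^sup>+x. ennreal (indicator (cube 0) x *\<^sub>R (norm (?T x))\<^sup>2) \<partial>lborel)"
    by (intro nn_integral_cong) (simp add: indicator_def)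
  also have "\<dots> = ennreal (\<integral>x. indicator (cube 0) x *\<^sub>R (norm (?T x))\<^sup>2 \<partial>lborel)"
    by (rule nn_integral_eq_integral[OF int]) simp
  finally show ?thesis unfolding eq .
qed

section \<open>The product kernel and trigonometric means of a periodization\<close>

definition kern :: "nat \<Rightarrow> real^'n \<Rightarrow> real" where
  "kern N u = (\<Prod>i\<in>UNIV. vp N (u $ i))"

definition kern_coeff :: "nat \<Rightarrow> ('n::finite \<Rightarrow> int) \<Rightarrow> real" where
  "kern_coeff N m = (\<Prod>i\<in>UNIV. vp_coeff N (m i))"

definition freqs :: "nat \<Rightarrow> ('n::finite \<Rightarrow> int) set" where
  "freqs N = PiE UNIV (\<lambda>_. {-int N..int N})"

lemma finite_freqs: "finite (freqs N)"
  unfolding freqs_def by (intro finite_PiE) auto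

lemma zero_freqs: "(\<lambda>_. 0) \<in> freqs N"
  by (auto simp: freqs_def)

lemma kern_coeff_bounds: "0 \<le> kern_coeff N m" "kern_coeff N m \<le> 1" "kern_coeff N (\<lambda>_. 0) = 1"
  unfolding kern_coeff_def using vp_coeff_bounds by (auto intro!: prod_nonneg prod_le_1)

lemma kern_nonneg: "0 \<le> kern N u"
  unfolding kern_def by (intro prod_nonneg) (auto simp: vp_nonneg)

lemma measurable_kern [measurable]: "kern N \<in> borel_measurable borel"
  unfolding kern_def[abs_def] by measurable

lemma kern_expand: "complex_of_real (kern N u) = (\<Sum>m\<in>freqs N. kern_coeff N m * ee (vec_of m \<bullet> u))"
proof -
  have "complex_of_real (kern N u) = (\<Prod>i\<in>UNIV. \<Sum>k\<in>{-int N..int N}. vp_coeff N k * ee (k * u $ i))"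
    by (simp add: kern_def vp_expand)
  also have "\<dots> = (\<Sum>m\<in>freqs N. \<Prod>i\<in>UNIV. vp_coeff N (m i) * ee (m i * u $ i))"
    unfolding freqs_def by (rule prod_sum_PiE) auto
  finally show ?thesis by (simp add: prod.distrib kern_coeff_def inner_vec_of ee_sum)
qed

lemma kern_le_const: "kern N (u :: real^'n) \<le> (2 * real N + 1) ^ CARD('n)"
  using prod_mono[of UNIV "\<lambda>i. vp N (u $ i)" "\<lambda>_. 2 * real N + 1"] vp_nonneg vp_le_const
  by (simp add: kern_def)

lemma kern_le_away:
  fixes u :: "real^'n"
  assumes "0 \<le> \<delta>" "\<delta> \<le> distZ (u $ j)"
  shows "kern N u \<le> (2 * real N + 1) ^ CARD('n) * (1 - \<delta>\<^sup>2) ^ N"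
proof -
  have "kern N u = vp N (u $ j) * (\<Prod>i\<in>UNIV - {j}. vp N (u $ i))"
    unfolding kern_def by (rule prod.remove) auto
  also have "\<dots> \<le> ((2 * real N + 1) * (1 - \<delta>\<^sup>2) ^ N) * (\<Prod>i\<in>UNIV - {j}. 2 * real N + 1)"
    using assms vp_nonneg vp_le_const by (intro mult_mono vp_le_away prod_mono prod_nonneg)
      (auto intro: order_trans[OF vp_nonneg vp_le_away])
  also have "\<dots> = (2 * real N + 1) * (2 * real N + 1) ^ (CARD('n) - 1) * (1 - \<delta>\<^sup>2) ^ N"
    by (simp add: mult_ac)
  also have "(2 * real N + 1) * (2 * real N + 1) ^ (CARD('n) - 1) = (2 * real N + 1) ^ CARD('n)"
    by (simp flip: power_Suc)
  finally show ?thesis .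
qed

lemma nn_integral_kern: "(\<integral>\<^sup>+u. indicator (cube a) u * ennreal (kern N u) \<partial>(lborel :: (real^'n) measure)) = 1"
proof -
  have "(\<integral>\<^sup>+u. indicator (cube a) u * ennreal (kern N u) \<partial>(lborel :: (real^'n) measure)) =
     (\<integral>\<^sup>+u. (\<Prod>i\<in>UNIV. indicator {a..a+1} (u $ i) * ennreal (vp N (u $ i))) \<partial>(lborel :: (real^'n) measure))"
    unfolding indicator_cube kern_def by (simp add: prod.distrib prod_ennreal vp_nonneg)
  also have "\<dots> = (\<Prod>i\<in>(UNIV :: 'n set). \<integral>\<^sup>+t. indicator {a..a+1} t * ennreal (vp N t) \<partial>lborel)"
    by (rule nn_integral_lborel_prod_vec) measurable
  also have "(\<integral>\<^sup>+t. indicator {a..a+1} t * ennreal (vp N t) \<partial>lborel) = (\<integral>\<^sup>+t. ennreal (indicator {a..a+1} t * vp N t) \<partial>lborel)"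
    by (intro nn_integral_cong) (simp add: indicator_def)
  also have "\<dots> = 1"
    by (subst nn_integral_eq_integral[OF integrable_vp]) (auto simp: vp_nonneg integral_vp)
  finally show ?thesis by simp
qed

lemma integral_kern: "(\<integral>u. indicator (cube a) u * kern N u \<partial>(lborel :: (real^'n) measure)) = 1"
proof -
  have "norm (kern N u) \<le> (2 * real N + 1) ^ CARD('n)" for u :: "real^'n"
    using kern_le_const[of N u] kern_nonneg[of N u] by simp
  then have "integrable lborel (\<lambda>u::real^'n. indicator (cube a) u *\<^sub>R kern N u)"
    by (intro integrable_cube_mult) measurable
  then have "ennreal (\<integral>u. indicator (cube a) u *\<^sub>R kern N u \<partial>(lborel :: (real^'n) measure)) = (\<integral>\<^sup>+u. ennreal (indicator (cube a) u *\<^sub>R kern N u) \<partial>(lborel :: (real^'n) measure))"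
    by (intro nn_integral_eq_integral[symmetric]) (auto simp: kern_nonneg)
  also have "\<dots> = (\<integral>\<^sup>+u. indicator (cube a) u * ennreal (kern N u) \<partial>(lborel :: (real^'n) measure))"
    by (intro nn_integral_cong) (simp add: indicator_def)
  also have "\<dots> = 1" by (rule nn_integral_kern)
  finally show ?thesis by simp
qed

lemma kern_periodic:
  assumes "\<nu> \<in> int_lattice"
  shows "kern N (u + \<nu>) = kern N u"
proof -
  have "complex_of_real (kern N (u + \<nu>)) = complex_of_real (kern N u)"
    unfolding kern_expand
  proof (intro sum.cong refl)
    fix m :: "'a \<Rightarrow> int"
    have "vec_of m \<bullet> \<nu> \<in> \<int>"
      unfolding inner_vec_of using assms by (intro Ints_sum Ints_mult) (auto simp: int_lattice_def)
    then show "kern_coeff N m * ee (vec_of m \<bullet> (u + \<nu>)) = kern_coeff N m * ee (vec_of m \<bullet> u)"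
      by (simp add: inner_add_right ee_add ee_Ints)
  qed
  then show ?thesis by (simp only: of_real_eq_iff)
qed

text \<open>\<open>fhat F (vec_of m)\<close> is the m-th Fourier coefficient of the periodization of
  F, so this is the convolution of that periodization with \<open>kern\<close>, written as a
  trigonometric polynomial.\<close>

definition kern_mean :: "nat \<Rightarrow> (real^'n \<Rightarrow> complex) \<Rightarrow> real^'n \<Rightarrow> complex" where
  "kern_mean N F x = (\<Sum>m\<in>freqs N. (kern_coeff N m * fhat F (vec_of m)) * ee (vec_of m \<bullet> x))"

lemma kern_mean_eq:
  assumes F: "integrable lborel F"
  shows "kern_mean N F x = (\<integral>u. F (x - u) * kern N u \<partial>lborel)"
proof -
  have [measurable]: "F \<in> borel_measurable borel" using F by (simp add: borel_measurable_integrable)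
  have i: "integrable lborel (\<lambda>u. F (x - u) * ee (vec_of m \<bullet> u))" for m
    by (intro integrable_mult_ee integrable_lborel_reflect F) measurable
  have "(\<integral>u. F (x - u) * kern N u \<partial>lborel) = (\<integral>u. (\<Sum>m\<in>freqs N. kern_coeff N m * (F (x - u) * ee (vec_of m \<bullet> u))) \<partial>lborel)"
    unfolding kern_expand by (simp add: sum_distrib_left mult_ac)
  also have "\<dots> = (\<Sum>m\<in>freqs N. kern_coeff N m * (\<integral>u. F (x - u) * ee (vec_of m \<bullet> u) \<partial>lborel))"
    by (simp only: Bochner_Integration.integral_sum i integrable_mult_right integral_mult_right_zero)
  also have "\<dots> = (\<Sum>m\<in>freqs N. kern_coeff N m * (fhat F (vec_of m) * ee (vec_of m \<bullet> x)))"
  proof (intro sum.cong refl arg_cong2[where f = "(*)"])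
    fix m :: "'a \<Rightarrow> int"
    have "(\<integral>u. F (x - u) * ee (vec_of m \<bullet> u) \<partial>lborel) = (\<integral>y. F (x - (x - y)) * ee (vec_of m \<bullet> (x - y)) \<partial>lborel)"
      by (subst integral_lborel_reflect[symmetric, of _ x]) measurable
    also have "\<dots> = (\<integral>y. (F y * ee (- (vec_of m \<bullet> y))) * ee (vec_of m \<bullet> x) \<partial>lborel)"
      by (intro Bochner_Integration.integral_cong refl) (simp add: inner_diff_right ee_diff cnj_ee)
    also have "\<dots> = fhat F (vec_of m) * ee (vec_of m \<bullet> x)"
      unfolding fhat_def by (rule integral_mult_left_zero)
    finally show "(\<integral>u. F (x - u) * ee (vec_of m \<bullet> u) \<partial>lborel) = fhat F (vec_of m) * ee (vec_of m \<bullet> x)" .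
  qed
  finally show ?thesis unfolding kern_mean_def by (simp add: mult_ac)
qed

text \<open>For non-integrable f the Bochner integral is 0 by convention.\<close>

lemma ennreal_norm_integral_le:
  fixes f :: "'a \<Rightarrow> 'b::{banach, second_countable_topology}"
  shows "ennreal (norm (\<integral>x. f x \<partial>M)) \<le> (\<integral>\<^sup>+x. ennreal (norm (f x)) \<partial>M)"
proof (cases "integrable M f")
  case True
  then show ?thesis by (rule integral_norm_bound_ennreal)
next
  case False
  show ?thesis unfolding not_integrable_integral_eq[OF False] by (simp only: norm_zero ennreal_0 zero_le)
qed

lemma ennreal_norm_sums_le:
  fixes f :: "nat \<Rightarrow> 'b::banach"
  assumes "f sums s"
  shows "ennreal (norm s) \<le> (\<Sum>k. ennreal (norm (f k)))"
proof (cases "(\<Sum>k. ennreal (norm (f k))) = \<top>")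
  case False
  then have sm: "summable (\<lambda>k. norm (f k))" by (intro summable_suminf_not_top) auto
  have "norm s = norm (\<Sum>k. f k)" using assms by (simp add: sums_iff)
  also have "\<dots> \<le> (\<Sum>k. norm (f k))" by (rule summable_norm[OF sm])
  finally have "ennreal (norm s) \<le> ennreal (\<Sum>k. norm (f k))" by (rule ennreal_leI)
  also have "\<dots> = (\<Sum>k. ennreal (norm (f k)))" by (rule suminf_ennreal2[OF _ sm, symmetric]) auto
  finally show ?thesis .
qed simp

text \<open>The centred cube is the period cell on which the distance of a coordinate to the
  integers is its absolute value.\<close>

definition kern_error :: "nat \<Rightarrow> (real^'n \<Rightarrow> complex) \<Rightarrow> ennreal" where
  "kern_error N F = (\<integral>\<^sup>+u. indicator (cube (-1/2)) u * ennreal (kern N u) * L1_modulus F u \<partial>lborel)"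

lemma measurable_L1_modulus [measurable]:
  assumes [measurable]: "F \<in> borel_measurable borel"
  shows "L1_modulus F \<in> borel_measurable borel"
proof -
  have eq: "L1_modulus F = (\<lambda>u. \<integral>\<^sup>+x. ennreal (norm (F (x - u) - F x)) \<partial>lborel)"
    by (rule ext) (rule L1_modulus_def)
  show ?thesis unfolding eq by measurable
qed

text \<open>Folding the convolution over the whole space into the centred cube uses the periodicity
  of \<open>kern\<close>; since the kernel has integral 1 there, the value
  \<open>F (x + e k)\<close> can be pulled under the integral. Unfolding in x leaves the L^1 modulus
  of F averaged against the kernel.\<close>

lemma kern_mean_L1:
  fixes F :: "real^'n \<Rightarrow> complex"
  assumes F: "integrable lborel F" and e: "bij_betw e UNIV int_lattice"
  shows "(\<integral>\<^sup>+x. indicator (cube 0) x * ennreal (norm (kern_mean N F x - (\<Sum>k. F (x + e k)))) \<partial>lborel) \<le> kern_error N F"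
proof -
  have [measurable]: "F \<in> borel_measurable borel" using F by (simp add: borel_measurable_integrable)
  let ?Q = "cube (-1/2) :: (real^'n) set"
  have lat: "e k \<in> int_lattice" for k by (rule bij_betw_apply[OF e UNIV_I])
  \<comment> \<open>Folding in u shifts by the negated vectors, so that the argument x - u is
    shifted by \<open>e k\<close>.\<close>
  have e': "bij_betw (\<lambda>k. - e k) UNIV int_lattice"
  proof -
    have "bij_betw (uminus \<circ> e) UNIV int_lattice"
      by (rule bij_betw_trans[OF e], rule bij_betw_byWitness[of _ uminus]) (auto intro: int_lattice_uminus)
    then show ?thesis by (simp add: o_def)
  qed
  define H where "H = (\<lambda>y. \<integral>\<^sup>+u. indicator ?Q u * ennreal (kern N u) * ennreal (norm (F (y - u) - F y)) \<partial>lborel)"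
  have [measurable]: "H \<in> borel_measurable borel" unfolding H_def by measurable
  have "(\<integral>\<^sup>+x. indicator (cube 0) x * ennreal (norm (kern_mean N F x - (\<Sum>k. F (x + e k)))) \<partial>lborel)
      \<le> (\<integral>\<^sup>+x. indicator (cube 0) x * (\<Sum>k. H (x + e k)) \<partial>lborel)"
  proof (intro nn_integral_mono_AE, use AE_summable_tile[OF e F, of 0] in eventually_elim)
    fix x assume s: "x \<in> cube 0 \<longrightarrow> summable (\<lambda>k. norm (F (x + e k)))"
    show "indicator (cube 0) x * ennreal (norm (kern_mean N F x - (\<Sum>k. F (x + e k)))) \<le> indicator (cube 0) x * (\<Sum>k. H (x + e k))"
    proof (cases "x \<in> cube 0")
      case True
      let ?h = "\<lambda>u. F (x - u) * kern N u"
      have kb: "norm (kern N u) \<le> (2 * real N + 1) ^ CARD('n)" for u :: "real^'n"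
        using kern_le_const[of N u] kern_nonneg[of N u] by simp
      have ki: "integrable lborel (\<lambda>u::real^'n. indicator ?Q u *\<^sub>R kern N u)"
        by (rule integrable_cube_mult[OF _ kb]) measurable
      have h: "integrable lborel ?h"
      proof (rule Bochner_Integration.integrable_bound)
        show "integrable lborel (\<lambda>u. (2 * real N + 1) ^ CARD('n) * norm (F (x - u)))"
          by (intro integrable_mult_right integrable_norm integrable_lborel_reflect F)
        show "AE u in lborel. norm (?h u) \<le> norm ((2 * real N + 1) ^ CARD('n) * norm (F (x - u)))"
        proof (rule AE_I2)
          fix u
          have "norm (?h u) = norm (kern N u) * norm (F (x - u))" by (simp add: norm_mult)
          also have "\<dots> \<le> (2 * real N + 1) ^ CARD('n) * norm (F (x - u))" by (intro mult_right_mono kb) simp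
          finally show "norm (?h u) \<le> norm ((2 * real N + 1) ^ CARD('n) * norm (F (x - u)))" by simp
        qed
      qed measurable
      have s1: "(\<lambda>k. \<integral>u. indicator ?Q u *\<^sub>R ?h (u + - e k) \<partial>lborel) sums kern_mean N F x"
        unfolding kern_mean_eq[OF F] by (rule sums_integral_tile[OF e' h])
      have s2: "(\<lambda>k. F (x + e k)) sums (\<Sum>k. F (x + e k))"
        using s True by (intro summable_sums[OF summable_norm_cancel]) simp
      have s3: "(\<lambda>k. (\<integral>u. indicator ?Q u *\<^sub>R ?h (u + - e k) \<partial>lborel) - F (x + e k)) sums (kern_mean N F x - (\<Sum>k. F (x + e k)))"
        by (rule sums_diff[OF s1 s2])
      have eq: "(\<integral>u. indicator ?Q u *\<^sub>R ?h (u + - e k) \<partial>lborel) - F (x + e k)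
          = (\<integral>u. indicator ?Q u *\<^sub>R ((F ((x + e k) - u) - F (x + e k)) * kern N u) \<partial>lborel)" for k
      proof -
        have per: "kern N (u + - e k) = kern N u" for u
          by (rule kern_periodic[OF int_lattice_uminus[OF lat]])
        have i1: "integrable lborel (\<lambda>u. indicator ?Q u *\<^sub>R ?h (u + - e k))"
          by (intro integrable_mult_indicator integrable_lborel_translate[OF h]) simp
        have i2: "integrable lborel (\<lambda>u. F (x + e k) * (complex_of_real (indicator ?Q u *\<^sub>R kern N u)))"
          using ki by (intro integrable_mult_right integrable_of_real)
        have "(\<integral>u. F (x + e k) * (complex_of_real (indicator ?Q u *\<^sub>R kern N u)) \<partial>lborel) = F (x + e k)"
          unfolding integral_mult_right_zero integral_complex_of_real by (simp add: integral_kern)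
        then have "(\<integral>u. indicator ?Q u *\<^sub>R ?h (u + - e k) \<partial>lborel) - F (x + e k) =
           (\<integral>u. indicator ?Q u *\<^sub>R ?h (u + - e k) - F (x + e k) * (complex_of_real (indicator ?Q u *\<^sub>R kern N u)) \<partial>lborel)"
          by (simp only: Bochner_Integration.integral_diff[OF i1 i2])
        also have "\<dots> = (\<integral>u. indicator ?Q u *\<^sub>R ((F ((x + e k) - u) - F (x + e k)) * kern N u) \<partial>lborel)"
        proof (rule Bochner_Integration.integral_cong[OF refl])
          fix u
          have "x - (u + - e k) = (x + e k) - u" by simp
          then have Feq: "F (x - (u + - e k)) = F ((x + e k) - u)" by (rule arg_cong)
          show "indicator ?Q u *\<^sub>R ?h (u + - e k) - F (x + e k) * (complex_of_real (indicator ?Q u *\<^sub>R kern N u))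
              = indicator ?Q u *\<^sub>R ((F ((x + e k) - u) - F (x + e k)) * kern N u)"
            unfolding per Feq by (cases "u \<in> ?Q") (simp_all add: left_diff_distrib)
        qed
        finally show ?thesis .
      qed
      have "ennreal (norm (kern_mean N F x - (\<Sum>k. F (x + e k)))) \<le>
          (\<Sum>k. ennreal (norm (\<integral>u. indicator ?Q u *\<^sub>R ((F ((x + e k) - u) - F (x + e k)) * kern N u) \<partial>lborel)))"
        using ennreal_norm_sums_le[OF s3] unfolding eq .
      also have "\<dots> \<le> (\<Sum>k. H (x + e k))"
      proof (intro suminf_le summableI)
        fix k
        have "ennreal (norm (\<integral>u. indicator ?Q u *\<^sub>R ((F ((x + e k) - u) - F (x + e k)) * kern N u) \<partial>lborel))
           \<le> (\<integral>\<^sup>+u. ennreal (norm (indicator ?Q u *\<^sub>R ((F ((x + e k) - u) - F (x + e k)) * kern N u))) \<partial>lborel)"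
          by (rule ennreal_norm_integral_le)
        also have "\<dots> = H (x + e k)"
          unfolding H_def
        proof (rule nn_integral_cong)
          fix u
          show "ennreal (norm (indicator ?Q u *\<^sub>R ((F ((x + e k) - u) - F (x + e k)) * kern N u))) = indicator ?Q u * ennreal (kern N u) * ennreal (norm (F ((x + e k) - u) - F (x + e k)))"
            using kern_nonneg[of N u] by (cases "u \<in> ?Q") (simp_all add: norm_mult ennreal_mult mult.commute)
        qed
        finally show "ennreal (norm (\<integral>u. indicator ?Q u *\<^sub>R ((F ((x + e k) - u) - F (x + e k)) * kern N u) \<partial>lborel)) \<le> H (x + e k)" .
      qed
      finally show ?thesis using True by simp
    qed simp
  qed
  also have "\<dots> = (\<integral>\<^sup>+y. H y \<partial>lborel)" by (rule nn_integral_tile[OF e]) measurable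
  also have "\<dots> = (\<integral>\<^sup>+u. (\<integral>\<^sup>+y. indicator ?Q u * ennreal (kern N u) * ennreal (norm (F (y - u) - F y)) \<partial>lborel) \<partial>lborel)"
    unfolding H_def by (rule lborel_pair.Fubini') measurable
  also have "\<dots> = kern_error N F"
    unfolding kern_error_def L1_modulus_def by (intro nn_integral_cong nn_integral_cmult) measurable
  finally show ?thesis .
qed

lemma L1_modulus_le:
  fixes F :: "'a::euclidean_space \<Rightarrow> 'b::{banach, second_countable_topology}"
  assumes [measurable]: "F \<in> borel_measurable borel"
  shows "L1_modulus F u \<le> 2 * (\<integral>\<^sup>+x. ennreal (norm (F x)) \<partial>lborel)"
proof -
  have z: "L1_modulus (\<lambda>_::'a. 0::'b) u = 0" by (simp add: L1_modulus_def)
  have "L1_modulus F u \<le> L1_modulus (\<lambda>_::'a. 0::'b) u + 2 * (\<integral>\<^sup>+x. ennreal (norm (F x - 0)) \<partial>lborel)"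
    by (rule L1_modulus_triangle) measurable
  then show ?thesis unfolding z by simp
qed

text \<open>If all |u_i| < \<delta>, the modulus is small and the kernel has total mass 1 on the
  cube. Otherwise some coordinate is at distance at least \<delta> from the integers, and the
  exponential decay of the kernel beats the trivial bound of the modulus by twice the L^1
  norm.\<close>

lemma kern_error_small:
  fixes F :: "real^'n \<Rightarrow> complex"
  assumes F: "integrable lborel F" and "\<epsilon> > 0"
  shows "\<forall>\<^sub>F N in sequentially. kern_error N F \<le> ennreal \<epsilon>"
proof -
  have [measurable]: "F \<in> borel_measurable borel" using F by (simp add: borel_measurable_integrable)
  let ?Q = "cube (-1/2) :: (real^'n) set"
  let ?d = "CARD('n)"
  define A where "A = (\<integral>x. norm (F x) \<partial>lborel)"
  have A: "(\<integral>\<^sup>+x. ennreal (norm (F x)) \<partial>lborel) = ennreal A" "0 \<le> A"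
    unfolding A_def using F by (auto intro!: nn_integral_eq_integral)
  obtain \<delta>0 where \<delta>0: "\<delta>0 > 0" "\<And>u. norm u < \<delta>0 \<Longrightarrow> L1_modulus F u \<le> ennreal (\<epsilon> / 2)"
    using L1_modulus_tendsto_0[OF F, of "\<epsilon> / 2"] \<open>\<epsilon> > 0\<close> by auto
  \<comment> \<open>Division by the dimension turns a bound on every coordinate into one on the
    norm.\<close>
  define \<delta> where "\<delta> = min (1 / 4) (\<delta>0 / (2 * real ?d))"
  have \<delta>: "0 < \<delta>" "\<delta> \<le> 1 / 4" "real ?d * \<delta> < \<delta>0"
  proof -
    have "real ?d * \<delta> \<le> real ?d * (\<delta>0 / (2 * real ?d))" unfolding \<delta>_def by (intro mult_left_mono) auto
    also have "\<dots> = \<delta>0 / 2" by simp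
    also have "\<dots> < \<delta>0" using \<delta>0(1) by simp
    finally show "real ?d * \<delta> < \<delta>0" .
  qed (use \<delta>0(1) in \<open>auto simp: \<delta>_def\<close>)
  let ?t = "\<lambda>N. (2 * real N + 1) ^ ?d * (1 - \<delta>\<^sup>2) ^ N"
  have d2: "0 < \<delta>\<^sup>2" "\<delta>\<^sup>2 < 1" using \<delta> by (auto simp: power_less_one_iff abs_square_less_1)
  have t0: "0 \<le> ?t N" for N using d2 by (intro mult_nonneg_nonneg zero_le_power) auto
  have "(\<lambda>N. 2 * A * ?t N) \<longlonglongrightarrow> 2 * A * 0"
    using d2 by (intro tendsto_intros vp_tail_tendsto_0) auto
  then have "\<forall>\<^sub>F N in sequentially. 2 * A * ?t N < \<epsilon> / 2"
    using \<open>\<epsilon> > 0\<close> by (intro order_tendstoD) auto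
  then show ?thesis
  proof eventually_elim
    fix N assume N: "2 * A * ?t N < \<epsilon> / 2"
    have "kern_error N F \<le> (\<integral>\<^sup>+u. ennreal (\<epsilon> / 2) * (indicator ?Q u * ennreal (kern N u)) + ennreal (2 * A * ?t N) * indicator ?Q u \<partial>lborel)"
      unfolding kern_error_def
    proof (rule nn_integral_mono)
      fix u :: "real^'n"
      show "indicator ?Q u * ennreal (kern N u) * L1_modulus F u \<le> ennreal (\<epsilon> / 2) * (indicator ?Q u * ennreal (kern N u)) + ennreal (2 * A * ?t N) * indicator ?Q u"
      proof (cases "u \<in> ?Q")
        case True
        show ?thesis
        proof (cases "\<forall>i. \<bar>u $ i\<bar> < \<delta>")
          case *: True
          have "norm u \<le> (\<Sum>i\<in>UNIV. \<bar>u $ i\<bar>)" by (rule norm_le_l1_cart)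
          also have "\<dots> \<le> (\<Sum>i\<in>(UNIV :: 'n set). \<delta>)" using * by (intro sum_mono) (auto intro: less_imp_le)
          also have "\<dots> < \<delta>0" using \<delta> by simp
          finally have "L1_modulus F u \<le> ennreal (\<epsilon> / 2)" by (rule \<delta>0(2))
          then have "ennreal (kern N u) * L1_modulus F u \<le> ennreal (kern N u) * ennreal (\<epsilon> / 2)"
            by (rule mult_left_mono) simp
          then show ?thesis using True by (simp add: mult.commute add_increasing2)
        next
          case False
          then obtain i where i: "\<delta> \<le> \<bar>u $ i\<bar>" by (auto simp: not_less)
          have "\<bar>u $ i - of_int 0\<bar> \<le> 1 / 2" using True by (auto simp: cube_def abs_le_iff dest!: spec[of _ i])
          from distZ_eq[OF this] have "\<delta> \<le> distZ (u $ i)" using i by simp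
          with \<delta> have k: "kern N u \<le> ?t N" by (intro kern_le_away) auto
          have "L1_modulus F u \<le> 2 * ennreal A" using L1_modulus_le[of F u] A by simp
          also have "\<dots> = ennreal (2 * A)" using A(2) by (simp add: ennreal_mult)
          finally have "ennreal (kern N u) * L1_modulus F u \<le> ennreal (?t N) * ennreal (2 * A)"
            using k by (intro mult_mono ennreal_leI) auto
          also have "\<dots> = ennreal (2 * A * ?t N)" using t0[of N] A(2) by (subst ennreal_mult[symmetric]) (auto simp: mult_ac)
          finally show ?thesis using True by (simp add: add_increasing)
        qed
      qed simp
    qed
    also have "\<dots> = ennreal (\<epsilon> / 2) * (\<integral>\<^sup>+u. indicator ?Q u * ennreal (kern N u) \<partial>lborel) + ennreal (2 * A * ?t N) * emeasure lborel ?Q"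
      by (simp add: nn_integral_add nn_integral_cmult nn_integral_cmult_indicator)
    also have "\<dots> = ennreal (\<epsilon> / 2) + ennreal (2 * A * ?t N)"
      by (simp add: nn_integral_kern emeasure_cube)
    also have "\<dots> \<le> ennreal (\<epsilon> / 2) + ennreal (\<epsilon> / 2)"
      using N by (intro add_mono ennreal_leI) auto
    also have "\<dots> = ennreal \<epsilon>" using \<open>\<epsilon> > 0\<close> by (subst ennreal_plus[symmetric]) auto
    finally show "kern_error N F \<le> ennreal \<epsilon>" .
  qed
qed

text \<open>\<open>Suc n\<close> leaves out the origin, whose contribution is the subtracted mean.
  Grouping by shells prepares the count, since rotational averages are constant on a shell.\<close>

definition lattice_energy :: "(real^'n \<Rightarrow> real) \<Rightarrow> ennreal" where
  "lattice_energy g = (\<Sum>n. ennreal (\<Sum>v\<in>shell (Suc n). g v))"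

lemma sum_freqs_le_lattice_energy:
  fixes g :: "real^'n \<Rightarrow> real"
  assumes d: "CARD('n) \<ge> 5" and g: "\<And>v. 0 \<le> g v"
  shows "ennreal (\<Sum>m\<in>freqs N - {\<lambda>_. 0}. g (vec_of m)) \<le> lattice_energy g"
proof -
  define K where "K = Suc (Max ((\<lambda>m::'n \<Rightarrow> int. nat (\<Sum>i\<in>UNIV. (m i)\<^sup>2)) ` freqs N))"
  have fs: "finite (shell (Suc n) :: (real^'n) set)" for n by (rule card_shell_le(1)[OF d]) simp
  have sub: "vec_of ` (freqs N - {\<lambda>_. 0}) \<subseteq> (\<Union>n<K. shell (Suc n) :: (real^'n) set)"
  proof (rule image_subsetI)
    fix m :: "'n \<Rightarrow> int" assume m: "m \<in> freqs N - {\<lambda>_. 0}"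
    define s where "s = (\<Sum>i\<in>UNIV. (m i)\<^sup>2)"
    have "s \<noteq> 0" unfolding s_def using m by (subst sum_nonneg_eq_0_iff) (auto simp: fun_eq_iff)
    moreover have "0 \<le> s" unfolding s_def by (intro sum_nonneg) auto
    ultimately have n: "s = int (Suc (nat (s - 1)))" by simp
    define n where "n = nat (s - 1)"
    note n = n[folded n_def]
    have "(norm (vec_of m :: real^'n))\<^sup>2 = real (Suc n)" using n by (simp add: norm_vec_of s_def)
    then have "vec_of m \<in> shell (Suc n)" by (simp add: shell_def vec_of_lattice)
    moreover have "n < K"
    proof -
      have "nat s \<le> Max ((\<lambda>m::'n \<Rightarrow> int. nat (\<Sum>i\<in>UNIV. (m i)\<^sup>2)) ` freqs N)"
        unfolding s_def using m finite_freqs by (intro Max_ge) auto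
      then show ?thesis using n by (simp add: K_def)
    qed
    ultimately show "vec_of m \<in> (\<Union>n<K. shell (Suc n))" by auto
  qed
  have "(\<Sum>m\<in>freqs N - {\<lambda>_. 0}. g (vec_of m)) = (\<Sum>v\<in>vec_of ` (freqs N - {\<lambda>_. 0}). g v)"
    by (simp add: sum.reindex[OF inj_vec_of])
  also have "\<dots> \<le> (\<Sum>v\<in>(\<Union>n<K. shell (Suc n)). g v)"
    using sub fs g by (intro sum_mono2) auto
  also have "\<dots> = (\<Sum>n<K. \<Sum>v\<in>shell (Suc n). g v)"
    using fs by (intro sum.UNION_disjoint) (auto simp: shell_def)
  finally have "ennreal (\<Sum>m\<in>freqs N - {\<lambda>_. 0}. g (vec_of m)) \<le> ennreal (\<Sum>n<K. \<Sum>v\<in>shell (Suc n). g v)"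
    by (rule ennreal_leI)
  also have "\<dots> = (\<Sum>n<K. ennreal (\<Sum>v\<in>shell (Suc n). g v))"
    using g by (intro sum_ennreal[symmetric] sum_nonneg) auto
  also have "\<dots> \<le> lattice_energy g"
    unfolding lattice_energy_def by (intro sum_le_suminf) auto
  finally show ?thesis .
qed

lemma fhat_0: "fhat F 0 = (\<integral>x. F x \<partial>lborel)"
  by (simp add: fhat_def)

text \<open>The zero frequency has kernel coefficient exactly 1 and cancels the integral of F; all
  other frequencies are multiplied by coefficients in [0, 1], so the energy can only drop.\<close>

lemma kern_mean_norm_sq_le:
  fixes F :: "real^'n \<Rightarrow> complex"
  assumes d: "CARD('n) \<ge> 5"
  shows "(\<integral>\<^sup>+x. indicator (cube 0) x * ennreal ((norm (kern_mean N F x - (\<integral>x. F x \<partial>lborel)))\<^sup>2) \<partial>lborel)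
    \<le> lattice_energy (\<lambda>\<xi>. (norm (fhat F \<xi>))\<^sup>2)"
proof -
  let ?A = "freqs N - {\<lambda>_. 0} :: ('n \<Rightarrow> int) set"
  have eq: "kern_mean N F x - (\<integral>x. F x \<partial>lborel) = (\<Sum>m\<in>?A. (kern_coeff N m * fhat F (vec_of m)) * ee (vec_of m \<bullet> x))" for x
    unfolding kern_mean_def
    by (subst sum.remove[OF finite_freqs zero_freqs]) (simp add: kern_coeff_bounds(3) fhat_0)
  have "(\<integral>\<^sup>+x. indicator (cube 0) x * ennreal ((norm (kern_mean N F x - (\<integral>x. F x \<partial>lborel)))\<^sup>2) \<partial>lborel)
      = ennreal (\<Sum>m\<in>?A. (norm (kern_coeff N m * fhat F (vec_of m)))\<^sup>2)"
    unfolding eq by (rule trig_poly_norm_sq) (simp add: finite_freqs)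
  also have "\<dots> \<le> ennreal (\<Sum>m\<in>?A. (norm (fhat F (vec_of m)))\<^sup>2)"
  proof (intro ennreal_leI sum_mono power_mono norm_ge_zero)
    fix m :: "'n \<Rightarrow> int"
    have "\<bar>kern_coeff N m\<bar> \<le> 1" using kern_coeff_bounds(1,2)[of N m] by simp
    then show "norm (kern_coeff N m * fhat F (vec_of m)) \<le> norm (fhat F (vec_of m))"
      by (simp add: norm_mult mult_left_le_one_le)
  qed
  also have "\<dots> \<le> lattice_energy (\<lambda>\<xi>. (norm (fhat F \<xi>))\<^sup>2)"
    by (rule sum_freqs_le_lattice_energy[OF d]) simp
  finally show ?thesis .
qed

text \<open>F is only assumed integrable, so the means converge to its periodization in L^1. A
  subsequence converges almost everywhere, and Fatou's lemma transfers the uniform L^2 bound of the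
  means to the limit.\<close>

lemma parseval_le:
  fixes F :: "real^'n \<Rightarrow> complex"
  assumes d: "CARD('n) \<ge> 5" and F: "integrable lborel F" and e: "bij_betw e UNIV int_lattice"
  shows "(\<integral>\<^sup>+x. indicator (cube 0) x * ennreal ((norm ((\<Sum>k. F (x + e k)) - (\<integral>x. F x \<partial>lborel)))\<^sup>2) \<partial>lborel)
    \<le> lattice_energy (\<lambda>\<xi>. (norm (fhat F \<xi>))\<^sup>2)"
proof -
  have [measurable]: "F \<in> borel_measurable borel" using F by (simp add: borel_measurable_integrable)
  define P where "P = (\<lambda>x. \<Sum>k. F (x + e k))"
  define c where "c = (\<integral>x. F x \<partial>lborel)"
  have [measurable]: "P \<in> borel_measurable borel" unfolding P_def by measurable
  have Tm[measurable]: "kern_mean N F \<in> borel_measurable borel" for N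
    unfolding kern_mean_def[abs_def] by measurable
  let ?u = "\<lambda>N x. indicator (cube 0) x *\<^sub>R (kern_mean N F x - P x)"
  have nn: "(\<integral>\<^sup>+x. ennreal (norm (?u N x)) \<partial>lborel) \<le> kern_error N F" for N
  proof -
    have "(\<integral>\<^sup>+x. ennreal (norm (?u N x)) \<partial>lborel) = (\<integral>\<^sup>+x. indicator (cube 0) x * ennreal (norm (kern_mean N F x - P x)) \<partial>lborel)"
      by (intro nn_integral_cong) (simp add: indicator_def)
    then show ?thesis unfolding P_def using kern_mean_L1[OF F e] by simp
  qed
  have int: "integrable lborel (?u N)" for N
  proof -
    have "norm (kern_mean N F x) \<le> (\<Sum>m\<in>freqs N. norm (kern_coeff N m * fhat F (vec_of m)))" for x
      unfolding kern_mean_def by (rule order_trans[OF norm_sum]) (simp add: norm_mult)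
    then have "integrable lborel (\<lambda>x. indicator (cube 0) x *\<^sub>R kern_mean N F x - indicator (cube 0) x *\<^sub>R P x)"
      unfolding P_def by (intro Bochner_Integration.integrable_diff integrable_cube_mult integrable_tile[OF e F]) measurable
    then show ?thesis by (simp add: scaleR_diff_right)
  qed
  have "(\<lambda>N. \<integral>x. norm (?u N x) \<partial>lborel) \<longlonglongrightarrow> 0"
  proof (rule LIMSEQ_I)
    fix r :: real assume "r > 0"
    then have "\<forall>\<^sub>F N in sequentially. kern_error N F \<le> ennreal (r / 2)" by (intro kern_error_small F) auto
    then obtain N0 where N0: "\<And>N. N \<ge> N0 \<Longrightarrow> kern_error N F \<le> ennreal (r / 2)"
      by (auto simp: eventually_sequentially)
    show "\<exists>no. \<forall>n\<ge>no. norm ((\<integral>x. norm (?u n x) \<partial>lborel) - 0) < r"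
    proof (intro exI[of _ N0] allI impI)
      fix n assume "n \<ge> N0"
      have "ennreal (\<integral>x. norm (?u n x) \<partial>lborel) = (\<integral>\<^sup>+x. ennreal (norm (?u n x)) \<partial>lborel)"
        by (intro nn_integral_eq_integral[symmetric] integrable_norm int) simp
      also have "\<dots> \<le> ennreal (r / 2)" using nn[of n] N0[OF \<open>n \<ge> N0\<close>] by (rule order_trans)
      finally have "(\<integral>x. norm (?u n x) \<partial>lborel) \<le> r / 2" using \<open>r > 0\<close> by simp
      moreover have "0 \<le> (\<integral>x. norm (?u n x) \<partial>lborel)" by (intro integral_nonneg_AE) simp
      ultimately show "norm ((\<integral>x. norm (?u n x) \<partial>lborel) - 0) < r" using \<open>r > 0\<close> by simp
    qed
  qed
  from tendsto_L1_AE_subseq[OF int this]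
  obtain r where r: "AE x in lborel. (\<lambda>n. ?u (r n) x) \<longlonglongrightarrow> 0" by blast
  let ?g = "\<lambda>n x. indicator (cube 0) x * ennreal ((norm (kern_mean (r n) F x - c))\<^sup>2)"
  have "(\<integral>\<^sup>+x. indicator (cube 0) x * ennreal ((norm (P x - c))\<^sup>2) \<partial>lborel) = (\<integral>\<^sup>+x. liminf (\<lambda>n. ?g n x) \<partial>lborel)"
  proof (intro nn_integral_cong_AE, use r in eventually_elim)
    fix x assume l: "(\<lambda>n. ?u (r n) x) \<longlonglongrightarrow> 0"
    show "indicator (cube 0) x * ennreal ((norm (P x - c))\<^sup>2) = liminf (\<lambda>n. ?g n x)"
    proof (cases "x \<in> cube 0")
      case True
      then have "(\<lambda>n. kern_mean (r n) F x - P x) \<longlonglongrightarrow> 0" using l by simp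
      then have "(\<lambda>n. kern_mean (r n) F x) \<longlonglongrightarrow> P x" by (simp add: LIM_zero_iff)
      then have "(\<lambda>n. ennreal ((norm (kern_mean (r n) F x - c))\<^sup>2)) \<longlonglongrightarrow> ennreal ((norm (P x - c))\<^sup>2)"
        by (intro tendsto_ennrealI tendsto_intros)
      then have "liminf (\<lambda>n. ennreal ((norm (kern_mean (r n) F x - c))\<^sup>2)) = ennreal ((norm (P x - c))\<^sup>2)"
        by (intro lim_imp_Liminf) auto
      then show ?thesis using True by simp
    next
      case False
      then show ?thesis by (simp add: Liminf_const)
    qed
  qed
  also have "\<dots> \<le> liminf (\<lambda>n. \<integral>\<^sup>+x. ?g n x \<partial>lborel)"
    by (rule nn_integral_liminf) measurable
  also have "\<dots> \<le> liminf (\<lambda>n. lattice_energy (\<lambda>\<xi>. (norm (fhat F \<xi>))\<^sup>2))"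
    unfolding c_def by (intro Liminf_mono always_eventually allI kern_mean_norm_sq_le d)
  also have "\<dots> = lattice_energy (\<lambda>\<xi>. (norm (fhat F \<xi>))\<^sup>2)" by (simp add: Liminf_const)
  finally show ?thesis unfolding P_def c_def .
qed

subsection \<open>Gaussian integrals and the dispersive estimate\<close>

lemma measurable_cnj [measurable]: "cnj \<in> borel_measurable borel"
  by (intro borel_measurable_continuous_onI continuous_intros)

text \<open>Rescaling by c = sqrt (2 pi a) turns the integral into the characteristic function of
  the standard normal distribution.\<close>

lemma gauss_ft:
  fixes a s :: real
  assumes a: "a > 0"
  shows "integrable lborel (\<lambda>t. exp (- pi * a * t\<^sup>2))"
    and "(\<integral>t. exp (- pi * a * t\<^sup>2) * ee (s * t) \<partial>lborel) = exp (- pi * s\<^sup>2 / a) / sqrt a"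
proof -
  define c where "c = sqrt (2 * pi * a)"
  have c: "c > 0" "c\<^sup>2 = 2 * pi * a" using a by (auto simp: c_def)
  define \<tau> where "\<tau> = 2 * pi * s / c"
  have d: "std_normal_density (0 + c * t) = exp (- pi * a * t\<^sup>2) / sqrt (2 * pi)" for t
    using c by (simp add: std_normal_density_def power_mult_distrib)
  have "integrable lborel (\<lambda>t. sqrt (2 * pi) * std_normal_density (0 + c * t))"
    using c by (intro integrable_mult_right lborel_integrable_real_affine integrable_normal_density) auto
  then show "integrable lborel (\<lambda>t. exp (- pi * a * t\<^sup>2))"
    unfolding d by simp
  have "complex_of_real (exp (- (\<tau>\<^sup>2) / 2)) = (\<integral>x. iexp (\<tau> * x) \<partial>std_normal_distribution)"
    using char_std_normal_distribution by (metis char_def)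
  also have "\<dots> = (\<integral>x. std_normal_density x *\<^sub>R iexp (\<tau> * x) \<partial>lborel)"
    by (subst integral_density) (auto simp: normal_density_nonneg)
  also have "\<dots> = \<bar>c\<bar> *\<^sub>R (\<integral>t. std_normal_density (0 + c * t) *\<^sub>R iexp (\<tau> * (0 + c * t)) \<partial>lborel)"
    by (rule lborel_integral_real_affine) (use c in simp)
  also have "(\<integral>t. std_normal_density (0 + c * t) *\<^sub>R iexp (\<tau> * (0 + c * t)) \<partial>lborel) = (\<integral>t. complex_of_real (1 / sqrt (2 * pi)) * (exp (- pi * a * t\<^sup>2) * ee (s * t)) \<partial>lborel)"
  proof (rule Bochner_Integration.integral_cong[OF refl])
    fix t
    have "\<tau> * (0 + c * t) = 2 * pi * (s * t)" using c by (simp add: \<tau>_def)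
    then have ie: "iexp (\<tau> * (0 + c * t)) = ee (s * t)" by (simp only: ee_def cis_conv_exp)
    show "std_normal_density (0 + c * t) *\<^sub>R iexp (\<tau> * (0 + c * t)) = complex_of_real (1 / sqrt (2 * pi)) * (exp (- pi * a * t\<^sup>2) * ee (s * t))"
      unfolding d ie by (simp add: scaleR_conv_of_real)
  qed
  also have "\<dots> = complex_of_real (1 / sqrt (2 * pi)) * (\<integral>t. exp (- pi * a * t\<^sup>2) * ee (s * t) \<partial>lborel)"
    by (rule integral_mult_right_zero)
  finally have e: "complex_of_real (exp (- (\<tau>\<^sup>2) / 2)) = complex_of_real (c / sqrt (2 * pi)) * (\<integral>t. exp (- pi * a * t\<^sup>2) * ee (s * t) \<partial>lborel)"
    using c by (simp add: scaleR_conv_of_real)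
  have "c / sqrt (2 * pi) = sqrt a" by (simp add: c_def real_sqrt_mult)
  moreover have "- (\<tau>\<^sup>2) / 2 = - pi * s\<^sup>2 / a"
    using c(2) a by (simp add: \<tau>_def power_divide power_mult_distrib) (simp add: power2_eq_square)
  ultimately have "complex_of_real (exp (- pi * s\<^sup>2 / a)) = complex_of_real (sqrt a) * (\<integral>t. exp (- pi * a * t\<^sup>2) * ee (s * t) \<partial>lborel)"
    using e by simp
  then show "(\<integral>t. exp (- pi * a * t\<^sup>2) * ee (s * t) \<partial>lborel) = exp (- pi * s\<^sup>2 / a) / sqrt a"
    using a by (simp add: field_simps)
qed

lemma gauss_integral:
  assumes "a > 0"
  shows "(\<integral>t. exp (- pi * a * t\<^sup>2) \<partial>lborel) = 1 / sqrt a"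
proof -
  have "complex_of_real (\<integral>t. exp (- pi * a * t\<^sup>2) \<partial>lborel) = (\<integral>t. complex_of_real (exp (- pi * a * t\<^sup>2)) \<partial>lborel)"
    by (rule integral_complex_of_real[symmetric])
  also have "\<dots> = complex_of_real (1 / sqrt a)"
    using gauss_ft(2)[OF assms, of 0] by simp
  finally show ?thesis by (simp only: of_real_eq_iff)
qed

definition chirp :: "real \<Rightarrow> real \<Rightarrow> real \<Rightarrow> complex" where
  "chirp \<epsilon> k t = exp (- pi * \<epsilon> * t\<^sup>2) * ee (k * t\<^sup>2)"

lemma measurable_chirp [measurable]: "chirp \<epsilon> k \<in> borel_measurable borel"
proof -
  have "(\<lambda>t. complex_of_real (exp (- pi * \<epsilon> * t\<^sup>2)) * ee (k * t\<^sup>2)) \<in> borel_measurable borel"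
    by measurable
  then show ?thesis unfolding chirp_def[abs_def] by simp
qed

lemma norm_chirp: "norm (chirp \<epsilon> k t) = exp (- pi * \<epsilon> * t\<^sup>2)"
  by (simp add: chirp_def norm_mult)

lemma integrable_chirp:
  assumes "\<epsilon> > 0"
  shows "integrable lborel (chirp \<epsilon> k)"
  using gauss_ft(1)[OF assms] by (rule Bochner_Integration.integrable_bound) (auto simp: norm_chirp)

text \<open>Van der Corput's trick: \<open>\<bar>\<integral>h\<bar>\<^sup>2\<close> is the integral of the autocorrelation of \<open>h\<close>, which is a real
  Gaussian up to a unimodular factor.\<close>
lemma chirp_ft_bound:
  fixes \<epsilon> k s :: real
  assumes \<epsilon>: "\<epsilon> > 0" and k: "k \<noteq> 0"
  shows "norm (\<integral>t. chirp \<epsilon> k t * ee (- (s * t)) \<partial>lborel) \<le> 1 / sqrt (2 * \<bar>k\<bar>)"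
proof -
  define h where "h = (\<lambda>t. chirp \<epsilon> k t * ee (- (s * t)))"
  have [measurable]: "h \<in> borel_measurable borel" unfolding h_def by measurable
  have nh: "norm (h t) = exp (- pi * \<epsilon> * t\<^sup>2)" for t by (simp add: h_def norm_mult norm_chirp)
  have hi: "integrable lborel h"
    unfolding h_def by (intro integrable_mult_ee integrable_chirp \<epsilon>) measurable
  define I where "I = (\<integral>t. h t \<partial>lborel)"
  have F: "integrable (lborel \<Otimes>\<^sub>M lborel) (\<lambda>(u, p). h (u + p) * cnj (h u))"
  proof (rule lborel_pair.Fubini_integrable)
    show "integrable lborel (\<lambda>u. \<integral>p. norm (case (u, p) of (u, p) \<Rightarrow> h (u + p) * cnj (h u)) \<partial>lborel)"
    proof -
      have "(\<integral>p. norm (case (u, p) of (u, p) \<Rightarrow> h (u + p) * cnj (h u)) \<partial>lborel) = (\<integral>t. norm (h t) \<partial>lborel) * norm (h u)" for u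
        using integral_lborel_translate[of "\<lambda>t. norm (h t)" u] by (simp add: norm_mult add.commute)
      then show ?thesis using hi by simp
    qed
    show "AE u in lborel. integrable lborel (\<lambda>p. case (u, p) of (u, p) \<Rightarrow> h (u + p) * cnj (h u))"
      using integrable_lborel_translate[OF hi] by (intro AE_I2) (simp add: add.commute)
  qed measurable
  have "I * cnj I = (\<integral>u. I * cnj (h u) \<partial>lborel)"
    unfolding I_def by (simp only: Bochner_Integration.integral_cnj integral_mult_right_zero)
  also have "\<dots> = (\<integral>u. (\<integral>p. h (u + p) * cnj (h u) \<partial>lborel) \<partial>lborel)"
  proof (rule Bochner_Integration.integral_cong[OF refl])
    fix u
    have "I = (\<integral>p. h (u + p) \<partial>lborel)" unfolding I_def using integral_lborel_translate[of h u] by (simp add: add.commute)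
    then show "I * cnj (h u) = (\<integral>p. h (u + p) * cnj (h u) \<partial>lborel)" by simp
  qed
  also have "\<dots> = (\<integral>p. (\<integral>u. h (u + p) * cnj (h u) \<partial>lborel) \<partial>lborel)"
    by (rule lborel_pair.Fubini_integral[symmetric]) (rule F)
  finally have II: "I * cnj I = (\<integral>p. (\<integral>u. h (u + p) * cnj (h u) \<partial>lborel) \<partial>lborel)" .
  \<comment> \<open>\<open>\<epsilon> / 2\<close> comes from the product of the two Gaussian
    amplitudes, the other term from the Fourier transform of the remaining Gaussian at frequency 2 k
    p.\<close>
  define b where "b = \<epsilon> / 2 + 2 * k\<^sup>2 / \<epsilon>"
  have b: "b > 0" using \<epsilon> by (simp add: b_def add_pos_nonneg)
  have inner: "norm (\<integral>u. h (u + p) * cnj (h u) \<partial>lborel) = exp (- pi * b * p\<^sup>2) / sqrt (2 * \<epsilon>)" for p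
  proof -
    define q where "q = exp (- pi * (\<epsilon> / 2) * p\<^sup>2) * ee (- (s * p))"
    have "h (u + p) * cnj (h u) = q * (exp (- pi * (2 * \<epsilon>) * (u + p / 2)\<^sup>2) * ee (2 * k * p * (u + p / 2)))" for u
    proof -
      \<comment> \<open>Completing the square: (u + p)^2 + u^2 = 2 (u + p/2)^2 + p^2/2, while the
        difference of the two squares is 2 p (u + p/2), linear in the same variable.\<close>
      have e1: "exp (- pi * \<epsilon> * (u + p)\<^sup>2) * exp (- pi * \<epsilon> * u\<^sup>2) = exp (- pi * (\<epsilon> / 2) * p\<^sup>2) * exp (- pi * (2 * \<epsilon>) * (u + p / 2)\<^sup>2)"
        unfolding exp_add[symmetric] by (rule arg_cong[of _ _ exp]) (simp add: power2_eq_square algebra_simps)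
      have e2: "ee (k * (u + p)\<^sup>2) * ee (- (s * (u + p))) * (ee (- (k * u\<^sup>2)) * ee (s * u)) = ee (- (s * p)) * ee (2 * k * p * (u + p / 2))"
        unfolding ee_add[symmetric] by (rule arg_cong[of _ _ ee]) (simp add: power2_eq_square algebra_simps)
      have "h (u + p) * cnj (h u) = complex_of_real (exp (- pi * \<epsilon> * (u + p)\<^sup>2) * exp (- pi * \<epsilon> * u\<^sup>2)) *
           (ee (k * (u + p)\<^sup>2) * ee (- (s * (u + p))) * (ee (- (k * u\<^sup>2)) * ee (s * u)))"
        unfolding h_def chirp_def by (simp add: cnj_ee)
      then show ?thesis unfolding e1 e2 q_def by simp
    qed
    then have "(\<integral>u. h (u + p) * cnj (h u) \<partial>lborel) = q * (\<integral>u. exp (- pi * (2 * \<epsilon>) * (u + p / 2)\<^sup>2) * ee (2 * k * p * (u + p / 2)) \<partial>lborel)"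
      by simp
    also have "(\<integral>u. exp (- pi * (2 * \<epsilon>) * (u + p / 2)\<^sup>2) * ee (2 * k * p * (u + p / 2)) \<partial>lborel) = (\<integral>w. exp (- pi * (2 * \<epsilon>) * w\<^sup>2) * ee (2 * k * p * w) \<partial>lborel)"
      by (rule integral_lborel_translate[of "\<lambda>w. complex_of_real (exp (- pi * (2 * \<epsilon>) * w\<^sup>2)) * ee (2 * k * p * w)"]) measurable
    also have "\<dots> = exp (- pi * (2 * k * p)\<^sup>2 / (2 * \<epsilon>)) / sqrt (2 * \<epsilon>)"
      by (rule gauss_ft(2)) (use \<epsilon> in simp)
    finally have "norm (\<integral>u. h (u + p) * cnj (h u) \<partial>lborel) = norm q * norm (complex_of_real (exp (- pi * (2 * k * p)\<^sup>2 / (2 * \<epsilon>)) / sqrt (2 * \<epsilon>)))"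
      by (simp only: norm_mult)
    also have "\<dots> = exp (- pi * (\<epsilon> / 2) * p\<^sup>2) * (exp (- pi * (2 * k * p)\<^sup>2 / (2 * \<epsilon>)) / sqrt (2 * \<epsilon>))"
      unfolding norm_of_real using \<epsilon> by (simp add: q_def norm_mult)
    also have "\<dots> = exp (- pi * (\<epsilon> / 2) * p\<^sup>2 + - pi * (2 * k * p)\<^sup>2 / (2 * \<epsilon>)) / sqrt (2 * \<epsilon>)"
      unfolding exp_add by simp
    also have "- pi * (\<epsilon> / 2) * p\<^sup>2 + - pi * (2 * k * p)\<^sup>2 / (2 * \<epsilon>) = - pi * b * p\<^sup>2"
      using \<epsilon> by (simp add: b_def power2_eq_square field_simps)
    finally show ?thesis .
  qed
  have "(norm I)\<^sup>2 = norm (I * cnj I)" by (simp add: norm_mult power2_eq_square)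
  also have "\<dots> \<le> (\<integral>p. norm (\<integral>u. h (u + p) * cnj (h u) \<partial>lborel) \<partial>lborel)"
    unfolding II by (rule integral_norm_bound)
  also have "\<dots> = (\<integral>p. exp (- pi * b * p\<^sup>2) \<partial>lborel) / sqrt (2 * \<epsilon>)"
    unfolding inner by (rule integral_divide_zero)
  also have "\<dots> = 1 / sqrt (b * (2 * \<epsilon>))"
    unfolding gauss_integral[OF b] by (simp add: real_sqrt_mult)
  \<comment> \<open>The singular factors in \<epsilon> cancel: what remains is at least (2|k|)^2, so
    the final bound is uniform in \<epsilon>.\<close>
  also have "b * (2 * \<epsilon>) = \<epsilon>\<^sup>2 + (2 * \<bar>k\<bar>)\<^sup>2"
    using \<epsilon> by (simp add: b_def power2_eq_square field_simps)
  also have "1 / sqrt (\<epsilon>\<^sup>2 + (2 * \<bar>k\<bar>)\<^sup>2) \<le> 1 / (2 * \<bar>k\<bar>)"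
  proof (rule divide_left_mono)
    have "sqrt ((2 * \<bar>k\<bar>)\<^sup>2) \<le> sqrt (\<epsilon>\<^sup>2 + (2 * \<bar>k\<bar>)\<^sup>2)" by (rule real_sqrt_le_mono) simp
    then show "2 * \<bar>k\<bar> \<le> sqrt (\<epsilon>\<^sup>2 + (2 * \<bar>k\<bar>)\<^sup>2)" by (simp only: real_sqrt_abs)
  qed (use k \<epsilon> in \<open>auto intro!: mult_pos_pos add_pos_nonneg\<close>)
  finally have "sqrt ((norm I)\<^sup>2) \<le> sqrt (1 / (2 * \<bar>k\<bar>))" by (rule real_sqrt_le_mono)
  then show ?thesis by (simp add: I_def h_def real_sqrt_divide)
qed

section \<open>Basic properties of the Fourier transform of integrable functions\<close>

lemma fhat_bound:
  assumes "integrable lborel f"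
  shows "norm (fhat f \<xi>) \<le> (\<integral>x. norm (f x) \<partial>lborel)"
proof -
  have "norm (fhat f \<xi>) \<le> (\<integral>x. norm (f x * ee (- (\<xi> \<bullet> x))) \<partial>lborel)"
    unfolding fhat_def by (rule integral_norm_bound)
  then show ?thesis by (simp add: norm_mult)
qed

lemma measurable_fhat [measurable]:
  assumes "f \<in> borel_measurable borel"
  shows "fhat f \<in> borel_measurable borel"
proof -
  note assms[measurable]
  have eq: "fhat f = (\<lambda>\<xi>. \<integral>x. f x * ee (- (\<xi> \<bullet> x)) \<partial>lborel)"
    by (rule ext) (rule fhat_def)
  show ?thesis unfolding eq by measurable
qed

lemma continuous_fhat:
  fixes f :: "real^'n \<Rightarrow> complex"
  assumes f: "integrable lborel f" and t: "\<xi> \<longlonglongrightarrow> \<eta>"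
  shows "(\<lambda>n. fhat f (\<xi> n)) \<longlonglongrightarrow> fhat f \<eta>"
  unfolding fhat_def
proof (rule integral_dominated_convergence[where w = "\<lambda>x. norm (f x)"])
  have [measurable]: "f \<in> borel_measurable borel" using f by (simp add: borel_measurable_integrable)
  show "(\<lambda>x. f x * ee (- (\<eta> \<bullet> x))) \<in> borel_measurable lborel" by measurable
  show "(\<lambda>x. f x * ee (- (\<xi> n \<bullet> x))) \<in> borel_measurable lborel" for n by measurable
  show "AE x in lborel. (\<lambda>n. f x * ee (- (\<xi> n \<bullet> x))) \<longlonglongrightarrow> f x * ee (- (\<eta> \<bullet> x))"
    by (intro AE_I2 tendsto_mult tendsto_const isCont_tendsto_compose[OF isCont_ee] tendsto_minus tendsto_inner t)
qed (use f in \<open>auto simp: norm_mult\<close>)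

text \<open>Fubini moves the transform from one factor to the other; this takes the place of Fourier
  inversion.\<close>

lemma fhat_multiplication:
  fixes F G :: "real^'n \<Rightarrow> complex"
  assumes F: "integrable lborel F" and G: "integrable lborel G"
  shows "(\<integral>\<xi>. G \<xi> * fhat F \<xi> \<partial>lborel) = (\<integral>y. F y * fhat G y \<partial>lborel)"
proof -
  have [measurable]: "F \<in> borel_measurable borel" "G \<in> borel_measurable borel"
    using F G by (auto simp: borel_measurable_integrable)
  have I: "integrable (lborel \<Otimes>\<^sub>M lborel) (\<lambda>(\<xi>, y). G \<xi> * (F y * ee (- (\<xi> \<bullet> y))))"
  proof (rule lborel_pair.Fubini_integrable)
    show "integrable lborel (\<lambda>\<xi>. \<integral>y. norm (case (\<xi>, y) of (\<xi>, y) \<Rightarrow> G \<xi> * (F y * ee (- (\<xi> \<bullet> y)))) \<partial>lborel)"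
      using G by (simp add: norm_mult)
    show "AE \<xi> in lborel. integrable lborel (\<lambda>y. case (\<xi>, y) of (\<xi>, y) \<Rightarrow> G \<xi> * (F y * ee (- (\<xi> \<bullet> y))))"
      using integrable_mult_ee[OF F] by (intro AE_I2) simp
  qed measurable
  have "(\<integral>\<xi>. G \<xi> * fhat F \<xi> \<partial>lborel) = (\<integral>\<xi>. (\<integral>y. G \<xi> * (F y * ee (- (\<xi> \<bullet> y))) \<partial>lborel) \<partial>lborel)"
    unfolding fhat_def by (simp only: integral_mult_right_zero)
  also have "\<dots> = (\<integral>y. (\<integral>\<xi>. G \<xi> * (F y * ee (- (\<xi> \<bullet> y))) \<partial>lborel) \<partial>lborel)"
    by (rule lborel_pair.Fubini_integral[symmetric]) (rule I)
  also have "\<dots> = (\<integral>y. F y * fhat G y \<partial>lborel)"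
  proof (rule Bochner_Integration.integral_cong[OF refl])
    fix y
    have "(\<integral>\<xi>. G \<xi> * (F y * ee (- (\<xi> \<bullet> y))) \<partial>lborel) = (\<integral>\<xi>. F y * (G \<xi> * ee (- (y \<bullet> \<xi>))) \<partial>lborel)"
      by (simp only: inner_commute mult.left_commute)
    then show "(\<integral>\<xi>. G \<xi> * (F y * ee (- (\<xi> \<bullet> y))) \<partial>lborel) = F y * fhat G y"
      unfolding fhat_def by (simp only: integral_mult_right_zero)
  qed
  finally show ?thesis .
qed

text \<open>\<open>cnj (fhat f \<xi>)\<close> is the transform of the reflected conjugate of f, so
  two applications of \<open>fhat_multiplication\<close> remove both transforms of f and leave the
  single kernel \<open>fhat g (x + y)\<close>. A sup bound on this kernel gives an L^1 estimate, a
  bound on its mass an L^2 estimate.\<close>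

lemma weighted_energy_eq:
  fixes f g :: "real^'n \<Rightarrow> complex"
  assumes f: "integrable lborel f" and g: "integrable lborel g"
  shows "(\<integral>\<xi>. g \<xi> * of_real ((norm (fhat f \<xi>))\<^sup>2) \<partial>lborel) = (\<integral>x. f x * (\<integral>y. cnj (f (- y)) * fhat g (x + y) \<partial>lborel) \<partial>lborel)"
proof -
  have [measurable]: "f \<in> borel_measurable borel" "g \<in> borel_measurable borel"
    using f g by (auto simp: borel_measurable_integrable)
  define f' where "f' = (\<lambda>y. cnj (f (- y)))"
  have f': "integrable lborel f'"
    unfolding f'_def using integrable_lborel_reflect[OF f, of 0] by (intro integrable_cnj) simp
  have cnj: "cnj (fhat f \<xi>) = fhat f' \<xi>" for \<xi>
  proof -
    have "cnj (fhat f \<xi>) = (\<integral>x. cnj (f x * ee (- (\<xi> \<bullet> x))) \<partial>lborel)"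
      unfolding fhat_def by (rule Bochner_Integration.integral_cnj[symmetric])
    also have "\<dots> = (\<integral>x. cnj (f (0 - x) * ee (- (\<xi> \<bullet> (0 - x)))) \<partial>lborel)"
      by (rule integral_lborel_reflect[symmetric]) measurable
    also have "\<dots> = fhat f' \<xi>" unfolding fhat_def f'_def by (simp add: cnj_ee)
    finally show ?thesis .
  qed
  have bdd: "integrable lborel (\<lambda>\<xi>. g \<xi> * fhat f' \<xi>)"
  proof (rule Bochner_Integration.integrable_bound)
    show "integrable lborel (\<lambda>\<xi>. (\<integral>x. norm (f' x) \<partial>lborel) * norm (g \<xi>))" using g by simp
    have [measurable]: "f' \<in> borel_measurable borel" using f' by (simp add: borel_measurable_integrable)
    show "(\<lambda>\<xi>. g \<xi> * fhat f' \<xi>) \<in> borel_measurable lborel" by measurable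
    show "AE \<xi> in lborel. norm (g \<xi> * fhat f' \<xi>) \<le> norm ((\<integral>x. norm (f' x) \<partial>lborel) * norm (g \<xi>))"
    proof (rule AE_I2)
      fix \<xi>
      have "norm (g \<xi>) * norm (fhat f' \<xi>) \<le> norm (g \<xi>) * (\<integral>x. norm (f' x) \<partial>lborel)"
        by (intro mult_left_mono fhat_bound f') simp
      moreover have "0 \<le> (\<integral>x. norm (f' x) \<partial>lborel)" by (intro integral_nonneg_AE) simp
      ultimately show "norm (g \<xi> * fhat f' \<xi>) \<le> norm ((\<integral>x. norm (f' x) \<partial>lborel) * norm (g \<xi>))"
        by (simp add: norm_mult abs_mult mult.commute)
    qed
  qed
  have "(\<integral>\<xi>. g \<xi> * of_real ((norm (fhat f \<xi>))\<^sup>2) \<partial>lborel) = (\<integral>\<xi>. (g \<xi> * fhat f' \<xi>) * fhat f \<xi> \<partial>lborel)"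
    unfolding complex_norm_square cnj by (simp only: mult_ac)
  also have "\<dots> = (\<integral>x. f x * fhat (\<lambda>\<xi>. g \<xi> * fhat f' \<xi>) x \<partial>lborel)"
    by (rule fhat_multiplication[OF f bdd])
  also have "\<dots> = (\<integral>x. f x * (\<integral>y. cnj (f (- y)) * fhat g (x + y) \<partial>lborel) \<partial>lborel)"
  proof (rule Bochner_Integration.integral_cong[OF refl])
    fix x
    have gx: "integrable lborel (\<lambda>\<xi>. g \<xi> * ee (- (x \<bullet> \<xi>)))" by (intro integrable_mult_ee g) measurable
    have "fhat (\<lambda>\<xi>. g \<xi> * fhat f' \<xi>) x = (\<integral>\<xi>. (g \<xi> * ee (- (x \<bullet> \<xi>))) * fhat f' \<xi> \<partial>lborel)"
      unfolding fhat_def[of "\<lambda>\<xi>. g \<xi> * fhat f' \<xi>"] by (simp only: mult_ac)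
    also have "\<dots> = (\<integral>y. f' y * fhat (\<lambda>\<xi>. g \<xi> * ee (- (x \<bullet> \<xi>))) y \<partial>lborel)"
      by (rule fhat_multiplication[OF f' gx])
    also have "(\<lambda>y. fhat (\<lambda>\<xi>. g \<xi> * ee (- (x \<bullet> \<xi>))) y) = (\<lambda>y. fhat g (x + y))"
    proof
      fix y
      have "ee (- (x \<bullet> \<xi>)) * ee (- (y \<bullet> \<xi>)) = ee (- ((x + y) \<bullet> \<xi>))" for \<xi>
        unfolding ee_add[symmetric] by (simp add: inner_add_left)
      then show "fhat (\<lambda>\<xi>. g \<xi> * ee (- (x \<bullet> \<xi>))) y = fhat g (x + y)"
        unfolding fhat_def by (simp only: mult.assoc)
    qed
    finally show "f x * fhat (\<lambda>\<xi>. g \<xi> * fhat f' \<xi>) x = f x * (\<integral>y. cnj (f (- y)) * fhat g (x + y) \<partial>lborel)"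
      unfolding f'_def by (simp only:)
  qed
  finally show ?thesis .
qed

section \<open>Gaussian-damped quadratic phases in several variables\<close>

definition gchirp :: "real \<Rightarrow> real \<Rightarrow> real^'n \<Rightarrow> complex" where
  "gchirp \<epsilon> k \<xi> = exp (- pi * \<epsilon> * (norm \<xi>)\<^sup>2) * ee (k * (norm \<xi>)\<^sup>2)"

lemma gchirp_prod: "gchirp \<epsilon> k \<xi> = (\<Prod>i\<in>UNIV. chirp \<epsilon> k (\<xi> $ i))"
proof -
  have n: "(norm \<xi>)\<^sup>2 = (\<Sum>i\<in>UNIV. (\<xi> $ i)\<^sup>2)" by (simp add: norm_vec_def L2_set_def sum_nonneg)
  show ?thesis
    unfolding gchirp_def chirp_def prod.distrib of_real_prod[symmetric] exp_sum[OF finite, symmetric] ee_sum[symmetric] n sum_distrib_left ..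
qed

lemma integrable_gchirp:
  assumes "\<epsilon> > 0"
  shows "integrable (lborel :: (real^'n) measure) (gchirp \<epsilon> k)"
  using integrable_lborel_prod_vec[of "\<lambda>_::'n. chirp \<epsilon> k"] integrable_chirp[OF assms] by (simp add: gchirp_prod[abs_def])

lemma fhat_gchirp:
  fixes v :: "real^'n"
  assumes "\<epsilon> > 0"
  shows "fhat (gchirp \<epsilon> k) v = (\<Prod>i\<in>UNIV. \<integral>t. chirp \<epsilon> k t * ee (- (v $ i * t)) \<partial>lborel)"
proof -
  have "fhat (gchirp \<epsilon> k) v = (\<integral>x. (\<Prod>i\<in>UNIV. chirp \<epsilon> k (x $ i) * ee (- (v $ i * x $ i))) \<partial>lborel)"
    unfolding fhat_def gchirp_prod prod.distrib ee_sum[symmetric] inner_vec_def inner_real_def sum_negf ..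
  also have "\<dots> = (\<Prod>i\<in>UNIV. \<integral>t. chirp \<epsilon> k t * ee (- (v $ i * t)) \<partial>lborel)"
    by (rule integral_lborel_prod_vec) (intro integrable_mult_ee integrable_chirp assms, measurable)
  finally show ?thesis .
qed

text \<open>As \<open>\<epsilon> \<rightarrow> 0\<close> this is the pairing of \<open>f\<close> with its free Schroedinger evolution at a time proportional
  to \<open>k\<close>, which is why it decays like \<open>\<bar>k\<bar>\<close> to the power \<open>-d/2\<close>.\<close>
definition chirp_energy :: "real \<Rightarrow> real \<Rightarrow> (real^'n \<Rightarrow> complex) \<Rightarrow> complex" where
  "chirp_energy \<epsilon> k f = (\<integral>\<xi>. gchirp \<epsilon> k \<xi> * of_real ((norm (fhat f \<xi>))\<^sup>2) \<partial>lborel)"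

text \<open>The kernel factors over the coordinates, and \<open>chirp_ft_bound\<close> for each of
  them bounds it uniformly by (2|k|)^(-d/2). The double integral of |f| against |f| supplies the
  squared L^1 norm.\<close>

lemma chirp_energy_dispersive:
  fixes f :: "real^'n \<Rightarrow> complex"
  assumes f: "integrable lborel f" and \<epsilon>: "\<epsilon> > 0" and k: "k \<noteq> 0"
  shows "norm (chirp_energy \<epsilon> k f) \<le> (1 / sqrt (2 * \<bar>k\<bar>)) ^ CARD('n) * (\<integral>x. norm (f x) \<partial>lborel)\<^sup>2"
proof -
  let ?K = "(1 / sqrt (2 * \<bar>k\<bar>)) ^ CARD('n)" let ?A = "\<integral>x. norm (f x) \<partial>lborel"
  have K: "norm (fhat (gchirp \<epsilon> k) v) \<le> ?K" for v :: "real^'n"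
  proof -
    have "norm (fhat (gchirp \<epsilon> k) v) = (\<Prod>i\<in>UNIV. norm (\<integral>t. chirp \<epsilon> k t * ee (- (v $ i * t)) \<partial>lborel))"
      unfolding fhat_gchirp[OF \<epsilon>] by (rule prod_norm[symmetric])
    also have "\<dots> \<le> (\<Prod>i\<in>(UNIV :: 'n set). 1 / sqrt (2 * \<bar>k\<bar>))"
      by (intro prod_mono conjI norm_ge_zero chirp_ft_bound \<epsilon> k)
    finally show ?thesis by simp
  qed
  have fr: "integrable lborel (\<lambda>y. norm (f (- y)) * ?K)"
    using integrable_lborel_reflect[OF f, of 0] by (intro integrable_mult_left integrable_norm) simp
  have inner: "norm (\<integral>y. cnj (f (- y)) * fhat (gchirp \<epsilon> k) (x + y) \<partial>lborel) \<le> ?A * ?K" for x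
  proof -
    have "norm (\<integral>y. cnj (f (- y)) * fhat (gchirp \<epsilon> k) (x + y) \<partial>lborel) \<le> (\<integral>y. norm (cnj (f (- y)) * fhat (gchirp \<epsilon> k) (x + y)) \<partial>lborel)"
      by (rule integral_norm_bound)
    also have "\<dots> \<le> (\<integral>y. norm (f (- y)) * ?K \<partial>lborel)"
      by (rule integral_mono_AE'[OF fr]) (auto simp: norm_mult intro!: AE_I2 mult_left_mono K)
    also have "\<dots> = (\<integral>y. norm (f (0 - y)) \<partial>lborel) * ?K" by simp
    also have "(\<integral>y. norm (f (0 - y)) \<partial>lborel) = ?A"
      by (rule integral_lborel_reflect) (use f in \<open>simp add: borel_measurable_integrable\<close>)
    finally show ?thesis .
  qed
  have fi: "integrable lborel (\<lambda>x. norm (f x) * (?A * ?K))" using f by simp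
  have "norm (chirp_energy \<epsilon> k f) \<le> (\<integral>x. norm (f x * (\<integral>y. cnj (f (- y)) * fhat (gchirp \<epsilon> k) (x + y) \<partial>lborel)) \<partial>lborel)"
    unfolding chirp_energy_def weighted_energy_eq[OF f integrable_gchirp[OF \<epsilon>]] by (rule integral_norm_bound)
  also have "\<dots> \<le> (\<integral>x. norm (f x) * (?A * ?K) \<partial>lborel)"
  proof (rule integral_mono_AE'[OF fi])
    show "AE x in lborel. norm (f x * (\<integral>y. cnj (f (- y)) * fhat (gchirp \<epsilon> k) (x + y) \<partial>lborel)) \<le> norm (f x) * (?A * ?K)"
      unfolding norm_mult[of "f _"] by (intro AE_I2 mult_left_mono inner norm_ge_zero)
    have "0 \<le> ?A * ?K" by (rule order_trans[OF norm_ge_zero inner])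
    then show "AE x in lborel. 0 \<le> norm (f x) * (?A * ?K)" by (intro AE_I2 mult_nonneg_nonneg) auto
  qed
  also have "\<dots> = ?K * ?A\<^sup>2" by (simp add: power2_eq_square)
  finally show ?thesis .
qed

lemma chirp_energy_le_0:
  fixes f :: "real^'n \<Rightarrow> complex"
  shows "norm (chirp_energy \<epsilon> k f) \<le> (\<integral>\<xi>. exp (- pi * \<epsilon> * (norm \<xi>)\<^sup>2) * (norm (fhat f \<xi>))\<^sup>2 \<partial>lborel)"
  unfolding chirp_energy_def
  by (rule order_trans[OF integral_norm_bound]) (simp add: gchirp_def norm_mult norm_power)

lemma chirp_energy_0:
  "chirp_energy \<epsilon> 0 f = complex_of_real (\<integral>\<xi>. exp (- pi * \<epsilon> * (norm \<xi>)\<^sup>2) * (norm (fhat f \<xi>))\<^sup>2 \<partial>lborel)"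
  unfolding chirp_energy_def gchirp_def integral_complex_of_real[symmetric] by simp

text \<open>The upper half of Plancherel, uniform in \<epsilon>. Taking absolute values reduces
  every k to k = 0, where the kernel is a Gaussian probability density; with |f(x) f(-y)| <=
  |f(x)|^2/2 + |f(-y)|^2/2 each term integrates to half the squared L^2 norm.\<close>

lemma chirp_energy_L2:
  fixes f :: "real^'n \<Rightarrow> complex"
  assumes f: "integrable lborel f" and f2: "integrable lborel (\<lambda>x. (norm (f x))\<^sup>2)" and \<epsilon>: "\<epsilon> > 0"
  shows "norm (chirp_energy \<epsilon> k f) \<le> (\<integral>x. (norm (f x))\<^sup>2 \<partial>lborel)"
proof -
  have [measurable]: "f \<in> borel_measurable borel" using f by (simp add: borel_measurable_integrable)
  let ?B = "\<integral>x. (norm (f x))\<^sup>2 \<partial>lborel"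
  define \<gamma> where "\<gamma> = (\<lambda>v::real^'n. \<Prod>i\<in>UNIV. exp (- pi * (v $ i)\<^sup>2 / \<epsilon>) / sqrt \<epsilon>)"
  have \<gamma>0: "0 \<le> \<gamma> v" for v using \<epsilon> by (auto simp: \<gamma>_def intro!: prod_nonneg)
  have [measurable]: "\<gamma> \<in> borel_measurable borel" unfolding \<gamma>_def by measurable
  have fg: "fhat (gchirp \<epsilon> 0) v = complex_of_real (\<gamma> v)" for v
  proof -
    have "(\<integral>t. chirp \<epsilon> 0 t * ee (- (s * t)) \<partial>lborel) = complex_of_real (exp (- pi * s\<^sup>2 / \<epsilon>) / sqrt \<epsilon>)" for s
      using gauss_ft(2)[OF \<epsilon>, of "- s"] by (simp add: chirp_def)
    then show ?thesis unfolding fhat_gchirp[OF \<epsilon>] \<gamma>_def by (simp only: of_real_prod)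
  qed
  have \<gamma>1: "(\<integral>\<^sup>+v. ennreal (\<gamma> v) \<partial>lborel) = 1"
  proof -
    have "(\<integral>\<^sup>+v. ennreal (\<gamma> v) \<partial>lborel) = (\<integral>\<^sup>+v. (\<Prod>i\<in>UNIV. ennreal (exp (- pi * (v $ i)\<^sup>2 / \<epsilon>) / sqrt \<epsilon>)) \<partial>(lborel :: (real^'n) measure))"
      unfolding \<gamma>_def using \<epsilon> by (intro nn_integral_cong prod_ennreal[symmetric]) auto
    also have "\<dots> = (\<Prod>i\<in>(UNIV :: 'n set). \<integral>\<^sup>+t. ennreal (exp (- pi * t\<^sup>2 / \<epsilon>) / sqrt \<epsilon>) \<partial>lborel)"
      by (rule nn_integral_lborel_prod_vec) measurable
    also have "(\<integral>\<^sup>+t. ennreal (exp (- pi * t\<^sup>2 / \<epsilon>) / sqrt \<epsilon>) \<partial>lborel) = 1"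
    proof -
      have e: "exp (- pi * t\<^sup>2 / \<epsilon>) = exp (- pi * (1 / \<epsilon>) * t\<^sup>2)" for t by simp
      have i: "integrable lborel (\<lambda>t. exp (- pi * t\<^sup>2 / \<epsilon>) / sqrt \<epsilon>)"
        unfolding e using \<epsilon> by (intro integrable_divide gauss_ft(1)) simp
      have "(\<integral>t. exp (- pi * t\<^sup>2 / \<epsilon>) / sqrt \<epsilon> \<partial>lborel) = (1 / sqrt (1 / \<epsilon>)) / sqrt \<epsilon>"
        unfolding integral_divide_zero e by (subst gauss_integral) (use \<epsilon> in auto)
      also have "\<dots> = 1" using \<epsilon> by (simp add: real_sqrt_divide)
      finally show ?thesis using \<epsilon> by (subst nn_integral_eq_integral[OF i]) auto
    qed
    finally show ?thesis by simp
  qed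
  have split: "ennreal (r\<^sup>2 / 2 * \<gamma> v) = ennreal (r\<^sup>2 / 2) * ennreal (\<gamma> v)" for r v
    using \<gamma>0[of v] by (intro ennreal_mult) auto
  have half: "ennreal (r\<^sup>2 / 2) = ennreal (1/2) * ennreal (r\<^sup>2)" for r
    by (subst ennreal_mult[symmetric]) auto
  have half': "ennreal (1/2) * ennreal r = ennreal (r / 2)" for r
    by (subst ennreal_mult'[symmetric]) auto
  have B: "(\<integral>\<^sup>+x. ennreal ((norm (f x))\<^sup>2) \<partial>lborel) = ennreal ?B"
    by (rule nn_integral_eq_integral[OF f2]) simp
  have "ennreal (norm (chirp_energy \<epsilon> 0 f)) \<le> (\<integral>\<^sup>+x. ennreal (norm (f x * (\<integral>y. cnj (f (- y)) * fhat (gchirp \<epsilon> 0) (x + y) \<partial>lborel))) \<partial>lborel)"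
    unfolding chirp_energy_def weighted_energy_eq[OF f integrable_gchirp[OF \<epsilon>]] by (rule ennreal_norm_integral_le)
  also have "\<dots> \<le> (\<integral>\<^sup>+x. (\<integral>\<^sup>+y. ennreal ((norm (f x))\<^sup>2 / 2 * \<gamma> (x + y)) + ennreal ((norm (f (- y)))\<^sup>2 / 2 * \<gamma> (x + y)) \<partial>lborel) \<partial>lborel)"
  proof (rule nn_integral_mono)
    fix x :: "real^'n"
    have "ennreal (norm (f x * (\<integral>y. cnj (f (- y)) * fhat (gchirp \<epsilon> 0) (x + y) \<partial>lborel))) =
        ennreal (norm (\<integral>y. f x * (cnj (f (- y)) * fhat (gchirp \<epsilon> 0) (x + y)) \<partial>lborel))"
      by (simp only: integral_mult_right_zero)
    also have "\<dots> \<le> (\<integral>\<^sup>+y. ennreal (norm (f x * (cnj (f (- y)) * fhat (gchirp \<epsilon> 0) (x + y)))) \<partial>lborel)"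
      by (rule ennreal_norm_integral_le)
    also have "\<dots> \<le> (\<integral>\<^sup>+y. ennreal ((norm (f x))\<^sup>2 / 2 * \<gamma> (x + y)) + ennreal ((norm (f (- y)))\<^sup>2 / 2 * \<gamma> (x + y)) \<partial>lborel)"
    proof (rule nn_integral_mono)
      fix y :: "real^'n"
      have "norm (f x) * norm (f (- y)) \<le> (norm (f x))\<^sup>2 / 2 + (norm (f (- y)))\<^sup>2 / 2"
        using sum_squares_bound[of "norm (f x)" "norm (f (- y))"] by simp
      then have "norm (f x) * norm (f (- y)) * \<gamma> (x + y) \<le> ((norm (f x))\<^sup>2 / 2 + (norm (f (- y)))\<^sup>2 / 2) * \<gamma> (x + y)"
        by (rule mult_right_mono[OF _ \<gamma>0])
      then have "norm (f x * (cnj (f (- y)) * fhat (gchirp \<epsilon> 0) (x + y))) \<le> (norm (f x))\<^sup>2 / 2 * \<gamma> (x + y) + (norm (f (- y)))\<^sup>2 / 2 * \<gamma> (x + y)"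
        using \<gamma>0[of "x + y"] unfolding fg norm_mult norm_of_real complex_mod_cnj by (simp add: distrib_right)
      then have "ennreal (norm (f x * (cnj (f (- y)) * fhat (gchirp \<epsilon> 0) (x + y)))) \<le> ennreal ((norm (f x))\<^sup>2 / 2 * \<gamma> (x + y) + (norm (f (- y)))\<^sup>2 / 2 * \<gamma> (x + y))"
        by (rule ennreal_leI)
      also have "\<dots> = ennreal ((norm (f x))\<^sup>2 / 2 * \<gamma> (x + y)) + ennreal ((norm (f (- y)))\<^sup>2 / 2 * \<gamma> (x + y))"
        using \<gamma>0[of "x + y"] by (intro ennreal_plus) auto
      finally show "ennreal (norm (f x * (cnj (f (- y)) * fhat (gchirp \<epsilon> 0) (x + y)))) \<le> ennreal ((norm (f x))\<^sup>2 / 2 * \<gamma> (x + y)) + ennreal ((norm (f (- y)))\<^sup>2 / 2 * \<gamma> (x + y))" .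
    qed
    finally show "ennreal (norm (f x * (\<integral>y. cnj (f (- y)) * fhat (gchirp \<epsilon> 0) (x + y) \<partial>lborel))) \<le> \<dots>" .
  qed
  also have "\<dots> = (\<integral>\<^sup>+x. (\<integral>\<^sup>+y. ennreal ((norm (f x))\<^sup>2 / 2 * \<gamma> (x + y)) \<partial>lborel) \<partial>lborel) + (\<integral>\<^sup>+x. (\<integral>\<^sup>+y. ennreal ((norm (f (- y)))\<^sup>2 / 2 * \<gamma> (x + y)) \<partial>lborel) \<partial>lborel)"
    by (simp add: nn_integral_add)
  also have "(\<integral>\<^sup>+x. (\<integral>\<^sup>+y. ennreal ((norm (f x))\<^sup>2 / 2 * \<gamma> (x + y)) \<partial>lborel) \<partial>lborel) = ennreal (?B / 2)"
  proof -
    have "(\<integral>\<^sup>+y. ennreal ((norm (f x))\<^sup>2 / 2 * \<gamma> (x + y)) \<partial>lborel) = ennreal (1/2) * ennreal ((norm (f x))\<^sup>2)" for x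
    proof -
      have "(\<integral>\<^sup>+y. ennreal ((norm (f x))\<^sup>2 / 2 * \<gamma> (x + y)) \<partial>lborel) = ennreal ((norm (f x))\<^sup>2 / 2) * (\<integral>\<^sup>+y. ennreal (\<gamma> (y + x)) \<partial>lborel)"
        unfolding split by (subst nn_integral_cmult) (auto simp: add.commute)
      also have "(\<integral>\<^sup>+y. ennreal (\<gamma> (y + x)) \<partial>lborel) = 1"
        using nn_integral_lborel_translate[of "\<lambda>y. ennreal (\<gamma> y)" x] \<gamma>1 by simp
      finally show ?thesis by (simp only: half mult_1_right)
    qed
    then have "(\<integral>\<^sup>+x. (\<integral>\<^sup>+y. ennreal ((norm (f x))\<^sup>2 / 2 * \<gamma> (x + y)) \<partial>lborel) \<partial>lborel) = ennreal (1/2) * ennreal ?B"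
      by (simp add: nn_integral_cmult B)
    then show ?thesis by (simp only: half')
  qed
  also have "(\<integral>\<^sup>+x. (\<integral>\<^sup>+y. ennreal ((norm (f (- y)))\<^sup>2 / 2 * \<gamma> (x + y)) \<partial>lborel) \<partial>lborel) = ennreal (?B / 2)"
  proof -
    have "(\<integral>\<^sup>+x. (\<integral>\<^sup>+y. ennreal ((norm (f (- y)))\<^sup>2 / 2 * \<gamma> (x + y)) \<partial>lborel) \<partial>lborel) = (\<integral>\<^sup>+y. (\<integral>\<^sup>+x. ennreal ((norm (f (- y)))\<^sup>2 / 2 * \<gamma> (x + y)) \<partial>lborel) \<partial>lborel)"
      by (rule lborel_pair.Fubini') measurable
    also have "\<dots> = (\<integral>\<^sup>+y. ennreal (1/2) * ennreal ((norm (f (- y)))\<^sup>2) \<partial>lborel)"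
    proof (rule nn_integral_cong)
      fix y :: "real^'n"
      have "(\<integral>\<^sup>+x. ennreal ((norm (f (- y)))\<^sup>2 / 2 * \<gamma> (x + y)) \<partial>lborel) = ennreal ((norm (f (- y)))\<^sup>2 / 2) * (\<integral>\<^sup>+x. ennreal (\<gamma> (x + y)) \<partial>lborel)"
        unfolding split by (rule nn_integral_cmult) measurable
      also have "(\<integral>\<^sup>+x. ennreal (\<gamma> (x + y)) \<partial>lborel) = 1"
        using nn_integral_lborel_translate[of "\<lambda>y. ennreal (\<gamma> y)" y] \<gamma>1 by simp
      finally show "(\<integral>\<^sup>+x. ennreal ((norm (f (- y)))\<^sup>2 / 2 * \<gamma> (x + y)) \<partial>lborel) = ennreal (1/2) * ennreal ((norm (f (- y)))\<^sup>2)"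
        by (simp only: half mult_1_right)
    qed
    also have "\<dots> = ennreal (1/2) * (\<integral>\<^sup>+y. ennreal ((norm (f (0 - y)))\<^sup>2) \<partial>lborel)"
      by (simp add: nn_integral_cmult)
    also have "(\<integral>\<^sup>+y. ennreal ((norm (f (0 - y)))\<^sup>2) \<partial>lborel) = ennreal ?B"
      unfolding B[symmetric] by (rule nn_integral_lborel_reflect) measurable
    finally show ?thesis by (simp only: half')
  qed
  also have "ennreal (?B / 2) + ennreal (?B / 2) = ennreal ?B"
    by (subst ennreal_plus[symmetric]) auto
  finally have 0: "norm (chirp_energy \<epsilon> 0 f) \<le> ?B" by simp
  have "norm (chirp_energy \<epsilon> k f) \<le> (\<integral>\<xi>. exp (- pi * \<epsilon> * (norm \<xi>)\<^sup>2) * (norm (fhat f \<xi>))\<^sup>2 \<partial>lborel)"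
    by (rule chirp_energy_le_0)
  also have "\<dots> \<le> norm (chirp_energy \<epsilon> 0 f)"
    unfolding chirp_energy_0 norm_of_real by (rule abs_ge_self)
  finally show ?thesis using 0 by simp
qed

subsection \<open>Averages over spheres\<close>

lemma abs_sqrt_eq: "\<bar>sqrt h\<bar> = sqrt \<bar>h\<bar>"
  by (cases "h \<ge> 0") (simp_all add: real_sqrt_minus[of "- h", simplified] abs_if)

text \<open>The point 0 is included because the fundamental theorem of calculus is later applied on
  [0, a] with two-sided derivatives. \<open>sqrt\<close> is odd on the reals, and at 0 the
  difference quotient is bounded by \<open>sqrt \<bar>h\<bar> ^ (d - 2)\<close>, which tends to
  0.\<close>

lemma sqrt_power_has_derivative:
  assumes d: "d \<ge> 3" and t: "t \<ge> 0"
  shows "((\<lambda>t. sqrt t ^ d) has_real_derivative (real d / 2 * sqrt t ^ (d - 2))) (at t)"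
proof (cases "t = 0")
  case False
  then have t: "t > 0" using t by simp
  have "((\<lambda>t. sqrt t ^ d) has_real_derivative (real d * sqrt t ^ (d - 1) * (inverse (sqrt t) / 2))) (at t)"
    using t by (auto intro!: derivative_eq_intros simp: mult_ac)
  moreover have "sqrt t ^ (d - 1) * inverse (sqrt t) = sqrt t ^ (d - 2)"
  proof -
    have "d - 1 = Suc (d - 2)" using d by simp
    then show ?thesis using t by simp
  qed
  ultimately show ?thesis by (simp add: mult_ac)
next
  case True
  have "(\<lambda>h. sqrt h ^ d / h) \<midarrow>0\<rightarrow> 0"
  proof (rule Lim_null_comparison)
    have "((\<lambda>h. sqrt \<bar>h\<bar> ^ (d - 2)) \<longlongrightarrow> sqrt \<bar>0\<bar> ^ (d - 2)) (at (0::real))"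
      by (intro tendsto_intros)
    then show "((\<lambda>h. sqrt \<bar>h\<bar> ^ (d - 2)) \<longlongrightarrow> 0) (at (0::real))" using d by (simp add: power_0_left)
    show "\<forall>\<^sub>F h in at 0. norm (sqrt h ^ d / h) \<le> sqrt \<bar>h\<bar> ^ (d - 2)"
    proof (intro always_eventually allI)
      fix h :: real
      have "d = 2 + (d - 2)" using d by simp
      then have "\<bar>sqrt h\<bar> ^ d = \<bar>sqrt h\<bar> ^ (2 + (d - 2))" by (rule arg_cong)
      also have "\<dots> = \<bar>sqrt h\<bar>\<^sup>2 * \<bar>sqrt h\<bar> ^ (d - 2)" by (rule power_add)
      also have "\<bar>sqrt h\<bar>\<^sup>2 = \<bar>h\<bar>" by (simp add: abs_sqrt_eq)
      finally have "norm (sqrt h ^ d / h) \<le> \<bar>sqrt h\<bar> ^ (d - 2)" by (cases "h = 0") (auto simp: power_abs)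
      also have "\<bar>sqrt h\<bar> = sqrt \<bar>h\<bar>" by (rule abs_sqrt_eq)
      finally show "norm (sqrt h ^ d / h) \<le> sqrt \<bar>h\<bar> ^ (d - 2)" .
    qed
  qed
  then show ?thesis using True d by (simp add: has_field_derivative_iff power_0_left)
qed

text \<open>Half the area of the unit sphere: the constant in the density of |\<xi>|^2.\<close>

definition radial_const :: "nat \<Rightarrow> real" where
  "radial_const d = real d / 2 * unit_ball_vol (real d)"

lemma radial_const_pos: "d > 0 \<Longrightarrow> radial_const d > 0"
  by (simp add: radial_const_def)

text \<open>Both measures agree on half-lines: the volume of a ball of radius sqrt a on one side,
  the fundamental theorem of calculus on the other. The exponent d/2 - 1 of t is the one in the
  lattice point count.\<close>

lemma distr_norm_sq_lborel:
  assumes d: "CARD('n::finite) \<ge> 3"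
  shows "distr (lborel :: (real^'n) measure) borel (\<lambda>\<xi>. (norm \<xi>)\<^sup>2) =
    density lborel (\<lambda>t. indicator {0..} t * ennreal (radial_const CARD('n) * sqrt t ^ (CARD('n) - 2)))"
    (is "?M = ?N")
proof -
  let ?d = "CARD('n)"
  let ?F = "\<lambda>t. unit_ball_vol (real ?d) * sqrt t ^ ?d"
  have M: "emeasure ?M {..a} = (if a \<ge> 0 then ennreal (?F a) else 0)" for a :: real
  proof (cases "a \<ge> 0")
    case True
    have "(\<lambda>\<xi>::real^'n. (norm \<xi>)\<^sup>2) -` {..a} = cball 0 (sqrt a)"
    proof -
      have "(norm \<xi>)\<^sup>2 \<le> a \<longleftrightarrow> norm \<xi> \<le> sqrt a" for \<xi> :: "real^'n"
        using real_sqrt_le_iff[of "(norm \<xi>)\<^sup>2" a] by simp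
      then show ?thesis by auto
    qed
    then show ?thesis using True by (simp add: emeasure_distr emeasure_cball)
  next
    case False
    then have "\<not> (norm \<xi>)\<^sup>2 \<le> a" for \<xi> :: "real^'n"
      using zero_le_power2[of "norm \<xi>"] by linarith
    then have "(\<lambda>\<xi>::real^'n. (norm \<xi>)\<^sup>2) -` {..a} = {}" by auto
    then show ?thesis using False by (simp add: emeasure_distr)
  qed
  have N: "emeasure ?N {..a} = (if a \<ge> 0 then ennreal (?F a) else 0)" for a :: real
  proof -
    have e: "emeasure ?N {..a} = (\<integral>\<^sup>+t. ennreal (radial_const ?d * sqrt t ^ (?d - 2)) * indicator {0..a} t \<partial>lborel)"
      by (subst emeasure_density) (auto intro!: nn_integral_cong simp: indicator_def)
    show ?thesis
    proof (cases "a \<ge> 0")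
      case True
      have "(\<integral>\<^sup>+t. ennreal (radial_const ?d * sqrt t ^ (?d - 2)) * indicator {0..a} t \<partial>lborel) = ?F a - ?F 0"
      proof (rule nn_integral_FTC_Icc)
        fix t assume "t \<in> {0..a}"
        then have "0 \<le> t" by simp
        then show "(?F has_real_derivative radial_const ?d * sqrt t ^ (?d - 2)) (at t)"
          using DERIV_cmult[OF sqrt_power_has_derivative[OF d, of t], of "unit_ball_vol (real ?d)"]
          by (simp add: radial_const_def mult_ac)
        show "0 \<le> radial_const ?d * sqrt t ^ (?d - 2)" using \<open>0 \<le> t\<close> by (simp add: radial_const_def)
      qed (use True in auto)
      then show ?thesis using True d by (simp add: e power_0_left)
    qed (simp add: e)
  qed
  show ?thesis
  proof (rule measure_eqI_generator_eq[where E = "range atMost" and \<Omega> = UNIV and A = "\<lambda>n. {..real n}"])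
    show "Int_stable (range (atMost :: real \<Rightarrow> real set))"
      by (auto simp: Int_stable_def)
    show "emeasure ?M X = emeasure ?N X" if "X \<in> range atMost" for X
      using that M N by auto
    show "sets ?M = sigma_sets UNIV (range atMost)" "sets ?N = sigma_sets UNIV (range atMost)"
      by (simp_all add: borel_eq_atMost)
    show "(\<Union>n. {..real n}) = UNIV" by (auto intro: real_arch_simple)
    show "emeasure ?M {..real n} \<noteq> \<infinity>" for n unfolding M by simp
  qed auto
qed

lemma nn_integral_radial:
  fixes u :: "real \<Rightarrow> ennreal"
  assumes d: "CARD('n::finite) \<ge> 3" and [measurable]: "u \<in> borel_measurable borel"
  shows "(\<integral>\<^sup>+\<xi>. u ((norm \<xi>)\<^sup>2) \<partial>(lborel :: (real^'n) measure)) =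
    (\<integral>\<^sup>+t. indicator {0..} t * ennreal (radial_const CARD('n) * sqrt t ^ (CARD('n) - 2)) * u t \<partial>lborel)"
proof -
  have "(\<integral>\<^sup>+\<xi>. u ((norm \<xi>)\<^sup>2) \<partial>(lborel :: (real^'n) measure)) = (\<integral>\<^sup>+t. u t \<partial>distr (lborel :: (real^'n) measure) borel (\<lambda>\<xi>. (norm \<xi>)\<^sup>2))"
    by (subst nn_integral_distr) auto
  also have "\<dots> = (\<integral>\<^sup>+t. indicator {0..} t * ennreal (radial_const CARD('n) * sqrt t ^ (CARD('n) - 2)) * u t \<partial>lborel)"
    unfolding distr_norm_sq_lborel[OF d] by (subst nn_integral_density) auto
  finally show ?thesis .
qed

lemma le_powr_interpolate:
  fixes x a b \<theta> :: real
  assumes "0 \<le> x" "x \<le> a" "x \<le> b" "0 \<le> \<theta>" "\<theta> \<le> 1"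
  shows "x \<le> a powr (1 - \<theta>) * b powr \<theta>"
proof (cases "x = 0")
  case False
  then have "x = x powr (1 - \<theta>) * x powr \<theta>" using assms by (simp flip: powr_add)
  also have "\<dots> \<le> a powr (1 - \<theta>) * b powr \<theta>" using assms by (intro mult_mono powr_mono2) auto
  finally show ?thesis .
qed simp

section \<open>Means of |f^|^2 over spheres and their sum over integer squared radii\<close>

definition sphere_mean :: "(real^'n^'n) measure \<Rightarrow> (real^'n \<Rightarrow> complex) \<Rightarrow> real^'n \<Rightarrow> real" where
  "sphere_mean \<mu> f v = (\<integral>A. (norm (fhat f (A *v v)))\<^sup>2 \<partial>\<mu>)"

context
  fixes \<mu> :: "(real^'n^'n) measure" and f :: "real^'n \<Rightarrow> complex"
  assumes haar: "haar_SO \<mu>" and f: "integrable lborel f"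
begin

lemma sphere_mean_integrable: "integrable \<mu> (\<lambda>A. (norm (fhat f (A *v v)))\<^sup>2)"
proof -
  interpret prob_space \<mu> using haar by (simp add: haar_SO_def)
  have [measurable_cong]: "sets \<mu> = sets borel" using haar by (simp add: haar_SO_def)
  have [measurable]: "f \<in> borel_measurable borel" using f by (simp add: borel_measurable_integrable)
  show ?thesis
  proof (rule integrable_const_bound[where B = "(\<integral>x. norm (f x) \<partial>lborel)\<^sup>2"])
    show "AE A in \<mu>. norm ((norm (fhat f (A *v v)))\<^sup>2) \<le> (\<integral>x. norm (f x) \<partial>lborel)\<^sup>2"
      using fhat_bound[OF f] by (intro AE_I2) (simp add: power_mono)
  qed measurable
qed

lemma sphere_mean_nonneg: "0 \<le> sphere_mean \<mu> f v"
  unfolding sphere_mean_def by (intro integral_nonneg_AE) simp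

lemma sphere_mean_nn: "ennreal (sphere_mean \<mu> f v) = (\<integral>\<^sup>+A. ennreal ((norm (fhat f (A *v v)))\<^sup>2) \<partial>\<mu>)"
  unfolding sphere_mean_def by (rule nn_integral_eq_integral[symmetric, OF sphere_mean_integrable]) simp

lemma sphere_mean_radial:
  assumes "2 \<le> CARD('n)" "norm v = norm w"
  shows "sphere_mean \<mu> f v = sphere_mean \<mu> f w"
proof -
  have [measurable]: "f \<in> borel_measurable borel" using f by (simp add: borel_measurable_integrable)
  have "ennreal (sphere_mean \<mu> f v) = ennreal (sphere_mean \<mu> f w)"
    unfolding sphere_mean_nn
    by (rule haar_SO_radial[OF assms(1) haar _ assms(2), of "\<lambda>\<xi>. ennreal ((norm (fhat f \<xi>))\<^sup>2)"]) measurable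
  then show ?thesis using sphere_mean_nonneg by simp
qed

text \<open>A single sphere is a null set, so integrals over space control the mean over it only
  through continuity, which f in L^1 provides.\<close>

lemma sphere_mean_tendsto:
  assumes t: "v \<longlonglongrightarrow> w"
  shows "(\<lambda>n. sphere_mean \<mu> f (v n)) \<longlonglongrightarrow> sphere_mean \<mu> f w"
  unfolding sphere_mean_def
proof (rule integral_dominated_convergence[where w = "\<lambda>_. (\<integral>x. norm (f x) \<partial>lborel)\<^sup>2"])
  interpret prob_space \<mu> using haar by (simp add: haar_SO_def)
  show "integrable \<mu> (\<lambda>_. (\<integral>x. norm (f x) \<partial>lborel)\<^sup>2)" by simp
  show "AE A in \<mu>. (\<lambda>n. (norm (fhat f (A *v v n)))\<^sup>2) \<longlonglongrightarrow> (norm (fhat f (A *v w)))\<^sup>2"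
  proof (intro AE_I2 tendsto_intros continuous_fhat[OF f])
    fix A :: "real^'n^'n"
    have "isCont ((*v) A) w" by (intro linear_continuous_at matrix_vector_mul_bounded_linear)
    then show "(\<lambda>n. A *v v n) \<longlonglongrightarrow> A *v w" by (rule isCont_tendsto_compose[OF _ t])
  qed
  show "AE A in \<mu>. norm ((norm (fhat f (A *v v n)))\<^sup>2) \<le> (\<integral>x. norm (f x) \<partial>lborel)\<^sup>2" for n
    using fhat_bound[OF f] by (intro AE_I2) (simp add: power_mono)
qed (use sphere_mean_integrable in \<open>auto simp: borel_measurable_integrable\<close>)

text \<open>The radial profile of the damped |f^|^2 is fed to \<open>sum_le_of_vp_bound\<close>. Its
  integral against the kernel is the integral over space of the damped |f^|^2 times
  \<open>vp N\<close> at |\<xi>|^2, hence a combination of the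
  \<open>chirp_energy \<epsilon> k f\<close> with coefficients in [0, 1]. For k \<noteq> 0 the two
  bounds on these are interpolated with weight \<theta>; Z bounds the resulting series in k.\<close>

lemma shell_sum_bound_eps:
  assumes d: "CARD('n) \<ge> 3" and f2: "integrable lborel (\<lambda>x. (norm (f x))\<^sup>2)" and e: "norm e = 1" and \<epsilon>: "\<epsilon> > 0"
    and \<theta>: "0 \<le> \<theta>" "\<theta> \<le> 1"
  defines "A1 \<equiv> \<integral>x. norm (f x) \<partial>lborel" and "A2 \<equiv> \<integral>x. (norm (f x))\<^sup>2 \<partial>lborel"
  assumes Z: "\<And>N. (\<Sum>k=1..N. real k powr (- (real CARD('n) * \<theta> / 2))) \<le> Z"
  shows "(\<Sum>n=1..M. radial_const CARD('n) * sqrt (real n) ^ (CARD('n) - 2) * exp (- pi * \<epsilon> * real n) * sphere_mean \<mu> f (sqrt (real n) *\<^sub>R e))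
    \<le> A2 + 2 * Z * (A2 powr (1 - \<theta>) * (A1\<^sup>2) powr \<theta>)"
proof -
  let ?d = "CARD('n)"
  interpret prob_space \<mu> using haar by (simp add: haar_SO_def)
  have [measurable_cong]: "sets \<mu> = sets borel" using haar by (simp add: haar_SO_def)
  have [measurable]: "f \<in> borel_measurable borel" using f by (simp add: borel_measurable_integrable)
  define B where "B = A2 + 2 * Z * (A2 powr (1 - \<theta>) * (A1\<^sup>2) powr \<theta>)"
  have A0: "0 \<le> A1" "0 \<le> A2" unfolding A1_def A2_def by (auto intro!: integral_nonneg_AE)
  have Z0: "0 \<le> Z" using Z[of 0] by simp
  have B0: "0 \<le> B" unfolding B_def using A0 Z0 by (intro add_nonneg_nonneg mult_nonneg_nonneg) auto
  define a where "a = (\<lambda>t. sphere_mean \<mu> f (sqrt t *\<^sub>R e))"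
  \<comment> \<open>\<open>sqrt\<close> is negative on negative reals; the absolute value makes G
    nonnegative and continuous on the whole line, as \<open>sum_le_of_vp_bound\<close> asks, without
    changing it for t > 0.\<close>
  define G where "G = (\<lambda>t. radial_const ?d * \<bar>sqrt t\<bar> ^ (?d - 2) * exp (- pi * \<epsilon> * t) * a t)"
  have a0: "0 \<le> a t" for t unfolding a_def by (rule sphere_mean_nonneg)
  have rc: "0 < radial_const ?d" using d by (intro radial_const_pos) simp
  have G0: "0 \<le> G t" for t unfolding G_def using a0 rc by (intro mult_nonneg_nonneg) auto
  have acont: "isCont a t" for t
    unfolding continuous_at_sequentially o_def a_def
  proof (intro allI impI sphere_mean_tendsto)
    fix x assume "x \<longlonglongrightarrow> t"
    then show "(\<lambda>n. sqrt (x n) *\<^sub>R e) \<longlonglongrightarrow> sqrt t *\<^sub>R e" by (intro tendsto_intros)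
  qed
  then have "continuous_on UNIV a" by (simp add: continuous_on_eq_continuous_at)
  then have am[measurable]: "a \<in> borel_measurable borel" by (rule borel_measurable_continuous_onI)
  have Gcont: "isCont G t" for t
    unfolding G_def by (intro continuous_intros acont isCont_real_sqrt)
  then have "continuous_on UNIV G" by (simp add: continuous_on_eq_continuous_at)
  then have Gm[measurable]: "G \<in> borel_measurable borel" by (rule borel_measurable_continuous_onI)
  have anorm: "a ((norm \<xi>)\<^sup>2) = sphere_mean \<mu> f \<xi>" for \<xi>
    unfolding a_def by (rule sphere_mean_radial) (use d e in auto)
  have bound: "(\<integral>\<^sup>+t. indicator {0<..} t * ennreal (G t * vp N t) \<partial>lborel) \<le> ennreal B" for N
  proof -
    define w where "w = (\<lambda>t. exp (- pi * \<epsilon> * t) * vp N t)"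
    have w0: "0 \<le> w t" for t unfolding w_def by (intro mult_nonneg_nonneg vp_nonneg) simp
    have [measurable]: "w \<in> borel_measurable borel" unfolding w_def by measurable
    have "(\<integral>\<^sup>+t. indicator {0<..} t * ennreal (G t * vp N t) \<partial>lborel) \<le>
       (\<integral>\<^sup>+t. indicator {0..} t * ennreal (radial_const ?d * sqrt t ^ (?d - 2)) * (ennreal (w t) * ennreal (a t)) \<partial>lborel)"
    proof (rule nn_integral_mono)
      fix t :: real
      show "indicator {0<..} t * ennreal (G t * vp N t) \<le> indicator {0..} t * ennreal (radial_const ?d * sqrt t ^ (?d - 2)) * (ennreal (w t) * ennreal (a t))"
      proof (cases "t > 0")
        case True
        have "ennreal (G t * vp N t) = ennreal ((radial_const ?d * sqrt t ^ (?d - 2)) * (w t * a t))"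
          using True unfolding G_def w_def by (simp add: mult_ac)
        also have "\<dots> = ennreal (radial_const ?d * sqrt t ^ (?d - 2)) * (ennreal (w t) * ennreal (a t))"
          using True rc w0 a0 by (simp add: ennreal_mult)
        finally show ?thesis using True by simp
      qed simp
    qed
    also have "\<dots> = (\<integral>\<^sup>+\<xi>. ennreal (w ((norm \<xi>)\<^sup>2)) * ennreal (a ((norm \<xi>)\<^sup>2)) \<partial>(lborel :: (real^'n) measure))"
      by (rule nn_integral_radial[OF d, symmetric]) measurable
    also have "\<dots> = (\<integral>\<^sup>+\<xi>. ennreal (w ((norm \<xi>)\<^sup>2)) * (\<integral>\<^sup>+A. ennreal ((norm (fhat f (A *v \<xi>)))\<^sup>2) \<partial>\<mu>) \<partial>lborel)"
      unfolding anorm sphere_mean_nn ..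
    also have "\<dots> = (\<integral>\<^sup>+\<xi>. ennreal (w ((norm \<xi>)\<^sup>2)) * ennreal ((norm (fhat f \<xi>))\<^sup>2) \<partial>lborel)"
      by (rule haar_SO_average[OF haar, of "\<lambda>\<xi>. ennreal ((norm (fhat f \<xi>))\<^sup>2)" "\<lambda>r. ennreal (w (r\<^sup>2))"]) measurable
    also have "\<dots> = (\<integral>\<^sup>+\<xi>. ennreal (w ((norm \<xi>)\<^sup>2) * (norm (fhat f \<xi>))\<^sup>2) \<partial>lborel)"
      using w0 by (intro nn_integral_cong ennreal_mult[symmetric]) auto
    also have "\<dots> \<le> ennreal B"
    proof -
      let ?h = "\<lambda>\<xi>::real^'n. w ((norm \<xi>)\<^sup>2) * (norm (fhat f \<xi>))\<^sup>2"
      have gi: "integrable lborel (\<lambda>\<xi>. gchirp \<epsilon> k \<xi> * of_real ((norm (fhat f \<xi>))\<^sup>2))" for k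
      proof (rule Bochner_Integration.integrable_bound)
        show "integrable lborel (\<lambda>\<xi>::real^'n. norm (gchirp \<epsilon> k \<xi>) * A1\<^sup>2)"
          by (intro integrable_mult_left integrable_norm integrable_gchirp \<epsilon>)
        have [measurable]: "(gchirp \<epsilon> k :: real^'n \<Rightarrow> complex) \<in> borel_measurable borel"
          using borel_measurable_integrable[OF integrable_gchirp[OF \<epsilon>, where k = k and 'n = 'n]] by simp
        show "(\<lambda>\<xi>. gchirp \<epsilon> k \<xi> * of_real ((norm (fhat f \<xi>))\<^sup>2)) \<in> borel_measurable lborel" by measurable
        have "norm (fhat f \<xi>) \<le> A1" for \<xi> unfolding A1_def by (rule fhat_bound[OF f])
        then show "AE \<xi> in lborel. norm (gchirp \<epsilon> k \<xi> * of_real ((norm (fhat f \<xi>))\<^sup>2)) \<le> norm (norm (gchirp \<epsilon> k \<xi>) * A1\<^sup>2)"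
          by (intro AE_I2) (auto simp: norm_mult norm_power intro!: mult_left_mono power_mono)
      qed
      have hexp: "complex_of_real (?h \<xi>) = (\<Sum>k\<in>{-int N..int N}. vp_coeff N k * (gchirp \<epsilon> k \<xi> * of_real ((norm (fhat f \<xi>))\<^sup>2)))" for \<xi>
        unfolding w_def of_real_mult vp_expand gchirp_def by (simp add: sum_distrib_left sum_distrib_right mult_ac)
      have hi: "integrable lborel ?h"
      proof -
        have "integrable lborel (\<lambda>\<xi>. Re (\<Sum>k\<in>{-int N..int N}. vp_coeff N k * (gchirp \<epsilon> k \<xi> * of_real ((norm (fhat f \<xi>))\<^sup>2))))"
          by (intro integrable_Re Bochner_Integration.integrable_sum integrable_mult_right gi)
        then show ?thesis unfolding hexp[symmetric] by simp
      qed
      have "complex_of_real (\<integral>\<xi>. ?h \<xi> \<partial>lborel) = (\<integral>\<xi>. complex_of_real (?h \<xi>) \<partial>lborel)"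
        by (rule integral_complex_of_real[symmetric])
      also have "\<dots> = (\<Sum>k\<in>{-int N..int N}. vp_coeff N k * chirp_energy \<epsilon> k f)"
        unfolding hexp chirp_energy_def
        by (simp only: Bochner_Integration.integral_sum gi integrable_mult_right integral_mult_right_zero)
      finally have "(\<integral>\<xi>. ?h \<xi> \<partial>lborel) \<le> norm (\<Sum>k\<in>{-int N..int N}. vp_coeff N k * chirp_energy \<epsilon> k f)"
        using abs_ge_self[of "\<integral>\<xi>. ?h \<xi> \<partial>lborel"] by (simp only: norm_of_real[symmetric, where 'a = complex])
      also have "\<dots> \<le> (\<Sum>k\<in>{-int N..int N}. norm (chirp_energy \<epsilon> k f))"
        using vp_coeff_bounds
        by (intro order_trans[OF norm_sum] sum_mono) (auto simp: norm_mult abs_of_nonneg intro!: mult_left_le_one_le)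
      also have "\<dots> \<le> (\<Sum>k\<in>{-int N..int N}. if k = 0 then A2 else A2 powr (1 - \<theta>) * (A1\<^sup>2) powr \<theta> * real_of_int \<bar>k\<bar> powr (- (real ?d * \<theta> / 2)))"
      proof (rule sum_mono)
        fix k :: int
        have 2: "norm (chirp_energy \<epsilon> k f) \<le> A2" unfolding A2_def by (rule chirp_energy_L2[OF f f2 \<epsilon>])
        show "norm (chirp_energy \<epsilon> k f) \<le> (if k = 0 then A2 else A2 powr (1 - \<theta>) * (A1\<^sup>2) powr \<theta> * real_of_int \<bar>k\<bar> powr (- (real ?d * \<theta> / 2)))"
        proof (cases "k = 0")
          case False
          define K where "K = \<bar>real_of_int k\<bar>"
          have K: "K > 0" using False by (simp add: K_def)
          have "norm (chirp_energy \<epsilon> k f) \<le> (1 / sqrt (2 * K)) ^ ?d * A1\<^sup>2"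
            unfolding A1_def K_def by (rule chirp_energy_dispersive[OF f \<epsilon>]) (use False in simp)
          also have "\<dots> \<le> (1 / sqrt K) ^ ?d * A1\<^sup>2"
            using K by (intro mult_right_mono power_mono divide_left_mono real_sqrt_le_mono) auto
          also have "(1 / sqrt K) ^ ?d = K powr (- (real ?d / 2))"
          proof -
            have "1 / sqrt K = K powr (- (1 / 2))" using K by (simp add: powr_minus_divide powr_half_sqrt)
            then have "(1 / sqrt K) ^ ?d = (K powr (- (1 / 2))) ^ ?d" by (rule arg_cong)
            also have "\<dots> = (K powr (- (1 / 2))) powr real ?d"
              by (rule powr_realpow[symmetric]) (use K in simp)
            also have "\<dots> = K powr (- (real ?d / 2))" by (simp add: powr_powr)
            finally show ?thesis .
          qed
          finally have 1: "norm (chirp_energy \<epsilon> k f) \<le> K powr (- (real ?d / 2)) * A1\<^sup>2" .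
          have "norm (chirp_energy \<epsilon> k f) \<le> A2 powr (1 - \<theta>) * (K powr (- (real ?d / 2)) * A1\<^sup>2) powr \<theta>"
            by (rule le_powr_interpolate[OF norm_ge_zero 2 1 \<theta>])
          also have "(K powr (- (real ?d / 2)) * A1\<^sup>2) powr \<theta> = K powr (- (real ?d * \<theta> / 2)) * (A1\<^sup>2) powr \<theta>"
            using K by (simp add: powr_mult powr_powr)
          finally show ?thesis using False by (simp add: K_def mult_ac)
        qed (use 2 in simp)
      qed
      also have "\<dots> = A2 + (\<Sum>k\<in>{-int N..int N} - {0}. A2 powr (1 - \<theta>) * (A1\<^sup>2) powr \<theta> * real_of_int \<bar>k\<bar> powr (- (real ?d * \<theta> / 2)))"
        by (subst sum.remove[of _ 0]) (auto intro!: sum.cong)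
      also have "(\<Sum>k\<in>{-int N..int N} - {0}. A2 powr (1 - \<theta>) * (A1\<^sup>2) powr \<theta> * real_of_int \<bar>k\<bar> powr (- (real ?d * \<theta> / 2)))
          = A2 powr (1 - \<theta>) * (A1\<^sup>2) powr \<theta> * (\<Sum>k\<in>{-int N..int N} - {0}. real_of_int \<bar>k\<bar> powr (- (real ?d * \<theta> / 2)))"
        by (simp only: sum_distrib_left)
      also have "(\<Sum>k\<in>{-int N..int N} - {0}. real_of_int \<bar>k\<bar> powr (- (real ?d * \<theta> / 2))) = 2 * (\<Sum>k=1..N. real k powr (- (real ?d * \<theta> / 2)))"
      proof -
        have "{-int N..int N} - {0} = {-int N..-1} \<union> {1..int N}" by auto
        then have "(\<Sum>k\<in>{-int N..int N} - {0}. real_of_int \<bar>k\<bar> powr (- (real ?d * \<theta> / 2))) =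
          (\<Sum>k\<in>{-int N..-1}. real_of_int \<bar>k\<bar> powr (- (real ?d * \<theta> / 2))) + (\<Sum>k\<in>{1..int N}. real_of_int \<bar>k\<bar> powr (- (real ?d * \<theta> / 2)))"
          by (simp only:) (subst sum.union_disjoint, auto)
        also have "(\<Sum>k\<in>{-int N..-1}. real_of_int \<bar>k\<bar> powr (- (real ?d * \<theta> / 2))) = (\<Sum>k=1..N. real k powr (- (real ?d * \<theta> / 2)))"
          by (rule sum.reindex_bij_witness[of _ "\<lambda>k. - int k" "\<lambda>k. nat (- k)"]) auto
        also have "(\<Sum>k\<in>{1..int N}. real_of_int \<bar>k\<bar> powr (- (real ?d * \<theta> / 2))) = (\<Sum>k=1..N. real k powr (- (real ?d * \<theta> / 2)))"
          by (rule sum.reindex_bij_witness[of _ int nat]) auto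
        finally show ?thesis by simp
      qed
      also have "A2 + A2 powr (1 - \<theta>) * (A1\<^sup>2) powr \<theta> * (2 * (\<Sum>k=1..N. real k powr (- (real ?d * \<theta> / 2)))) \<le> A2 + A2 powr (1 - \<theta>) * (A1\<^sup>2) powr \<theta> * (2 * Z)"
        by (intro add_left_mono mult_left_mono Z mult_nonneg_nonneg) auto
      also have "\<dots> = B" unfolding B_def by simp
      finally have "(\<integral>\<xi>. ?h \<xi> \<partial>lborel) \<le> B" .
      moreover have "(\<integral>\<^sup>+\<xi>. ennreal (?h \<xi>) \<partial>lborel) = ennreal (\<integral>\<xi>. ?h \<xi> \<partial>lborel)"
        using w0 by (intro nn_integral_eq_integral hi) auto
      ultimately show ?thesis by (simp add: ennreal_leI)
    qed
    finally show ?thesis .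
  qed
  have "(\<Sum>n=1..M. G (real n)) \<le> B"
    by (rule sum_le_of_vp_bound[OF G0 Gm Gcont bound B0])
  then show ?thesis unfolding G_def a_def B_def by simp
qed

end

subsection \<open>Summation over shells and interpolation\<close>

definition rotated_energy :: "(real^'n^'n) measure \<Rightarrow> (real^'n \<Rightarrow> complex) \<Rightarrow> ennreal" where
  "rotated_energy \<mu> f = (\<integral>\<^sup>+A. lattice_energy (\<lambda>v. (norm (fhat f (A *v v)))\<^sup>2) \<partial>\<mu>)"

context
  fixes \<mu> :: "(real^'n^'n) measure" and f :: "real^'n \<Rightarrow> complex"
  assumes haar: "haar_SO \<mu>" and f: "integrable lborel f"
begin

text \<open>The sum is finite, so \<epsilon> tends to 0 term by term under a bound that does not
  involve it.\<close>

lemma shell_sum_bound: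
  assumes d: "CARD('n) \<ge> 3" and f2: "integrable lborel (\<lambda>x. (norm (f x))\<^sup>2)" and e: "norm e = 1"
    and \<theta>: "0 \<le> \<theta>" "\<theta> \<le> 1"
    and Z: "\<And>N. (\<Sum>k=1..N. real k powr (- (real CARD('n) * \<theta> / 2))) \<le> Z"
  shows "(\<Sum>n=1..M. radial_const CARD('n) * sqrt (real n) ^ (CARD('n) - 2) * sphere_mean \<mu> f (sqrt (real n) *\<^sub>R e))
    \<le> (\<integral>x. (norm (f x))\<^sup>2 \<partial>lborel) + 2 * Z * ((\<integral>x. (norm (f x))\<^sup>2 \<partial>lborel) powr (1 - \<theta>) * ((\<integral>x. norm (f x) \<partial>lborel)\<^sup>2) powr \<theta>)"
    (is "?S \<le> ?B")
proof -
  let ?T = "\<lambda>\<epsilon>. \<Sum>n=1..M. radial_const CARD('n) * sqrt (real n) ^ (CARD('n) - 2) * exp (- pi * \<epsilon> * real n) * sphere_mean \<mu> f (sqrt (real n) *\<^sub>R e)"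
  have "(\<lambda>j. ?T (inverse (real (Suc j)))) \<longlonglongrightarrow>
     (\<Sum>n=1..M. radial_const CARD('n) * sqrt (real n) ^ (CARD('n) - 2) * exp (- pi * 0 * real n) * sphere_mean \<mu> f (sqrt (real n) *\<^sub>R e))"
    by (intro tendsto_intros LIMSEQ_inverse_real_of_nat)
  moreover have "?T (inverse (real (Suc j))) \<le> ?B" for j
    by (rule shell_sum_bound_eps[OF haar f d f2 e _ \<theta> Z]) simp
  ultimately have "(\<Sum>n=1..M. radial_const CARD('n) * sqrt (real n) ^ (CARD('n) - 2) * exp (- pi * 0 * real n) * sphere_mean \<mu> f (sqrt (real n) *\<^sub>R e)) \<le> ?B"
    by (intro LIMSEQ_le_const2[of _ _ ?B]) auto
  then show ?thesis by simp
qed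

text \<open>A shell contributes its cardinality times one spherical mean. The count is a multiple of
  the power of n that occurs in the radial density, and the quotient of the two constants comes out
  in front.\<close>

lemma rotated_energy_bound:
  assumes d: "CARD('n) \<ge> 5" and f2: "integrable lborel (\<lambda>x. (norm (f x))\<^sup>2)"
    and \<theta>: "0 \<le> \<theta>" "\<theta> \<le> 1"
    and Z: "\<And>N. (\<Sum>k=1..N. real k powr (- (real CARD('n) * \<theta> / 2))) \<le> Z"
  shows "rotated_energy \<mu> f \<le> ennreal (12 ^ CARD('n) * moment_const / radial_const CARD('n) *
    ((\<integral>x. (norm (f x))\<^sup>2 \<partial>lborel) + 2 * Z * ((\<integral>x. (norm (f x))\<^sup>2 \<partial>lborel) powr (1 - \<theta>) * ((\<integral>x. norm (f x) \<partial>lborel)\<^sup>2) powr \<theta>)))"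
    (is "_ \<le> ennreal (?K / ?c * ?B)")
proof -
  have [measurable_cong]: "sets \<mu> = sets borel" using haar by (simp add: haar_SO_def)
  have [measurable]: "f \<in> borel_measurable borel" using f by (simp add: borel_measurable_integrable)
  define e where "e = (axis undefined 1 :: real^'n)"
  have e: "norm e = 1" by (simp add: e_def)
  have K0: "0 \<le> ?K" by (simp add: moment_const_def)
  have c0: "0 < ?c" using d by (intro radial_const_pos) simp
  have fs: "finite (shell (Suc n) :: (real^'n) set)" for n by (rule card_shell_le(1)[OF d]) simp
  have "rotated_energy \<mu> f = (\<integral>\<^sup>+A. (\<Sum>n. \<Sum>v\<in>shell (Suc n). ennreal ((norm (fhat f (A *v v)))\<^sup>2)) \<partial>\<mu>)"
    unfolding rotated_energy_def lattice_energy_def by (intro nn_integral_cong suminf_cong sum_ennreal[symmetric]) auto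
  also have "\<dots> = (\<Sum>n. \<integral>\<^sup>+A. (\<Sum>v\<in>shell (Suc n). ennreal ((norm (fhat f (A *v v)))\<^sup>2)) \<partial>\<mu>)"
    by (rule nn_integral_suminf) measurable
  also have "\<dots> = (\<Sum>n. \<Sum>v\<in>shell (Suc n). ennreal (sphere_mean \<mu> f v))"
    unfolding sphere_mean_nn[OF haar f] by (intro suminf_cong nn_integral_sum) measurable
  also have "\<dots> \<le> ennreal (?K / ?c * ?B)"
    unfolding suminf_eq_SUP
  proof (rule SUP_least)
    fix M :: nat
    let ?a = "\<lambda>n. sphere_mean \<mu> f (sqrt (real n) *\<^sub>R e)"
    have "(\<Sum>n<M. \<Sum>v\<in>shell (Suc n). ennreal (sphere_mean \<mu> f v)) \<le> (\<Sum>n<M. ennreal (?K / ?c * (?c * sqrt (real (Suc n)) ^ (CARD('n) - 2) * ?a (Suc n))))"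
    proof (rule sum_mono)
      fix n
      have "(\<Sum>v\<in>shell (Suc n). ennreal (sphere_mean \<mu> f v)) = (\<Sum>v\<in>(shell (Suc n) :: (real^'n) set). ennreal (?a (Suc n)))"
      proof (intro sum.cong refl arg_cong[of _ _ ennreal])
        fix v :: "real^'n" assume "v \<in> shell (Suc n)"
        then have "(norm v)\<^sup>2 = real (Suc n)" by (simp add: shell_def)
        then have "norm v = sqrt (real (Suc n))" by (metis norm_ge_zero real_sqrt_unique)
        then show "sphere_mean \<mu> f v = ?a (Suc n)"
          using d by (intro sphere_mean_radial[OF haar f]) (auto simp: e)
      qed
      also have "\<dots> = ennreal (real (card (shell (Suc n) :: (real^'n) set)) * ?a (Suc n))"
        using sphere_mean_nonneg[OF haar f] by (simp add: ennreal_mult ennreal_of_nat_eq_real_of_nat)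
      also have "\<dots> \<le> ennreal ((?K * sqrt (real (Suc n)) ^ (CARD('n) - 2)) * ?a (Suc n))"
        using card_shell_le(2)[OF d, of "Suc n"] sphere_mean_nonneg[OF haar f] by (intro ennreal_leI mult_right_mono) auto
      also have "(?K * sqrt (real (Suc n)) ^ (CARD('n) - 2)) * ?a (Suc n) = ?K / ?c * (?c * sqrt (real (Suc n)) ^ (CARD('n) - 2) * ?a (Suc n))"
        using c0 by simp
      finally show "(\<Sum>v\<in>shell (Suc n). ennreal (sphere_mean \<mu> f v)) \<le> ennreal (?K / ?c * (?c * sqrt (real (Suc n)) ^ (CARD('n) - 2) * ?a (Suc n)))" .
    qed
    also have "\<dots> = ennreal (\<Sum>n<M. ?K / ?c * (?c * sqrt (real (Suc n)) ^ (CARD('n) - 2) * ?a (Suc n)))"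
      using K0 c0 sphere_mean_nonneg[OF haar f] by (intro sum_ennreal mult_nonneg_nonneg) auto
    also have "(\<Sum>n<M. ?K / ?c * (?c * sqrt (real (Suc n)) ^ (CARD('n) - 2) * ?a (Suc n))) = ?K / ?c * (\<Sum>n<M. ?c * sqrt (real (Suc n)) ^ (CARD('n) - 2) * ?a (Suc n))"
      by (rule sum_distrib_left[symmetric])
    also have "(\<Sum>n<M. ?c * sqrt (real (Suc n)) ^ (CARD('n) - 2) * ?a (Suc n)) = (\<Sum>n=1..M. ?c * sqrt (real n) ^ (CARD('n) - 2) * ?a n)"
      by (rule sum.reindex_bij_witness[of _ "\<lambda>n. n - 1" Suc]) auto
    also have "ennreal (?K / ?c * \<dots>) \<le> ennreal (?K / ?c * ?B)"
      using d K0 c0 by (intro ennreal_leI mult_left_mono shell_sum_bound[OF _ f2 e \<theta> Z]) auto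
    finally show "(\<Sum>n<M. \<Sum>v\<in>shell (Suc n). ennreal (sphere_mean \<mu> f v)) \<le> ennreal (?K / ?c * ?B)" .
  qed
  finally show ?thesis .
qed

end

text \<open>Cauchy-Schwarz with geometric weights r^i. Transforms of disjoint pieces of f need not
  be orthogonal on the lattice; the weighted sum costs a factor r^(-i) on the i-th piece, which the
  decay of the pieces can afford.\<close>

lemma sums_norm_sq_le:
  fixes a :: "nat \<Rightarrow> complex" and r :: real
  assumes r: "0 < r" "r < 1" and a: "a sums s"
  shows "ennreal ((norm s)\<^sup>2) \<le> (\<Sum>i. ennreal (1 / (1 - r) * ((norm (a i))\<^sup>2 / r ^ i)))"
proof -
  have bound: "ennreal ((norm (\<Sum>i<n. a i))\<^sup>2) \<le> (\<Sum>i. ennreal (1 / (1 - r) * ((norm (a i))\<^sup>2 / r ^ i)))" for n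
  proof -
    have "norm (\<Sum>i<n. a i) \<le> (\<Sum>i<n. sqrt (r ^ i) * (norm (a i) / sqrt (r ^ i)))"
      using r by (intro order_trans[OF norm_sum] sum_mono) simp
    then have "(norm (\<Sum>i<n. a i))\<^sup>2 \<le> (\<Sum>i<n. sqrt (r ^ i) * (norm (a i) / sqrt (r ^ i)))\<^sup>2"
      by (intro power_mono) auto
    also have "\<dots> \<le> (\<Sum>i<n. (sqrt (r ^ i))\<^sup>2) * (\<Sum>i<n. (norm (a i) / sqrt (r ^ i))\<^sup>2)"
      by (rule Cauchy_Schwarz_ineq_sum)
    also have "\<dots> = (\<Sum>i<n. r ^ i) * (\<Sum>i<n. (norm (a i))\<^sup>2 / r ^ i)"
      using r by (simp add: power_divide)
    also have "\<dots> \<le> (1 / (1 - r)) * (\<Sum>i<n. (norm (a i))\<^sup>2 / r ^ i)"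
    proof (intro mult_right_mono sum_nonneg)
      have "(\<Sum>i<n. r ^ i) \<le> (\<Sum>i. r ^ i)" using r by (intro sum_le_suminf summable_geometric) auto
      then show "(\<Sum>i<n. r ^ i) \<le> 1 / (1 - r)" using r by (simp add: suminf_geometric)
    qed (use r in auto)
    also have "\<dots> = (\<Sum>i<n. 1 / (1 - r) * ((norm (a i))\<^sup>2 / r ^ i))"
      by (rule sum_distrib_left)
    finally have "ennreal ((norm (\<Sum>i<n. a i))\<^sup>2) \<le> ennreal (\<Sum>i<n. 1 / (1 - r) * ((norm (a i))\<^sup>2 / r ^ i))"
      by (rule ennreal_leI)
    also have "\<dots> = (\<Sum>i<n. ennreal (1 / (1 - r) * ((norm (a i))\<^sup>2 / r ^ i)))"
      using r by (intro sum_ennreal[symmetric]) auto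
    also have "\<dots> \<le> (\<Sum>i. ennreal (1 / (1 - r) * ((norm (a i))\<^sup>2 / r ^ i)))"
      by (intro sum_le_suminf) auto
    finally show ?thesis .
  qed
  have "(\<lambda>n. ennreal ((norm (\<Sum>i<n. a i))\<^sup>2)) \<longlonglongrightarrow> ennreal ((norm s)\<^sup>2)"
    using a unfolding sums_def by (intro tendsto_ennrealI tendsto_intros)
  then show ?thesis by (rule LIMSEQ_le_const2) (use bound in blast)
qed

section \<open>Energies of infinite decompositions\<close>

lemma suminf_swap_ennreal:
  fixes f :: "nat \<Rightarrow> nat \<Rightarrow> ennreal"
  shows "(\<Sum>n. \<Sum>i. f n i) = (\<Sum>i. \<Sum>n. f n i)"
proof -
  have "(\<Sum>n. \<Sum>i. f n i) = (\<integral>\<^sup>+n. (\<Sum>i. f n i) \<partial>count_space UNIV)"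
    by (rule nn_integral_count_space_nat[symmetric])
  also have "\<dots> = (\<Sum>i. \<integral>\<^sup>+n. f n i \<partial>count_space UNIV)"
    by (rule nn_integral_suminf) simp
  finally show ?thesis by (simp only: nn_integral_count_space_nat)
qed

lemma lattice_energy_subadditive:
  assumes g: "\<And>v. 0 \<le> g v" and h: "\<And>i v. 0 \<le> h i v" and le: "\<And>v. ennreal (g v) \<le> (\<Sum>i. ennreal (h i v))"
  shows "lattice_energy g \<le> (\<Sum>i. lattice_energy (h i))"
proof -
  have "lattice_energy g \<le> (\<Sum>n. \<Sum>i. ennreal (\<Sum>v\<in>shell (Suc n). h i v))"
    unfolding lattice_energy_def
  proof (intro suminf_le summableI)
    fix n
    have "ennreal (\<Sum>v\<in>shell (Suc n). g v) = (\<Sum>v\<in>shell (Suc n). ennreal (g v))"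
      using g by (intro sum_ennreal[symmetric]) auto
    also have "\<dots> \<le> (\<Sum>v\<in>shell (Suc n). \<Sum>i. ennreal (h i v))" by (intro sum_mono le)
    also have "\<dots> = (\<Sum>i. \<Sum>v\<in>shell (Suc n). ennreal (h i v))"
      by (rule suminf_sum[symmetric]) simp
    also have "\<dots> = (\<Sum>i. ennreal (\<Sum>v\<in>shell (Suc n). h i v))"
      using h by (intro suminf_cong sum_ennreal) auto
    finally show "ennreal (\<Sum>v\<in>shell (Suc n). g v) \<le> (\<Sum>i. ennreal (\<Sum>v\<in>shell (Suc n). h i v))" .
  qed
  also have "\<dots> = (\<Sum>i. lattice_energy (h i))"
    unfolding lattice_energy_def by (rule suminf_swap_ennreal)
  finally show ?thesis .
qed

lemma lattice_energy_cmult: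
  assumes "0 \<le> c" "\<And>v. 0 \<le> g v"
  shows "lattice_energy (\<lambda>v. c * g v) = ennreal c * lattice_energy g"
proof -
  have "lattice_energy (\<lambda>v. c * g v) = (\<Sum>n. ennreal c * ennreal (\<Sum>v\<in>shell (Suc n). g v))"
    unfolding lattice_energy_def sum_distrib_left[symmetric]
    using assms by (intro suminf_cong ennreal_mult sum_nonneg) auto
  then show ?thesis unfolding lattice_energy_def by simp
qed

lemma measurable_lattice_energy [measurable]:
  fixes f :: "real^'n \<Rightarrow> complex"
  assumes "f \<in> borel_measurable borel"
  shows "(\<lambda>A. lattice_energy (\<lambda>v. (norm (fhat f (A *v v)))\<^sup>2)) \<in> borel_measurable borel"
proof -
  note assms[measurable]
  show ?thesis unfolding lattice_energy_def by measurable
qed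

lemma rotated_energy_subadditive:
  fixes f :: "real^'n \<Rightarrow> complex" and F :: "nat \<Rightarrow> real^'n \<Rightarrow> complex"
  assumes haar: "haar_SO \<mu>" and r: "0 < r" "r < 1" and F: "\<And>i. F i \<in> borel_measurable borel"
    and sums: "\<And>\<xi>. (\<lambda>i. fhat (F i) \<xi>) sums fhat f \<xi>"
  shows "rotated_energy \<mu> f \<le> (\<Sum>i. ennreal (1 / (1 - r) / r ^ i) * rotated_energy \<mu> (F i))"
proof -
  have [measurable_cong]: "sets \<mu> = sets borel" using haar by (simp add: haar_SO_def)
  note F[measurable]
  have "rotated_energy \<mu> f \<le> (\<integral>\<^sup>+A. (\<Sum>i. ennreal (1 / (1 - r) / r ^ i) * lattice_energy (\<lambda>v. (norm (fhat (F i) (A *v v)))\<^sup>2)) \<partial>\<mu>)"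
    unfolding rotated_energy_def
  proof (rule nn_integral_mono)
    fix A :: "real^'n^'n"
    have "lattice_energy (\<lambda>v. (norm (fhat f (A *v v)))\<^sup>2) \<le> (\<Sum>i. lattice_energy (\<lambda>v. 1 / (1 - r) / r ^ i * (norm (fhat (F i) (A *v v)))\<^sup>2))"
      using sums_norm_sq_le[OF r sums] r by (intro lattice_energy_subadditive) (auto simp: mult_ac)
    also have "\<dots> = (\<Sum>i. ennreal (1 / (1 - r) / r ^ i) * lattice_energy (\<lambda>v. (norm (fhat (F i) (A *v v)))\<^sup>2))"
      using r by (intro suminf_cong lattice_energy_cmult) auto
    finally show "lattice_energy (\<lambda>v. (norm (fhat f (A *v v)))\<^sup>2) \<le> \<dots>" .
  qed
  also have "\<dots> = (\<Sum>i. \<integral>\<^sup>+A. ennreal (1 / (1 - r) / r ^ i) * lattice_energy (\<lambda>v. (norm (fhat (F i) (A *v v)))\<^sup>2) \<partial>\<mu>)"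
    by (rule nn_integral_suminf) measurable
  also have "\<dots> = (\<Sum>i. ennreal (1 / (1 - r) / r ^ i) * rotated_energy \<mu> (F i))"
    unfolding rotated_energy_def by (intro suminf_cong nn_integral_cmult) measurable
  finally show ?thesis .
qed

text \<open>A dyadic decomposition downwards from the height \<tau>. Slice 0 has no upper cutoff and
  holds everything above \<tau>; the large values are left to the L^2 norm.\<close>

definition level_cut :: "real \<Rightarrow> ('a \<Rightarrow> complex) \<Rightarrow> nat \<Rightarrow> 'a \<Rightarrow> complex" where
  "level_cut \<tau> f i x = (if \<tau> / 2 ^ i < norm (f x) \<and> (i = 0 \<or> norm (f x) \<le> 2 * \<tau> / 2 ^ i) then f x else 0)"

lemma sum_level_cut:
  assumes "\<tau> > 0"
  shows "(\<Sum>i<Suc n. level_cut \<tau> f i x) = (if \<tau> / 2 ^ n < norm (f x) then f x else 0)"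
proof (induction n)
  case (Suc n)
  have "\<tau> / 2 ^ Suc n < \<tau> / 2 ^ n" using assms by (simp add: divide_strict_left_mono)
  moreover have "2 * \<tau> / 2 ^ Suc n = \<tau> / 2 ^ n" by simp
  ultimately show ?case unfolding sum.lessThan_Suc[of _ "Suc n"] Suc level_cut_def[of _ _ "Suc n"] by auto
qed (simp add: level_cut_def)

lemma measurable_level_cut [measurable]:
  assumes [measurable]: "f \<in> borel_measurable M"
  shows "level_cut \<tau> f i \<in> borel_measurable M"
proof -
  have "(\<lambda>x. if \<tau> / 2 ^ i < norm (f x) \<and> (i = 0 \<or> norm (f x) \<le> 2 * \<tau> / 2 ^ i) then f x else 0) \<in> borel_measurable M"
    by measurable
  then show ?thesis by (simp add: level_cut_def[abs_def])
qed

lemma norm_level_cut_le: "norm (level_cut \<tau> f i x) \<le> norm (f x)"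
  by (simp add: level_cut_def)

text \<open>The partial sums are f restricted to the set where |f| exceeds \<tau>/2^n, so |f|
  dominates them.\<close>

lemma fhat_level_cut_sums:
  fixes f :: "real^'n \<Rightarrow> complex"
  assumes \<tau>: "\<tau> > 0" and f: "integrable lborel f"
  shows "(\<lambda>i. fhat (level_cut \<tau> f i) \<xi>) sums fhat f \<xi>"
proof -
  have [measurable]: "f \<in> borel_measurable borel" using f by (simp add: borel_measurable_integrable)
  have li: "integrable lborel (level_cut \<tau> f i)" for i
    using f by (rule Bochner_Integration.integrable_bound) (auto simp: norm_level_cut_le)
  let ?P = "\<lambda>n x. (\<Sum>i<Suc n. level_cut \<tau> f i x)"
  have "(\<lambda>n. \<integral>x. ?P n x * ee (- (\<xi> \<bullet> x)) \<partial>lborel) \<longlonglongrightarrow> (\<integral>x. f x * ee (- (\<xi> \<bullet> x)) \<partial>lborel)"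
  proof (rule integral_dominated_convergence[where w = "\<lambda>x. norm (f x)"])
    show "AE x in lborel. (\<lambda>n. ?P n x * ee (- (\<xi> \<bullet> x))) \<longlonglongrightarrow> f x * ee (- (\<xi> \<bullet> x))"
    proof (intro AE_I2 tendsto_mult tendsto_const)
      fix x
      show "(\<lambda>n. ?P n x) \<longlonglongrightarrow> f x"
      proof (cases "f x = 0")
        case False
        have "(\<lambda>n. \<tau> * (1 / 2) ^ n) \<longlonglongrightarrow> \<tau> * 0" by (intro tendsto_intros LIMSEQ_realpow_zero) auto
        then have "\<forall>\<^sub>F n in sequentially. \<tau> * (1 / 2) ^ n < norm (f x)"
          using False by (intro order_tendstoD) auto
        then have "\<forall>\<^sub>F n in sequentially. ?P n x = f x"
          by eventually_elim (simp only: sum_level_cut[OF \<tau>], simp add: power_one_over)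
        then show ?thesis by (rule tendsto_eventually)
      next
        case True
        show ?thesis by (simp only: sum_level_cut[OF \<tau>] True if_cancel tendsto_const)
      qed
    qed
    show "AE x in lborel. norm (?P n x * ee (- (\<xi> \<bullet> x))) \<le> norm (f x)" for n
      unfolding sum_level_cut[OF \<tau>] by (intro AE_I2) (simp add: norm_mult)
    show "(\<lambda>x. f x * ee (- (\<xi> \<bullet> x))) \<in> borel_measurable lborel" by measurable
    show "(\<lambda>x. ?P n x * ee (- (\<xi> \<bullet> x))) \<in> borel_measurable lborel" for n
      unfolding sum_level_cut[OF \<tau>] by measurable
  qed (use f in simp)
  moreover have "(\<integral>x. ?P n x * ee (- (\<xi> \<bullet> x)) \<partial>lborel) = (\<Sum>i<Suc n. fhat (level_cut \<tau> f i) \<xi>)" for n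
  proof -
    have i: "integrable lborel (\<lambda>x. level_cut \<tau> f i x * ee (- (\<xi> \<bullet> x)))" for i
      by (intro integrable_mult_ee li) measurable
    show ?thesis unfolding fhat_def sum_distrib_right by (simp only: Bochner_Integration.integral_sum i)
  qed
  ultimately have "(\<lambda>n. \<Sum>i<Suc n. fhat (level_cut \<tau> f i) \<xi>) \<longlonglongrightarrow> fhat f \<xi>" by (simp only: fhat_def)
  then show ?thesis unfolding sums_def by (rule LIMSEQ_imp_Suc)
qed

text \<open>Both integrals are traded for that of |f|^p: the lower cutoff of a slice bounds the L^1
  norm, since 1 - p <= 0, and the upper cutoff bounds the squared L^2 norm. As i grows, the first
  bound grows like 2^(i (p - 1)) while the second decays like 2^(-i (2 - p)); interpolation has to
  balance the two.\<close>

lemma level_cut_moments: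
  fixes f :: "real^'n \<Rightarrow> complex"
  assumes \<tau>: "\<tau> > 0" and p: "1 \<le> p" "p < 2"
    and f: "integrable lborel f" and f2: "integrable lborel (\<lambda>x. (norm (f x))\<^sup>2)"
    and fp: "integrable lborel (\<lambda>x. norm (f x) powr p)"
    and b2: "(\<integral>x. (norm (f x))\<^sup>2 \<partial>lborel) \<le> \<tau>\<^sup>2" and bp: "(\<integral>x. norm (f x) powr p \<partial>lborel) \<le> \<tau> powr p"
  shows "(\<integral>x. (norm (level_cut \<tau> f i x))\<^sup>2 \<partial>lborel) \<le> 2 * \<tau>\<^sup>2 * 2 powr (- (real i * (2 - p)))"
    and "(\<integral>x. norm (level_cut \<tau> f i x) \<partial>lborel) \<le> \<tau> * 2 powr (real i * (p - 1))"
proof -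
  let ?t = "\<tau> / 2 ^ i"
  have t: "?t > 0" using \<tau> by simp
  have tp: "?t = \<tau> * 2 powr (- real i)" by (simp add: powr_minus powr_realpow field_simps)
  have "norm (level_cut \<tau> f i x) \<le> ?t powr (1 - p) * norm (f x) powr p" for x
  proof (cases "level_cut \<tau> f i x = 0")
    case False
    then have n: "?t < norm (f x)" "level_cut \<tau> f i x = f x" by (auto simp: level_cut_def split: if_splits)
    then have pos: "0 < norm (f x)" using t by linarith
    have "norm (f x) = norm (f x) powr (1 - p) * norm (f x) powr p" using pos by (simp flip: powr_add)
    also have "\<dots> \<le> ?t powr (1 - p) * norm (f x) powr p"
      using n t p by (intro mult_right_mono powr_mono2') auto
    finally show ?thesis using n by simp
  qed simp
  then have "(\<integral>x. norm (level_cut \<tau> f i x) \<partial>lborel) \<le> (\<integral>x. ?t powr (1 - p) * norm (f x) powr p \<partial>lborel)"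
    using fp by (intro integral_mono_AE') auto
  also have "\<dots> \<le> ?t powr (1 - p) * \<tau> powr p"
    unfolding integral_mult_right_zero by (intro mult_left_mono bp) auto
  also have "\<dots> = \<tau> * 2 powr (real i * (p - 1))"
  proof -
    have "?t powr (1 - p) = \<tau> powr (1 - p) * 2 powr (real i * (p - 1))"
      unfolding tp using \<tau> by (simp add: powr_mult powr_powr algebra_simps)
    moreover have "\<tau> powr (1 - p) * \<tau> powr p = \<tau>" using \<tau> by (simp flip: powr_add)
    ultimately show ?thesis by (simp add: mult_ac)
  qed
  finally show "(\<integral>x. norm (level_cut \<tau> f i x) \<partial>lborel) \<le> \<tau> * 2 powr (real i * (p - 1))" .
  show "(\<integral>x. (norm (level_cut \<tau> f i x))\<^sup>2 \<partial>lborel) \<le> 2 * \<tau>\<^sup>2 * 2 powr (- (real i * (2 - p)))"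
  \<comment> \<open>Slice 0 lacks the upper cutoff, so the L^2 norm of f itself is used.\<close>
  proof (cases "i = 0")
    case True
    have "(\<integral>x. (norm (level_cut \<tau> f i x))\<^sup>2 \<partial>lborel) \<le> (\<integral>x. (norm (f x))\<^sup>2 \<partial>lborel)"
      using f2 by (intro integral_mono_AE') (auto intro!: AE_I2 power_mono norm_level_cut_le)
    also have "\<dots> \<le> \<tau>\<^sup>2" by (rule b2)
    also have "\<dots> \<le> 2 * \<tau>\<^sup>2" by simp
    finally show ?thesis using True by simp
  next
    case False
    have "(norm (level_cut \<tau> f i x))\<^sup>2 \<le> (2 * ?t) powr (2 - p) * norm (f x) powr p" for x
    proof (cases "level_cut \<tau> f i x = 0")
      case *: False
      then have n: "?t < norm (f x)" "norm (f x) \<le> 2 * ?t" "level_cut \<tau> f i x = f x"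
        using False by (auto simp: level_cut_def split: if_splits)
      then have pos: "0 < norm (f x)" using t by linarith
      have "(norm (f x))\<^sup>2 = norm (f x) powr (2 - p) * norm (f x) powr p"
        using pos by (simp add: powr_add[symmetric])
      also have "\<dots> \<le> (2 * ?t) powr (2 - p) * norm (f x) powr p"
        using n p pos by (intro mult_right_mono powr_mono2) auto
      finally show ?thesis using n by simp
    qed simp
    then have "(\<integral>x. (norm (level_cut \<tau> f i x))\<^sup>2 \<partial>lborel) \<le> (\<integral>x. (2 * ?t) powr (2 - p) * norm (f x) powr p \<partial>lborel)"
      using fp by (intro integral_mono_AE') auto
    also have "\<dots> \<le> (2 * ?t) powr (2 - p) * \<tau> powr p"
      unfolding integral_mult_right_zero by (intro mult_left_mono bp) auto
    also have "\<dots> = 2 powr (2 - p) * (\<tau>\<^sup>2 * 2 powr (- (real i * (2 - p))))"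
    proof -
      have "(2 * ?t) powr (2 - p) = 2 powr (2 - p) * (\<tau> powr (2 - p) * 2 powr (- (real i * (2 - p))))"
        unfolding tp using \<tau> by (simp add: powr_mult powr_powr)
      moreover have "\<tau> powr (2 - p) * \<tau> powr p = \<tau>\<^sup>2" using \<tau> by (simp add: powr_add[symmetric])
      ultimately show ?thesis by (simp add: mult_ac)
    qed
    also have "\<dots> \<le> 2 * (\<tau>\<^sup>2 * 2 powr (- (real i * (2 - p))))"
      using powr_mono[of "2 - p" 1 2] p by (intro mult_right_mono) auto
    finally show ?thesis by simp
  qed
qed

text \<open>Pointwise t^p <= t + t^2, by the first term for t <= 1 and the second for t > 1.\<close>

lemma powr_norm_integrable:
  fixes f :: "real^'n \<Rightarrow> complex"
  assumes f: "integrable lborel f" and f2: "integrable lborel (\<lambda>x. (norm (f x))\<^sup>2)" and p: "1 \<le> p" "p \<le> 2"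
  shows "integrable lborel (\<lambda>x. norm (f x) powr p)"
proof (rule Bochner_Integration.integrable_bound)
  have [measurable]: "f \<in> borel_measurable borel" using f by (simp add: borel_measurable_integrable)
  show "integrable lborel (\<lambda>x. norm (f x) + (norm (f x))\<^sup>2)" using f f2 by simp
  show "(\<lambda>x. norm (f x) powr p) \<in> borel_measurable lborel" by measurable
  show "AE x in lborel. norm (norm (f x) powr p) \<le> norm (norm (f x) + (norm (f x))\<^sup>2)"
  proof (rule AE_I2)
    fix x
    have "norm (f x) powr p \<le> norm (f x) + (norm (f x))\<^sup>2"
    proof (cases "norm (f x) \<le> 1")
      case True
      have "norm (f x) powr p \<le> norm (f x) powr 1"
        by (rule powr_mono') (use True p in auto)
      then show ?thesis by (simp add: add_increasing2)
    next
      case False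
      then have "norm (f x) powr p \<le> norm (f x) powr 2" using p by (intro powr_mono) auto
      also have "\<dots> = (norm (f x))\<^sup>2" by simp
      finally show ?thesis by (simp add: add_increasing)
    qed
    then show "norm (norm (f x) powr p) \<le> norm (norm (f x) + (norm (f x))\<^sup>2)" by simp
  qed
qed

text \<open>Interpolation: each level set of \<open>f\<close> is estimated with the exponent \<open>\<theta>\<close>, and the hypothesis
  \<open>2 / d < \<theta> < 2 / p - 1\<close> makes the resulting geometric series converge.\<close>
lemma rotated_energy_le:
  fixes p :: real
  assumes d: "CARD('n::finite) \<ge> 5" and p1: "1 \<le> p" and p2: "p < 2 * real CARD('n) / (real CARD('n) + 2)"
  shows "\<exists>C\<ge>0. \<forall>(f :: real^'n \<Rightarrow> complex) \<mu>. haar_SO \<mu> \<longrightarrow> integrable lborel f \<longrightarrow> integrable lborel (\<lambda>x. (norm (f x))\<^sup>2)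
    \<longrightarrow> rotated_energy \<mu> f \<le> ennreal (C * (Lp_norm 2 f + Lp_norm p f)\<^sup>2)"
proof -
  define D where "D = real CARD('n)"
  have D: "D \<ge> 5" using d by (simp add: D_def)
  have pD: "p * (D + 2) < 2 * D" using p2 D by (simp add: D_def pos_less_divide_eq)
  have p2': "p < 2"
  proof -
    have "p * (D + 2) < 2 * (D + 2)" using pD by (simp add: distrib_left)
    then show ?thesis by (rule mult_right_less_imp_less) (use D in simp)
  qed
  \<comment> \<open>The midpoint of the admissible interval; \<open>gap\<close>, a rewriting of the
    hypothesis on p, says that the interval is nonempty.\<close>
  define \<theta> where "\<theta> = (2 / D + (2 / p - 1)) / 2"
  have gap: "2 / D < 2 / p - 1" using pD p1 D by (simp add: field_simps)
  have \<theta>1: "2 / D < \<theta>" "\<theta> < 2 / p - 1" using gap by (auto simp: \<theta>_def)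
  have \<theta>: "0 \<le> \<theta>" "\<theta> \<le> 1"
  proof -
    have "0 \<le> 2 / D" using D by simp
    then show "0 \<le> \<theta>" using \<theta>1 by linarith
    have "2 / p \<le> 2" using p1 by (simp add: divide_le_eq)
    then show "\<theta> \<le> 1" using \<theta>1 by linarith
  qed
  define s where "s = - (D * \<theta> / 2)"
  have "2 < \<theta> * D" using \<theta>1(1) D by (simp add: pos_divide_less_eq)
  then have s: "s < -1" by (simp add: s_def mult.commute)
  have sm: "summable (\<lambda>k. real k powr s)" using s by (simp add: summable_real_powr_iff)
  define Z where "Z = (\<Sum>k. real k powr s)"
  have Z: "(\<Sum>k=1..N. real k powr (- (real CARD('n) * \<theta> / 2))) \<le> Z" for N
    unfolding Z_def D_def[symmetric] s_def[symmetric] by (rule sum_le_suminf[OF sm]) auto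
  have Z0: "0 \<le> Z" using Z[of 0] by simp
  \<comment> \<open>The interpolated bound of slice i decays like 2 to the power -i \<sigma>: the
    exponent (2 - p)(1 - \<theta>) - 2(p - 1)\<theta> simplifies to 2 - p - \<theta> p. Its
    positivity is \<theta> < 2/p - 1.\<close>
  define \<sigma> where "\<sigma> = 2 - p - \<theta> * p"
  have "\<theta> * p < 2 - p" using \<theta>1(2) p1 by (simp add: field_simps)
  then have \<sigma>: "0 < \<sigma>" by (simp add: \<sigma>_def)
  \<comment> \<open>The energy of slice i is of order r^(2i): one factor r^i pays for the weight
    r^(-i) in \<open>rotated_energy_subadditive\<close>, the other makes the series
    converge.\<close>
  define r where "r = 2 powr (- (\<sigma> / 2))"
  have r: "0 < r" "r < 1"
    using powr_less_mono[of "- (\<sigma> / 2)" 0 2] \<sigma> by (auto simp: r_def)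
  define K where "K = 12 ^ CARD('n) * moment_const / radial_const CARD('n)"
  have K0: "0 \<le> K"
    using radial_const_pos[of "CARD('n)"] d by (auto simp: K_def moment_const_def intro!: divide_nonneg_nonneg)
  define L where "L = K * (2 + 4 * Z)"
  have L0: "0 \<le> L" using K0 Z0 by (simp add: L_def)
  \<comment> \<open>One factor 1/(1 - r) comes from Cauchy-Schwarz, the other from the geometric
    series.\<close>
  define C where "C = L / (1 - r)\<^sup>2"
  have C0: "0 \<le> C" using L0 by (simp add: C_def)
  show ?thesis
  proof (intro exI[of _ C] conjI C0 allI impI)
    fix f :: "real^'n \<Rightarrow> complex" and \<mu> :: "(real^'n^'n) measure"
    assume haar: "haar_SO \<mu>" and f: "integrable lborel f" and f2: "integrable lborel (\<lambda>x. (norm (f x))\<^sup>2)"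
    have [measurable]: "f \<in> borel_measurable borel" using f by (simp add: borel_measurable_integrable)
    have fp: "integrable lborel (\<lambda>x. norm (f x) powr p)" using powr_norm_integrable[OF f f2 p1] p2' by simp
    define \<tau> where "\<tau> = Lp_norm 2 f + Lp_norm p f"
    have n0: "0 \<le> Lp_norm 2 f" "0 \<le> Lp_norm p f" by (auto simp: Lp_norm_def)
    have e2: "(\<integral>x. (norm (f x))\<^sup>2 \<partial>lborel) = (Lp_norm 2 f)\<^sup>2"
    proof -
      have "0 \<le> (\<integral>x. (norm (f x))\<^sup>2 \<partial>lborel)" by (intro integral_nonneg_AE) simp
      then show ?thesis by (simp add: Lp_norm_def powr_half_sqrt)
    qed
    have ep: "(\<integral>x. norm (f x) powr p \<partial>lborel) = Lp_norm p f powr p"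
    proof -
      have "0 \<le> (\<integral>x. norm (f x) powr p \<partial>lborel)" by (intro integral_nonneg_AE) simp
      then show ?thesis using p1 by (simp add: Lp_norm_def powr_powr)
    qed
    have b2: "(\<integral>x. (norm (f x))\<^sup>2 \<partial>lborel) \<le> \<tau>\<^sup>2" unfolding e2 \<tau>_def using n0 by (intro power_mono) auto
    have bp: "(\<integral>x. norm (f x) powr p \<partial>lborel) \<le> \<tau> powr p" unfolding ep \<tau>_def using n0 p1 by (intro powr_mono2) auto
    show "rotated_energy \<mu> f \<le> ennreal (C * (Lp_norm 2 f + Lp_norm p f)\<^sup>2)"
    proof (cases "\<tau> = 0")
      \<comment> \<open>\<tau> is the height of the slices, so 0 is treated apart: the squared L^2
        norm vanishes, and with \<open>0 powr x = 0\<close> so does the energy bound.\<close>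
      case True
      then have "Lp_norm 2 f = 0" using n0 by (simp add: \<tau>_def)
      then have z: "(\<integral>x. (norm (f x))\<^sup>2 \<partial>lborel) = 0" using e2 by simp
      show ?thesis using rotated_energy_bound[OF haar f d f2 \<theta> Z] unfolding z by simp
    next
      case False
      then have \<tau>: "\<tau> > 0" using n0 by (simp add: \<tau>_def)
      have piece: "rotated_energy \<mu> (level_cut \<tau> f i) \<le> ennreal (L * \<tau>\<^sup>2 * (r ^ i)\<^sup>2)" for i
      proof -
        let ?g = "level_cut \<tau> f i"
        let ?A2 = "\<integral>x. (norm (?g x))\<^sup>2 \<partial>lborel" let ?A1 = "\<integral>x. norm (?g x) \<partial>lborel"
        have g: "integrable lborel ?g"
          using f by (rule Bochner_Integration.integrable_bound) (auto simp: norm_level_cut_le)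
        have g2: "integrable lborel (\<lambda>x. (norm (?g x))\<^sup>2)"
          using f2 by (rule Bochner_Integration.integrable_bound) (auto simp: norm_level_cut_le power_mono)
        note m = level_cut_moments[OF \<tau> p1 p2' f f2 fp b2 bp, of i]
        have A0: "0 \<le> ?A2" "0 \<le> ?A1" by (auto intro!: integral_nonneg_AE)
        have rr: "(r ^ i)\<^sup>2 = 2 powr (- (real i * \<sigma>))"
        proof -
          have "(r ^ i)\<^sup>2 = r ^ (i * 2)" by (rule power_mult[symmetric])
          also have "\<dots> = r powr real (i * 2)" by (rule powr_realpow[OF r(1), symmetric])
          also have "\<dots> = 2 powr (- (real i * \<sigma>))" by (simp add: r_def powr_powr mult.commute)
          finally show ?thesis .
        qed
        have 1: "?A2 \<le> 2 * \<tau>\<^sup>2 * (r ^ i)\<^sup>2"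
        proof -
          have "2 powr (- (real i * (2 - p))) \<le> (2::real) powr (- (real i * \<sigma>))"
            using \<theta> p1 by (intro powr_mono) (auto simp: \<sigma>_def intro!: mult_left_mono)
          then have "2 * \<tau>\<^sup>2 * 2 powr (- (real i * (2 - p))) \<le> 2 * \<tau>\<^sup>2 * (r ^ i)\<^sup>2"
            unfolding rr by (intro mult_left_mono) auto
          then show ?thesis using m(1) by linarith
        qed
        have 2: "?A2 powr (1 - \<theta>) * (?A1\<^sup>2) powr \<theta> \<le> 2 * \<tau>\<^sup>2 * (r ^ i)\<^sup>2"
        proof -
          have "?A2 powr (1 - \<theta>) * (?A1\<^sup>2) powr \<theta> \<le> (2 * \<tau>\<^sup>2 * 2 powr (- (real i * (2 - p)))) powr (1 - \<theta>) * ((\<tau> * 2 powr (real i * (p - 1)))\<^sup>2) powr \<theta>"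
            using m A0 \<theta> by (intro mult_mono powr_mono2 power_mono) auto
          also have "(2 * \<tau>\<^sup>2 * 2 powr (- (real i * (2 - p)))) powr (1 - \<theta>) = 2 powr (1 - \<theta>) * ((\<tau>\<^sup>2) powr (1 - \<theta>) * 2 powr (- (real i * (2 - p)) * (1 - \<theta>)))"
            by (simp add: powr_mult powr_powr)
          also have "((\<tau> * 2 powr (real i * (p - 1)))\<^sup>2) powr \<theta> = (\<tau>\<^sup>2) powr \<theta> * 2 powr (2 * real i * (p - 1) * \<theta>)"
          proof -
            have "((2::real) powr (real i * (p - 1)))\<^sup>2 = 2 powr (2 * (real i * (p - 1)))"
              by (simp add: power2_eq_square flip: powr_add)
            then show ?thesis by (simp add: power_mult_distrib powr_mult powr_powr mult_ac)
          qed
          also have "2 powr (1 - \<theta>) * ((\<tau>\<^sup>2) powr (1 - \<theta>) * 2 powr (- (real i * (2 - p)) * (1 - \<theta>))) * ((\<tau>\<^sup>2) powr \<theta> * 2 powr (2 * real i * (p - 1) * \<theta>))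
            = 2 powr (1 - \<theta>) * (((\<tau>\<^sup>2) powr (1 - \<theta>) * (\<tau>\<^sup>2) powr \<theta>) * (2 powr (- (real i * (2 - p)) * (1 - \<theta>)) * 2 powr (2 * real i * (p - 1) * \<theta>)))"
            by (simp only: mult_ac)
          also have "(\<tau>\<^sup>2) powr (1 - \<theta>) * (\<tau>\<^sup>2) powr \<theta> = \<tau>\<^sup>2" using \<tau> by (simp flip: powr_add)
          also have "2 powr (- (real i * (2 - p)) * (1 - \<theta>)) * 2 powr (2 * real i * (p - 1) * \<theta>) = (r ^ i)\<^sup>2"
            unfolding rr powr_add[symmetric] \<sigma>_def by (rule arg_cong[of _ _ "(powr) 2"]) (simp add: algebra_simps)
          also have "2 powr (1 - \<theta>) * (\<tau>\<^sup>2 * (r ^ i)\<^sup>2) \<le> 2 * (\<tau>\<^sup>2 * (r ^ i)\<^sup>2)"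
            using powr_mono[of "1 - \<theta>" 1 2] \<theta> by (intro mult_right_mono) auto
          finally show ?thesis by simp
        qed
        have "?A2 + 2 * Z * (?A2 powr (1 - \<theta>) * (?A1\<^sup>2) powr \<theta>) \<le> 2 * \<tau>\<^sup>2 * (r ^ i)\<^sup>2 + 2 * Z * (2 * \<tau>\<^sup>2 * (r ^ i)\<^sup>2)"
          using 1 2 Z0 by (intro add_mono mult_left_mono) auto
        also have "\<dots> = (2 + 4 * Z) * (\<tau>\<^sup>2 * (r ^ i)\<^sup>2)" by (simp add: algebra_simps)
        finally have "K * (?A2 + 2 * Z * (?A2 powr (1 - \<theta>) * (?A1\<^sup>2) powr \<theta>)) \<le> K * ((2 + 4 * Z) * (\<tau>\<^sup>2 * (r ^ i)\<^sup>2))"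
          using K0 by (rule mult_left_mono)
        also have "\<dots> = L * \<tau>\<^sup>2 * (r ^ i)\<^sup>2" by (simp only: L_def mult.assoc)
        finally have "ennreal (K * (?A2 + 2 * Z * (?A2 powr (1 - \<theta>) * (?A1\<^sup>2) powr \<theta>))) \<le> ennreal (L * \<tau>\<^sup>2 * (r ^ i)\<^sup>2)"
          by (rule ennreal_leI)
        then show ?thesis
          using rotated_energy_bound[OF haar g d g2 \<theta> Z] unfolding K_def by (rule order_trans[rotated])
      qed
      have "rotated_energy \<mu> f \<le> (\<Sum>i. ennreal (1 / (1 - r) / r ^ i) * rotated_energy \<mu> (level_cut \<tau> f i))"
        by (rule rotated_energy_subadditive[OF haar r]) (measurable, rule fhat_level_cut_sums[OF \<tau> f])
      also have "\<dots> \<le> (\<Sum>i. ennreal (1 / (1 - r) / r ^ i) * ennreal (L * \<tau>\<^sup>2 * (r ^ i)\<^sup>2))"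
        by (intro suminf_le mult_left_mono piece summableI) auto
      also have "\<dots> = (\<Sum>i. ennreal (L * \<tau>\<^sup>2 / (1 - r) * r ^ i))"
      proof (rule suminf_cong)
        fix i
        have "ennreal (1 / (1 - r) / r ^ i) * ennreal (L * \<tau>\<^sup>2 * (r ^ i)\<^sup>2) = ennreal (1 / (1 - r) / r ^ i * (L * \<tau>\<^sup>2 * (r ^ i)\<^sup>2))"
          using r L0 by (intro ennreal_mult[symmetric]) auto
        also have "1 / (1 - r) / r ^ i * (L * \<tau>\<^sup>2 * (r ^ i)\<^sup>2) = L * \<tau>\<^sup>2 / (1 - r) * r ^ i"
          using r by (simp add: power2_eq_square)
        finally show "ennreal (1 / (1 - r) / r ^ i) * ennreal (L * \<tau>\<^sup>2 * (r ^ i)\<^sup>2) = ennreal (L * \<tau>\<^sup>2 / (1 - r) * r ^ i)" .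
      qed
      also have "\<dots> = ennreal (\<Sum>i. L * \<tau>\<^sup>2 / (1 - r) * r ^ i)"
        using r L0 by (intro suminf_ennreal2 summable_mult summable_geometric) auto
      also have "(\<Sum>i. L * \<tau>\<^sup>2 / (1 - r) * r ^ i) = L * \<tau>\<^sup>2 / (1 - r) * (\<Sum>i. r ^ i)"
        by (rule suminf_mult) (use r in \<open>simp add: summable_geometric\<close>)
      also have "(\<Sum>i. r ^ i) = 1 / (1 - r)" by (rule suminf_geometric) (use r in simp)
      also have "L * \<tau>\<^sup>2 / (1 - r) * (1 / (1 - r)) = C * \<tau>\<^sup>2" by (simp add: C_def power2_eq_square)
      finally show ?thesis unfolding \<tau>_def .
    qed
  qed
qed

section \<open>Back to the periodizations\<close>

lemma infsum_nat_complex: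
  fixes g :: "nat \<Rightarrow> complex"
  shows "infsum g UNIV = (if summable (\<lambda>k. norm (g k)) then suminf g else 0)"
proof (cases "summable (\<lambda>k. norm (g k))")
  case True
  then have "(g has_sum suminf g) UNIV"
    by (intro norm_summable_imp_has_sum summable_sums summable_norm_cancel[OF True])
  then show ?thesis using True by (simp add: infsumI)
next
  case False
  have "\<not> g summable_on UNIV"
  proof
    assume "g summable_on UNIV"
    then have "(\<lambda>k. norm (g k)) summable_on UNIV" by (simp add: summable_on_iff_abs_summable_on_complex)
    then have "summable (\<lambda>k. norm (g k))" by (rule summable_on_imp_summable)
    then show False using False by simp
  qed
  then show ?thesis using False by (simp add: infsum_not_exists)
qed

text \<open>Unordered summation of complex numbers is absolute, and \<open>infsum\<close> is 0 where
  it fails. The case distinction reproduces this default, which makes the measurability in x a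
  statement about every point and not only up to a null set.\<close>

lemma periodization_eq:
  assumes e: "bij_betw e UNIV int_lattice"
  shows "periodization f \<rho> x = (if (\<Sum>k. ennreal (norm (f (\<rho> *v (x + e k))))) \<noteq> \<top> then (\<Sum>k. f (\<rho> *v (x + e k))) else 0)"
proof -
  have "bij_betw (uminus \<circ> e) UNIV int_lattice"
    by (rule bij_betw_trans[OF e], rule bij_betw_byWitness[of _ uminus]) (auto intro: int_lattice_uminus)
  then have b: "bij_betw (\<lambda>k. - e k) UNIV int_lattice" by (simp add: o_def)
  have "periodization f \<rho> x = infsum (\<lambda>k. f (\<rho> *v (x - (- e k)))) UNIV"
    unfolding periodization_def by (rule infsum_reindex_bij_betw[OF b, symmetric])
  also have "\<dots> = infsum (\<lambda>k. f (\<rho> *v (x + e k))) UNIV" by (simp only: diff_minus_eq_add)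
  finally have eq: "periodization f \<rho> x = infsum (\<lambda>k. f (\<rho> *v (x + e k))) UNIV" .
  have iff: "summable (\<lambda>k. norm (f (\<rho> *v (x + e k)))) \<longleftrightarrow> (\<Sum>k. ennreal (norm (f (\<rho> *v (x + e k))))) \<noteq> \<top>"
  proof
    assume "summable (\<lambda>k. norm (f (\<rho> *v (x + e k))))"
    then show "(\<Sum>k. ennreal (norm (f (\<rho> *v (x + e k))))) \<noteq> \<top>"
      by (rule ennreal_suminf_neq_top) (rule norm_ge_zero)
  next
    assume "(\<Sum>k. ennreal (norm (f (\<rho> *v (x + e k))))) \<noteq> \<top>"
    then show "summable (\<lambda>k. norm (f (\<rho> *v (x + e k))))"
      by (rule summable_suminf_not_top[rotated]) (rule norm_ge_zero)
  qed
  show ?thesis unfolding eq infsum_nat_complex iff ..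
qed

lemma measurable_periodization:
  assumes [measurable]: "f \<in> borel_measurable borel"
  shows "periodization f \<rho> \<in> borel_measurable borel"
proof -
  obtain e :: "nat \<Rightarrow> real^'a" where e: "bij_betw e UNIV int_lattice" by (rule int_lattice_enum)
  have "(\<lambda>x. if (\<Sum>k. ennreal (norm (f (\<rho> *v (x + e k))))) \<noteq> \<top> then (\<Sum>k. f (\<rho> *v (x + e k))) else 0) \<in> borel_measurable borel"
    by measurable
  then show ?thesis by (simp only: periodization_eq[OF e, symmetric] eta_contract_eq)
qed

lemma fhat_rotate:
  fixes f :: "real^'n \<Rightarrow> complex"
  assumes \<rho>: "orthogonal_matrix \<rho>" and f: "integrable lborel f"
  shows "integrable lborel (\<lambda>x. f (\<rho> *v x))" and "fhat (\<lambda>x. f (\<rho> *v x)) v = fhat f (\<rho> *v v)"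
proof -
  have [measurable]: "f \<in> borel_measurable borel" using f by (simp add: borel_measurable_integrable)
  have "integrable (distr lborel borel (\<lambda>x. \<rho> *v x)) f" using f by (simp add: lborel_orthogonal[OF \<rho>])
  then show "integrable lborel (\<lambda>x. f (\<rho> *v x))" by (subst (asm) integrable_distr_eq) auto
  have "fhat f (\<rho> *v v) = (\<integral>y. f y * ee (- ((\<rho> *v v) \<bullet> y)) \<partial>distr lborel borel (\<lambda>x. \<rho> *v x))"
    unfolding fhat_def lborel_orthogonal[OF \<rho>] ..
  also have "\<dots> = (\<integral>x. f (\<rho> *v x) * ee (- ((\<rho> *v v) \<bullet> (\<rho> *v x))) \<partial>lborel)"
    by (rule integral_distr) measurable
  finally show "fhat (\<lambda>x. f (\<rho> *v x)) v = fhat f (\<rho> *v v)"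
    unfolding fhat_def orthogonal_matrix_inner[OF \<rho>] by simp
qed

text \<open>Periodizing f along the rotated lattice is periodizing f composed with \<rho> along the
  integer lattice; the transform of the composition at v is that of f at \<rho> v, and
  \<open>parseval_le\<close> applies.\<close>

lemma periodization_rotation:
  fixes f :: "real^'n \<Rightarrow> complex"
  assumes d: "CARD('n) \<ge> 5" and \<rho>: "orthogonal_matrix \<rho>" and f: "integrable lborel f"
  shows "(\<integral>\<^sup>+x\<in>unit_cube. ennreal ((norm (periodization f \<rho> x - fourier_coeff (periodization f \<rho>) 0))\<^sup>2) \<partial>lborel)
      \<le> lattice_energy (\<lambda>v. (norm (fhat f (\<rho> *v v)))\<^sup>2)"
proof -
  have [measurable]: "f \<in> borel_measurable borel" using f by (simp add: borel_measurable_integrable)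
  obtain e :: "nat \<Rightarrow> real^'n" where e: "bij_betw e UNIV int_lattice" by (rule int_lattice_enum)
  define F where "F = (\<lambda>x. f (\<rho> *v x))"
  have F: "integrable lborel F" unfolding F_def by (rule fhat_rotate(1)[OF \<rho> f])
  have [measurable]: "F \<in> borel_measurable borel" unfolding F_def by measurable
  note measurable_periodization[measurable]
  have AE: "AE x in lborel. x \<in> cube 0 \<longrightarrow> periodization f \<rho> x = (\<Sum>k. F (x + e k))"
    using AE_summable_tile[OF e F, of 0]
  proof eventually_elim
    fix x assume s: "x \<in> cube 0 \<longrightarrow> summable (\<lambda>k. norm (F (x + e k)))"
    show "x \<in> cube 0 \<longrightarrow> periodization f \<rho> x = (\<Sum>k. F (x + e k))"
    proof
      assume "x \<in> cube 0"
      then have "(\<Sum>k. ennreal (norm (F (x + e k)))) \<noteq> \<top>"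
        using s by (intro ennreal_suminf_neq_top) auto
      then show "periodization f \<rho> x = (\<Sum>k. F (x + e k))"
        unfolding periodization_eq[OF e] F_def by simp
    qed
  qed
  have fc: "fourier_coeff (periodization f \<rho>) 0 = (\<integral>x. F x \<partial>lborel)"
  proof -
    have "fourier_coeff (periodization f \<rho>) 0 = (\<integral>x. indicator (cube 0) x *\<^sub>R periodization f \<rho> x \<partial>lborel)"
      by (simp add: fourier_coeff_def set_lebesgue_integral_def unit_cube_eq)
    also have "\<dots> = (\<integral>x. indicator (cube 0) x *\<^sub>R (\<Sum>k. F (x + e k)) \<partial>lborel)"
      using AE by (intro integral_cong_AE) (auto elim!: eventually_mono simp: indicator_def)
    also have "\<dots> = (\<integral>x. F x \<partial>lborel)" by (rule integral_tile[OF e F])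
    finally show ?thesis .
  qed
  have "(\<integral>\<^sup>+x\<in>unit_cube. ennreal ((norm (periodization f \<rho> x - fourier_coeff (periodization f \<rho>) 0))\<^sup>2) \<partial>lborel)
      = (\<integral>\<^sup>+x. indicator (cube 0) x * ennreal ((norm ((\<Sum>k. F (x + e k)) - (\<integral>x. F x \<partial>lborel)))\<^sup>2) \<partial>lborel)"
    unfolding fc unit_cube_eq
  proof (rule nn_integral_cong_AE, use AE in eventually_elim)
    fix x assume "x \<in> cube 0 \<longrightarrow> periodization f \<rho> x = (\<Sum>k. F (x + e k))"
    then show "ennreal ((norm (periodization f \<rho> x - (\<integral>x. F x \<partial>lborel)))\<^sup>2) * indicator (cube 0) x
       = indicator (cube 0) x * ennreal ((norm ((\<Sum>k. F (x + e k)) - (\<integral>x. F x \<partial>lborel)))\<^sup>2)"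
      by (cases "x \<in> cube 0") simp_all
  qed
  also have "\<dots> \<le> lattice_energy (\<lambda>v. (norm (fhat F v))\<^sup>2)" by (rule parseval_le[OF d F e])
  also have "fhat F = (\<lambda>v. fhat f (\<rho> *v v))" unfolding F_def by (rule ext) (rule fhat_rotate(2)[OF \<rho> f])
  finally show ?thesis .
qed

text \<open>The cube has measure 1, so adding the constant back costs a finite amount: |g|^2 <= 2 |g
  - c|^2 + 2 |c|^2.\<close>

lemma set_integrable_norm_sq:
  fixes g :: "real^'n \<Rightarrow> complex"
  assumes [measurable]: "g \<in> borel_measurable borel"
    and fin: "(\<integral>\<^sup>+x\<in>unit_cube. ennreal ((norm (g x - c))\<^sup>2) \<partial>lborel) < \<infinity>"
  shows "set_integrable lborel unit_cube (\<lambda>x. (norm (g x))\<^sup>2)"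
  unfolding set_integrable_def unit_cube_eq
proof (rule integrableI_bounded)
  have "(\<integral>\<^sup>+x. ennreal (norm (indicator (cube 0) x *\<^sub>R (norm (g x))\<^sup>2)) \<partial>(lborel :: (real^'n) measure)) \<le>
      (\<integral>\<^sup>+x. 2 * (ennreal ((norm (g x - c))\<^sup>2) * indicator (cube 0) x) + ennreal (2 * (norm c)\<^sup>2) * indicator (cube 0) x \<partial>lborel)"
  proof (rule nn_integral_mono)
    fix x :: "real^'n"
    have "norm (g x) \<le> norm (g x - c) + norm c" using norm_triangle_ineq[of "g x - c" c] by simp
    then have "(norm (g x))\<^sup>2 \<le> (norm (g x - c) + norm c)\<^sup>2" by (intro power_mono) auto
    also have "\<dots> \<le> 2 * (norm (g x - c))\<^sup>2 + 2 * (norm c)\<^sup>2"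
      using sum_squares_bound[of "norm (g x - c)" "norm c"] by (simp add: power2_sum)
    finally have "ennreal ((norm (g x))\<^sup>2) \<le> ennreal (2 * (norm (g x - c))\<^sup>2 + 2 * (norm c)\<^sup>2)" by (rule ennreal_leI)
    also have "\<dots> = 2 * ennreal ((norm (g x - c))\<^sup>2) + ennreal (2 * (norm c)\<^sup>2)"
      by (simp add: ennreal_plus ennreal_mult)
    finally show "ennreal (norm (indicator (cube 0) x *\<^sub>R (norm (g x))\<^sup>2)) \<le> 2 * (ennreal ((norm (g x - c))\<^sup>2) * indicator (cube 0) x) + ennreal (2 * (norm c)\<^sup>2) * indicator (cube 0) x"
      by (cases "x \<in> cube 0") simp_all
  qed
  also have "\<dots> = 2 * (\<integral>\<^sup>+x. ennreal ((norm (g x - c))\<^sup>2) * indicator (cube 0) x \<partial>lborel) + ennreal (2 * (norm c)\<^sup>2)"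
    by (simp add: nn_integral_add nn_integral_cmult nn_integral_cmult_indicator emeasure_cube)
  also have "\<dots> < \<infinity>"
    using fin unfolding unit_cube_eq by (simp add: ennreal_mult_less_top)
  finally show "(\<integral>\<^sup>+x. ennreal (norm (indicator (cube 0) x *\<^sub>R (norm (g x))\<^sup>2)) \<partial>(lborel :: (real^'n) measure)) < \<infinity>" .
qed measurable

theorem theorem2:
  fixes p :: real
  assumes d5: "CARD('n) \<ge> 5"
    and p1: "1 \<le> p"
    and p2: "p < 2 * real CARD('n) / (real CARD('n) + 2)"
  shows "\<exists>C::real. \<forall>(f :: real^'n \<Rightarrow> complex) (\<mu> :: (real^'n^'n) measure).
           haar_SO \<mu> \<longrightarrow> f \<in> borel_measurable lborel \<longrightarrow> integrable lborel f \<longrightarrow>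
           integrable lborel (\<lambda>x. (norm (f x))\<^sup>2) \<longrightarrow>
           (AE \<rho> in \<mu>. set_borel_measurable lborel unit_cube (periodization f \<rho>) \<and>
                        set_integrable lborel unit_cube (\<lambda>x. (norm (periodization f \<rho> x))\<^sup>2))
           \<and> (\<integral>\<^sup>+ \<rho>. (\<integral>\<^sup>+ x \<in> unit_cube.
                 ennreal ((norm (periodization f \<rho> x - fourier_coeff (periodization f \<rho>) 0))\<^sup>2) \<partial>lborel) \<partial>\<mu>)
               \<le> ennreal (C * (Lp_norm 2 f + Lp_norm p f)\<^sup>2)"
proof -
  obtain C where C: "\<And>(f :: real^'n \<Rightarrow> complex) \<mu>. haar_SO \<mu> \<Longrightarrow> integrable lborel f \<Longrightarrow> integrable lborel (\<lambda>x. (norm (f x))\<^sup>2)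
    \<Longrightarrow> rotated_energy \<mu> f \<le> ennreal (C * (Lp_norm 2 f + Lp_norm p f)\<^sup>2)"
    using rotated_energy_le[OF d5 p1 p2] by blast
  show ?thesis
  proof (intro exI[of _ C] allI impI)
    fix f :: "real^'n \<Rightarrow> complex" and \<mu> :: "(real^'n^'n) measure"
    assume haar: "haar_SO \<mu>" and f: "integrable lborel f" and f2: "integrable lborel (\<lambda>x. (norm (f x))\<^sup>2)"
    have [measurable_cong]: "sets \<mu> = sets borel" using haar by (simp add: haar_SO_def)
    have fm[measurable]: "f \<in> borel_measurable borel" using f by (simp add: borel_measurable_integrable)
    let ?E = "\<lambda>\<rho>. lattice_energy (\<lambda>v. (norm (fhat f (\<rho> *v v)))\<^sup>2)"
    let ?I = "\<lambda>\<rho>. \<integral>\<^sup>+x\<in>unit_cube. ennreal ((norm (periodization f \<rho> x - fourier_coeff (periodization f \<rho>) 0))\<^sup>2) \<partial>lborel"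
    have le: "AE \<rho> in \<mu>. ?I \<rho> \<le> ?E \<rho>"
      using haar_SO_AE[OF haar] by eventually_elim (auto simp: SO_def intro!: periodization_rotation[OF d5 _ f])
    have "(\<integral>\<^sup>+\<rho>. ?I \<rho> \<partial>\<mu>) \<le> rotated_energy \<mu> f"
      unfolding rotated_energy_def by (rule nn_integral_mono_AE[OF le])
    also note C[OF haar f f2]
    finally have 2: "(\<integral>\<^sup>+\<rho>. ?I \<rho> \<partial>\<mu>) \<le> ennreal (C * (Lp_norm 2 f + Lp_norm p f)\<^sup>2)" .
    have "(\<integral>\<^sup>+\<rho>. ?E \<rho> \<partial>\<mu>) \<noteq> \<infinity>"
      using C[OF haar f f2] unfolding rotated_energy_def by (auto simp: top_unique)
    moreover have "?E \<in> borel_measurable \<mu>"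
      using measurable_lattice_energy[OF fm] by measurable
    \<comment> \<open>A finite average of the lattice energies makes them finite for almost every
      rotation; membership in L^2 is thus a consequence of the quantitative bound.\<close>
    ultimately have "AE \<rho> in \<mu>. ?E \<rho> \<noteq> \<infinity>"
      by (intro nn_integral_PInf_AE)
    then have 1: "AE \<rho> in \<mu>. set_borel_measurable lborel unit_cube (periodization f \<rho>) \<and>
        set_integrable lborel unit_cube (\<lambda>x. (norm (periodization f \<rho> x))\<^sup>2)"
      using le
    proof eventually_elim
      fix \<rho> assume "?E \<rho> \<noteq> \<infinity>" "?I \<rho> \<le> ?E \<rho>"
      then have fin: "?I \<rho> < \<infinity>" by (auto simp: less_top[symmetric] top_unique)
      have [measurable]: "periodization f \<rho> \<in> borel_measurable borel" by (rule measurable_periodization[OF fm])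
      have "set_borel_measurable lborel unit_cube (periodization f \<rho>)"
        unfolding set_borel_measurable_def unit_cube_eq by measurable
      moreover have "set_integrable lborel unit_cube (\<lambda>x. (norm (periodization f \<rho> x))\<^sup>2)"
        by (rule set_integrable_norm_sq[OF _ fin]) measurable
      ultimately show "set_borel_measurable lborel unit_cube (periodization f \<rho>) \<and>
        set_integrable lborel unit_cube (\<lambda>x. (norm (periodization f \<rho> x))\<^sup>2)" by (rule conjI)
    qed
    from 1 2 show "(AE \<rho> in \<mu>. set_borel_measurable lborel unit_cube (periodization f \<rho>) \<and>
        set_integrable lborel unit_cube (\<lambda>x. (norm (periodization f \<rho> x))\<^sup>2)) \<and>
        (\<integral>\<^sup>+\<rho>. ?I \<rho> \<partial>\<mu>) \<le> ennreal (C * (Lp_norm 2 f + Lp_norm p f)\<^sup>2)"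
      by (rule conjI)
  qed
qed

end
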